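(* Let $\Sigma$ be an $n$-dimensional smooth, connected, embedded submanifold of $\mathbb{R}^{n+k}$ (possibly with boundary). If $\lambda[\Sigma]=1$, then $\Sigma$ is flat, that is, the second fundamental form of $\Sigma$ vanishes at every point $x\in\Sigma$. In particular, if $\Sigma$ is properly embedded in $\mathbb{R}^{n+k}$, then $\Sigma$ is an $n$-dimensional plane.
   Context: The entropy of an $n$-dimensional submanifold $\Sigma\subseteq\mathbb{R}^{n+k}$ is $$\lambda[\Sigma]=\sup_{x_0\in\mathbb{R}^{n+k},\,t_0>0}\int_\Sigma \frac{1}{(4\pi t_0)^{n/2}}e^{-\frac{|x-x_0|^2}{4t_0}}\,d\mathcal{H}^n(x),$$ where $\mathcal{H}^n$ is $n$-dimensional Hausdorff measure. With this normalization an $n$-dimensional plane has entropy $1$. Planes are affine, i.e. not required to pass through the origin. *)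

theory Defs
  imports "HOL-Analysis.Analysis"
begin

subsection \<open>Hausdorff measure and entropy\<close>

text \<open>
  Coverings use sets of diameter at most \<open>\<delta>\<close>. Boundedness is required because
  \<^const>\<open>diameter\<close> has no meaning on unbounded sets. Empty sets contribute \<open>0\<close>, also for \<open>n = 0\<close>.
\<close>

definition hausdorff_pre :: "nat \<Rightarrow> real \<Rightarrow> 'a::metric_space set \<Rightarrow> ennreal" where
  "hausdorff_pre n \<delta> A =
     Inf {(\<Sum>i. if C i = {} then 0 else ennreal (unit_ball_vol (real n) * (diameter (C i) / 2) ^ n))
          | C :: nat \<Rightarrow> 'a set.
            A \<subseteq> (\<Union>i. C i) \<and> (\<forall>i. bounded (C i) \<and> diameter (C i) \<le> \<delta>)}"

definition hausdorff_outer :: "nat \<Rightarrow> 'a::metric_space set \<Rightarrow> ennreal" where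
  "hausdorff_outer n A = (SUP \<delta>\<in>{0<..}. hausdorff_pre n \<delta> A)"

text \<open>
  \<^const>\<open>hausdorff_outer\<close> is a metric outer measure, hence countably additive on the Borel sets by
  Caratheodory's criterion, so that \<^const>\<open>measure_of\<close> yields its restriction to the Borel sets.
\<close>

definition hausdorff_measure :: "nat \<Rightarrow> 'a::metric_space measure" where
  "hausdorff_measure n = measure_of UNIV (sets borel) (hausdorff_outer n)"

definition entropy :: "nat \<Rightarrow> 'a::euclidean_space set \<Rightarrow> ennreal" where
  "entropy n \<Sigma> =
     (SUP x0. SUP t0\<in>{0<..}. \<integral>\<^sup>+x\<in>\<Sigma>.
        ennreal (1 / (4 * pi * t0) powr (real n / 2) * exp (- ((norm (x - x0))\<^sup>2 / (4 * t0))))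
      \<partial>hausdorff_measure n)"


subsection \<open>Smooth maps\<close>

text \<open>Only meaningful on open sets \<open>S\<close>.\<close>

primrec Ck_on :: "nat \<Rightarrow> ('a::real_normed_vector \<Rightarrow> 'b::real_normed_vector) \<Rightarrow> 'a set \<Rightarrow> bool" where
  "Ck_on 0 f S \<longleftrightarrow> continuous_on S f"
| "Ck_on (Suc k) f S \<longleftrightarrow>
     (\<forall>x\<in>S. f differentiable (at x)) \<and> (\<forall>v. Ck_on k (\<lambda>x. frechet_derivative f (at x) v) S)"

definition smooth_on :: "('a::real_normed_vector \<Rightarrow> 'b::real_normed_vector) \<Rightarrow> 'a set \<Rightarrow> bool" where
  "smooth_on f S \<longleftrightarrow> (\<forall>k. Ck_on k f S)"

definition smooth_diffeo ::
  "'a::real_normed_vector set \<Rightarrow> 'b::real_normed_vector set \<Rightarrow> ('a \<Rightarrow> 'b) \<Rightarrow> ('b \<Rightarrow> 'a) \<Rightarrow> bool" where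
  "smooth_diffeo U V \<phi> \<psi> \<longleftrightarrow>
     open U \<and> open V \<and> homeomorphism U V \<phi> \<psi> \<and> smooth_on \<phi> U \<and> smooth_on \<psi> V"


subsection \<open>Embedded submanifolds with boundary\<close>

text \<open>
  Local (half-)slice condition: near each point, an ambient diffeomorphism takes \<open>\<Sigma>\<close> to an
  \<open>n\<close>-dimensional linear subspace \<open>L\<close>, or to a closed half-space \<open>{y \<in> L. 0 \<le> e \<bullet> y}\<close> of it with
  the given point on the bounding hyperplane.
\<close>

definition interior_point :: "nat \<Rightarrow> 'a::euclidean_space set \<Rightarrow> 'a \<Rightarrow> bool" where
  "interior_point n \<Sigma> p \<longleftrightarrow>
     (\<exists>U V (\<phi>::'a \<Rightarrow> 'a) \<psi> L. p \<in> U \<and> smooth_diffeo U V \<phi> \<psi> \<and> subspace L \<and> dim L = n \<and>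
        \<phi> ` (U \<inter> \<Sigma>) = V \<inter> L)"

definition boundary_point :: "nat \<Rightarrow> 'a::euclidean_space set \<Rightarrow> 'a \<Rightarrow> bool" where
  "boundary_point n \<Sigma> p \<longleftrightarrow>
     (\<exists>U V (\<phi>::'a \<Rightarrow> 'a) \<psi> L e. p \<in> U \<and> smooth_diffeo U V \<phi> \<psi> \<and> subspace L \<and> dim L = n \<and>
        e \<in> L \<and> e \<noteq> 0 \<and> \<phi> ` (U \<inter> \<Sigma>) = V \<inter> {y \<in> L. 0 \<le> e \<bullet> y} \<and> e \<bullet> \<phi> p = 0)"

definition submanifold :: "nat \<Rightarrow> 'a::euclidean_space set \<Rightarrow> bool" where
  "submanifold n \<Sigma> \<longleftrightarrow> (\<forall>p\<in>\<Sigma>. interior_point n \<Sigma> p \<or> boundary_point n \<Sigma> p)"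

definition manifold_boundary :: "nat \<Rightarrow> 'a::euclidean_space set \<Rightarrow> 'a set" where
  "manifold_boundary n \<Sigma> = {p \<in> \<Sigma>. boundary_point n \<Sigma> p}"

text \<open>
  A properly embedded submanifold of a manifold \<open>M\<close> has a proper inclusion map and its boundary
  lies in the boundary of \<open>M\<close>. For \<open>M\<close> a Euclidean space the latter is empty. (Closed
  half-planes and closed disks are flat, have entropy 1 and a proper inclusion, but are not planes.)
\<close>

definition properly_embedded :: "nat \<Rightarrow> 'a::euclidean_space set \<Rightarrow> bool" where
  "properly_embedded n \<Sigma> \<longleftrightarrow>
     submanifold n \<Sigma> \<and> manifold_boundary n \<Sigma> = {} \<and> (\<forall>K. compact K \<longrightarrow> compact (\<Sigma> \<inter> K))"

definition is_plane :: "nat \<Rightarrow> 'a::euclidean_space set \<Rightarrow> bool" where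
  "is_plane n P \<longleftrightarrow> affine P \<and> aff_dim P = int n"


subsection \<open>Tangent spaces and second fundamental form\<close>

text \<open>
  Velocities of smooth curves that stay in \<open>\<Sigma>\<close> on one side of \<open>0\<close>, so that at a boundary
  point the result is the full tangent space, with inward and outward pointing vectors.
\<close>

definition tangent_space :: "'a::euclidean_space set \<Rightarrow> 'a \<Rightarrow> 'a set" where
  "tangent_space \<Sigma> p =
     {v. \<exists>\<epsilon>>0. \<exists>\<gamma> :: real \<Rightarrow> 'a.
           smooth_on \<gamma> {-\<epsilon><..<\<epsilon>} \<and> \<gamma> 0 = p \<and> (\<gamma> has_vector_derivative v) (at 0) \<and>
           (\<gamma> ` {0..<\<epsilon>} \<subseteq> \<Sigma> \<or> \<gamma> ` {-\<epsilon><..0} \<subseteq> \<Sigma>)}"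

text \<open>
  The vector \<open>A(u,v)\<close> is the normal component of the ambient derivative \<open>D\<^sub>u Y\<close> at \<open>p\<close>, where \<open>Y\<close> is a
  local extension of \<open>v\<close> to a smooth vector field tangent along \<open>\<Sigma>\<close>. It does not depend on
  the choice of \<open>Y\<close>. Intended for \<open>p \<in> \<Sigma>\<close> and \<open>u\<close>, \<open>v\<close> tangent to \<open>\<Sigma>\<close> at \<open>p\<close>.
\<close>

definition second_fundamental_form :: "'a::euclidean_space set \<Rightarrow> 'a \<Rightarrow> 'a \<Rightarrow> 'a \<Rightarrow> 'a" where
  "second_fundamental_form \<Sigma> p u v =
     (THE w. w \<in> (tangent_space \<Sigma> p)\<^sup>\<bottom> \<and>
        (\<exists>U Y. open U \<and> p \<in> U \<and> smooth_on Y U \<and> (\<forall>q\<in>U \<inter> \<Sigma>. Y q \<in> tangent_space \<Sigma> q) \<and>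
               Y p = v \<and> frechet_derivative Y (at p) u - w \<in> tangent_space \<Sigma> p))"

definition flat :: "'a::euclidean_space set \<Rightarrow> bool" where
  "flat \<Sigma> \<longleftrightarrow>
     (\<forall>p\<in>\<Sigma>. \<forall>u\<in>tangent_space \<Sigma> p. \<forall>v\<in>tangent_space \<Sigma> p. second_fundamental_form \<Sigma> p u v = 0)"

end

theory Submission
  imports Defs "HOL-Probability.Distributions"
begin

text \<open>
  Write \<open>\<Sigma>\<close> near an interior point \<open>p\<close> as a graph \<open>x + u x\<close> over its tangent plane, with
  \<open>u x = A x x / 2 + o(|x|\<^sup>2)\<close>, and test the entropy with the Gaussian of scale \<open>t\<close> centred at
  \<open>p + t *\<^sub>R \<eta>\<close>, where \<open>\<eta>\<close> is the trace of \<open>A\<close>. The area element contributes \<open>t |A|\<^sup>2\<close>, while the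
  distance of the graph from the plane costs the variance of \<open>A x x / 2\<close> divided by \<open>4 t\<close>, which is
  \<open>t |A|\<^sup>2 / 2\<close>. Hence the integral is at least \<open>1 + t |A|\<^sup>2 / 2 - o(t)\<close>, and entropy 1 forces \<open>A = 0\<close>.
  As \<^const>\<open>hausdorff_measure\<close> is normalized by balls, comparing it from below with
  Lebesgue measure on the tangent plane rests on the isodiametric inequality.

  If \<open>A = 0\<close> everywhere, the tangent planes along a chart satisfy a linear differential equation
  with constant solution; at boundary points \<open>A = 0\<close> holds by continuity. So \<open>\<Sigma>\<close> is
  locally contained in a plane, which is locally constant along the connected set \<open>\<Sigma>\<close>.
\<close>

subsection \<open>The isodiametric inequality\<close>

text \<open>The shift of the centre is essential. Under the Gaussian the quadratic form
  \<open>A x x / 2\<close> has mean \<open>t *\<^sub>R \<eta>\<close>; a centre at \<open>p\<close>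
  would pay for this mean with a further loss \<open>t * |\<eta>|^2 / 4\<close>, which already
  exceeds the gain on round spheres of dimension at least 3. After the shift only the variance is
  paid. Any piece of \<Sigma> bounds the entropy from below, so a lower bound for the Hausdorff
  measure of a small graph is enough. No area formula enters: coverings are compared with Lebesgue
  measure through distances alone. Near a point, distances on the graph dominate those of a linear
  change of coordinates. It is taken triangular, so that its volume factor follows from Fubini one
  coordinate at a time; Steiner symmetrization uses the same product coordinates. Accordingly the
  graph function is controlled through increments and not through derivatives. The errors have sizes
  \<open>\<epsilon> * t\<close> and \<open>t^2\<close>. They are beaten by fixing \<epsilon> first,
  then the radius of the graph, and then t, which may depend on both.\<close>

definition steiner :: "'i set \<Rightarrow> 'i \<Rightarrow> ('i \<Rightarrow> real) set \<Rightarrow> ('i \<Rightarrow> real) set" where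
  "steiner I i K = {f \<in> space (Pi\<^sub>M I (\<lambda>_. lborel)).
     ennreal (2 * \<bar>f i\<bar>) < (\<integral>\<^sup>+t. indicator K (f(i := t)) \<partial>lborel)}"

lemma measurable_slice_integral:
  assumes "i \<in> I" and [measurable]: "K \<in> sets (Pi\<^sub>M I (\<lambda>_. lborel :: real measure))"
  shows "(\<lambda>f. \<integral>\<^sup>+t. indicator K (f(i := t)) \<partial>lborel) \<in> borel_measurable (Pi\<^sub>M I (\<lambda>_. lborel))"
proof -
  have "I = I \<union> {i}" using assms by auto
  then have [measurable]: "(\<lambda>x. (fst x)(i := snd x)) \<in>
      Pi\<^sub>M I (\<lambda>_. lborel :: real measure) \<Otimes>\<^sub>M lborel \<rightarrow>\<^sub>M Pi\<^sub>M I (\<lambda>_. lborel)"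
    by (intro measurable_fun_upd) auto
  show ?thesis
    by (rule sigma_finite_measure.borel_measurable_nn_integral[OF lborel.sigma_finite_measure_axioms])
       (auto simp: case_prod_beta)
qed

lemma sets_steiner [measurable]:
  assumes "i \<in> I" "K \<in> sets (Pi\<^sub>M I (\<lambda>_. lborel :: real measure))"
  shows "steiner I i K \<in> sets (Pi\<^sub>M I (\<lambda>_. lborel))"
proof -
  note measurable_slice_integral[OF assms, measurable]
  have [measurable]: "(\<lambda>f. f i) \<in> borel_measurable (Pi\<^sub>M I (\<lambda>_. lborel :: real measure))"
    using measurable_component_singleton[OF assms(1), of "\<lambda>_. lborel :: real measure"] by simp
  show ?thesis unfolding steiner_def by measurable
qed

lemma emeasure_abs_less: "emeasure lborel {t::real. ennreal (2 * \<bar>t\<bar>) < m} = m"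
proof (cases m)
  case (real r)
  then have "{t::real. ennreal (2 * \<bar>t\<bar>) < m} = {- (r/2) <..< r/2}"
    by (auto simp: ennreal_less_iff abs_if split: if_splits)
  then show ?thesis using real by (simp add: emeasure_lborel_Ioo)
next
  case top
  then show ?thesis by simp
qed

text \<open>Fubini with the coordinate \<open>i\<close> innermost: on each line the symmetrized set
  is a centred open interval with the length of the original slice. By
  \<open>emeasure_abs_less\<close> this includes slices of length 0, which become empty, and of
  infinite length.\<close>

lemma emeasure_steiner:
  assumes "finite I" "i \<in> I" and K: "K \<in> sets (Pi\<^sub>M I (\<lambda>_. lborel :: real measure))"
  shows "emeasure (Pi\<^sub>M I (\<lambda>_. lborel)) (steiner I i K) = emeasure (Pi\<^sub>M I (\<lambda>_. lborel)) K"
proof -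
  define J where "J = I - {i}"
  have J: "finite J" "i \<notin> J" "I = insert i J" using assms by (auto simp: J_def)
  interpret product_sigma_finite "\<lambda>_. lborel :: real measure" by standard
  let ?S = "steiner I i K" and ?M = "Pi\<^sub>M (insert i J) (\<lambda>_. lborel :: real measure)"
  have S: "?S \<in> sets ?M" using sets_steiner[OF assms(2,3)] J by simp
  have K': "K \<in> sets ?M" using K J by simp
  have "emeasure ?M ?S = (\<integral>\<^sup>+x. \<integral>\<^sup>+y. indicator ?S (x(i := y)) \<partial>lborel \<partial>Pi\<^sub>M J (\<lambda>_. lborel))"
    using S J by (subst nn_integral_indicator[OF S, symmetric], subst product_nn_integral_insert) auto
  also have "\<dots> = (\<integral>\<^sup>+x. \<integral>\<^sup>+y. indicator K (x(i := y)) \<partial>lborel \<partial>Pi\<^sub>M J (\<lambda>_. lborel))"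
  proof (rule nn_integral_cong)
    fix x assume x: "x \<in> space (Pi\<^sub>M J (\<lambda>_. lborel :: real measure))"
    have "x(i := y) \<in> space ?M" for y using x by (auto simp: space_PiM PiE_def extensional_def)
    then have "(\<integral>\<^sup>+y. indicator ?S (x(i := y)) \<partial>lborel) =
      (\<integral>\<^sup>+y. indicator {t. ennreal (2 * \<bar>t\<bar>) < (\<integral>\<^sup>+t. indicator K (x(i := t)) \<partial>lborel)} y \<partial>lborel)"
      by (intro nn_integral_cong) (auto simp: steiner_def indicator_def J(3))
    also have "\<dots> = (\<integral>\<^sup>+t. indicator K (x(i := t)) \<partial>lborel)"
      by (subst nn_integral_indicator) (simp_all add: emeasure_abs_less)
    finally show "(\<integral>\<^sup>+y. indicator ?S (x(i := y)) \<partial>lborel) = (\<integral>\<^sup>+y. indicator K (x(i := y)) \<partial>lborel)" .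
  qed
  also have "\<dots> = emeasure ?M K"
    using K' J by (subst nn_integral_indicator[OF K', symmetric], subst product_nn_integral_insert) auto
  finally show ?thesis by (simp add: J(3)[symmetric])
qed

lemma slice_measurable:
  assumes "i \<in> I" and [measurable]: "K \<in> sets (Pi\<^sub>M I (\<lambda>_. lborel :: real measure))"
    and f: "f \<in> space (Pi\<^sub>M I (\<lambda>_. lborel))"
  shows "{t. f(i := t) \<in> K} \<in> sets lborel"
proof -
  have "I = I \<union> {i}" using assms by auto
  then have [measurable]: "(\<lambda>t. f(i := t)) \<in> lborel \<rightarrow>\<^sub>M Pi\<^sub>M I (\<lambda>_. lborel :: real measure)"
    using f by (intro measurable_fun_upd) auto
  have "(\<lambda>t. f(i := t)) -` K \<inter> space lborel \<in> sets lborel" by measurable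
  then show ?thesis by (simp add: vimage_def)
qed

text \<open>Adding \<open>Sup A - Inf B \<le> c\<close> and \<open>Sup B - Inf A \<le> c\<close>
  bounds the sum of the lengths of the two enclosing intervals by \<open>2 * c\<close>. This is the
  one-dimensional reason why Steiner symmetrization does not increase diameters.\<close>

lemma emeasure_add_le_of_dist_le:
  fixes A B :: "real set"
  assumes "A \<noteq> {}" "B \<noteq> {}" and AB: "\<And>a b. a \<in> A \<Longrightarrow> b \<in> B \<Longrightarrow> \<bar>a - b\<bar> \<le> c"
    and "ennreal (2 * x) < emeasure lborel A" "ennreal (2 * y) < emeasure lborel B"
    and "0 \<le> x" "0 \<le> y"
  shows "x + y \<le> c"
proof -
  obtain a0 b0 where 0: "a0 \<in> A" "b0 \<in> B" using assms by blast
  have A: "bdd_above A" "bdd_below A"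
    using AB[OF _ 0(2)] by (auto intro!: bdd_aboveI[of _ "b0 + c"] bdd_belowI[of _ "b0 - c"] simp: abs_le_iff)
       (smt (verit))+
  have B: "bdd_above B" "bdd_below B"
    using AB[OF 0(1)] by (auto intro!: bdd_aboveI[of _ "a0 + c"] bdd_belowI[of _ "a0 - c"] simp: abs_le_iff)
       (smt (verit))+
  have sub: "A \<subseteq> {Inf A..Sup A}" "B \<subseteq> {Inf B..Sup B}"
    using A B by (auto intro: cInf_lower cSup_upper)
  have le: "Inf A \<le> Sup A" "Inf B \<le> Sup B" using sub 0 by auto
  have "emeasure lborel A \<le> emeasure lborel {Inf A..Sup A}" "emeasure lborel B \<le> emeasure lborel {Inf B..Sup B}"
    using sub by (intro emeasure_mono; simp)+
  then have "ennreal (2 * x) < ennreal (Sup A - Inf A)" "ennreal (2 * y) < ennreal (Sup B - Inf B)"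
    using assms le by (simp_all add: emeasure_lborel_Icc)
  then have 1: "2 * x < Sup A - Inf A" "2 * y < Sup B - Inf B"
    using assms by (auto simp: ennreal_less_iff)
  have "Sup A - c \<le> b" if "b \<in> B" for b
  proof -
    have "Sup A \<le> b + c" using assms(1) AB[OF _ that] by (intro cSup_least) (auto simp: abs_le_iff, smt (verit))
    then show ?thesis by simp
  qed
  then have 2: "Sup A - c \<le> Inf B" using assms by (intro cInf_greatest)
  have "Sup B - c \<le> a" if "a \<in> A" for a
  proof -
    have "Sup B \<le> a + c" using assms(2) AB[OF that] by (intro cSup_least) (auto simp: abs_le_iff, smt (verit))
    then show ?thesis by simp
  qed
  then have 3: "Sup B - c \<le> Inf A" using assms by (intro cInf_greatest)
  from 1 2 3 show ?thesis by linarith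
qed

text \<open>The coordinates other than \<open>i\<close> contribute the same amount \<open>s\<close>
  before and after symmetrization. Points \<open>a\<close>, \<open>b\<close> of the two slices of
  \<open>K\<close> thus satisfy \<open>(a - b)^2 \<le> d - s\<close>, and the one-dimensional lemma
  carries this bound to the centred intervals.\<close>

lemma steiner_diameter:
  assumes "finite I" "i \<in> I" and K: "K \<in> sets (Pi\<^sub>M I (\<lambda>_. lborel :: real measure))"
    and d: "\<And>f g. f \<in> K \<Longrightarrow> g \<in> K \<Longrightarrow> (\<Sum>j\<in>I. (f j - g j)\<^sup>2) \<le> d"
    and f: "f \<in> steiner I i K" and g: "g \<in> steiner I i K"
  shows "(\<Sum>j\<in>I. (f j - g j)\<^sup>2) \<le> d"
proof -
  define s where "s = (\<Sum>j\<in>I - {i}. (f j - g j)\<^sup>2)"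
  define A B where "A = {t. f(i := t) \<in> K}" and "B = {t. g(i := t) \<in> K}"
  have fg: "f \<in> space (Pi\<^sub>M I (\<lambda>_. lborel))" "g \<in> space (Pi\<^sub>M I (\<lambda>_. lborel))"
    using f g by (auto simp: steiner_def)
  note sl = slice_measurable[OF assms(2) K fg(1)] slice_measurable[OF assms(2) K fg(2)]
  have ind: "(\<lambda>t. indicator K (f(i := t))) = (indicator A :: real \<Rightarrow> ennreal)"
       "(\<lambda>t. indicator K (g(i := t))) = (indicator B :: real \<Rightarrow> ennreal)"
    by (auto simp: A_def B_def indicator_def fun_eq_iff)
  have m: "ennreal (2 * \<bar>f i\<bar>) < emeasure lborel A" "ennreal (2 * \<bar>g i\<bar>) < emeasure lborel B"
    using f g sl[folded A_def B_def] unfolding steiner_def by (auto simp: ind)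
  then have ne: "A \<noteq> {}" "B \<noteq> {}" by auto
  have 1: "(a - b)\<^sup>2 + s \<le> d" if "a \<in> A" "b \<in> B" for a b
  proof -
    have "(\<Sum>j\<in>I. ((f(i := a)) j - (g(i := b)) j)\<^sup>2) \<le> d"
      using that by (intro d) (auto simp: A_def B_def simp del: fun_upd_apply)
    also have "(\<Sum>j\<in>I. ((f(i := a)) j - (g(i := b)) j)\<^sup>2) = (a - b)\<^sup>2 + s"
      unfolding s_def using assms(1,2) by (subst sum.remove[of _ i]) auto
    finally show ?thesis .
  qed
  have "d - s \<ge> 0"
  proof -
    obtain a b where "a \<in> A" "b \<in> B" using ne by blast
    from 1[OF this] have "(a - b)\<^sup>2 \<le> d - s" by simp
    then show ?thesis using zero_le_power2[of "a - b"] by linarith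
  qed
  have "\<bar>f i\<bar> + \<bar>g i\<bar> \<le> sqrt (d - s)"
  proof (rule emeasure_add_le_of_dist_le[OF ne _ m])
    fix a b assume "a \<in> A" "b \<in> B"
    then have "(a - b)\<^sup>2 \<le> d - s" using 1 by fastforce
    then show "\<bar>a - b\<bar> \<le> sqrt (d - s)" by (metis real_sqrt_abs real_sqrt_le_iff)
  qed auto
  then have "\<bar>f i - g i\<bar> \<le> sqrt (d - s)" by linarith
  then have "(f i - g i)\<^sup>2 \<le> d - s" using \<open>d - s \<ge> 0\<close> by (metis real_sqrt_abs real_sqrt_le_iff)
  moreover have "(\<Sum>j\<in>I. (f j - g j)\<^sup>2) = (f i - g i)\<^sup>2 + s"
    unfolding s_def using assms(1,2) by (subst sum.remove[of _ i]) auto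
  ultimately show ?thesis by simp
qed

lemma steiner_reflect_same:
  assumes "f \<in> steiner I i K" "i \<in> I"
  shows "f(i := - f i) \<in> steiner I i K"
  using assms by (auto simp: steiner_def space_PiM PiE_def extensional_def)

text \<open>Reflecting coordinate \<open>j\<close> leaves the parameter \<open>t\<close> of an
  \<open>i\<close>-slice alone, so the slices through a point and through its reflection coincide.
  Hence symmetries gained in earlier directions survive later symmetrizations.\<close>

lemma steiner_reflect_other:
  assumes "f \<in> steiner I i K" "i \<noteq> j" "j \<in> I" and sym: "\<And>f. f \<in> K \<Longrightarrow> f(j := - f j) \<in> K"
  shows "f(j := - f j) \<in> steiner I i K"
proof -
  have "f(j := - f j, i := t) \<in> K \<longleftrightarrow> f(i := t) \<in> K" for t
  proof -
    have "(f(i := t))(j := - (f(i := t)) j) = f(j := - f j, i := t)"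
      "(f(j := - f j, i := t))(j := - (f(j := - f j, i := t)) j) = f(i := t)"
      using assms(2) by (auto simp: fun_eq_iff)
    then show ?thesis
      using sym[of "f(i := t)"] sym[of "f(j := - f j, i := t)"] by metis
  qed
  then have "(\<lambda>t. indicator K (f(j := - f j, i := t)) :: ennreal) = (\<lambda>t. indicator K (f(i := t)))"
    by (auto simp: indicator_def)
  then show ?thesis using assms(1-3) by (auto simp: steiner_def space_PiM PiE_def extensional_def)
qed

text \<open>Symmetrizing in every coordinate direction makes a set centrally symmetric without increasing
  its diameter, so that it lies in a ball of half the diameter.\<close>

lemma isodiametric_PiM:
  assumes I: "finite I" and K: "K \<in> sets (Pi\<^sub>M I (\<lambda>_. lborel :: real measure))" and "0 < d"
    and d: "\<And>f g. f \<in> K \<Longrightarrow> g \<in> K \<Longrightarrow> (\<Sum>j\<in>I. (f j - g j)\<^sup>2) \<le> d\<^sup>2"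
  shows "emeasure (Pi\<^sub>M I (\<lambda>_. lborel)) K \<le> ennreal (unit_ball_vol (card I) * (d / 2) ^ card I)"
proof -
  let ?M = "Pi\<^sub>M I (\<lambda>_. lborel :: real measure)"
  have "\<exists>K'\<in>sets ?M. emeasure ?M K' = emeasure ?M K \<and>
      (\<forall>f\<in>K'. \<forall>g\<in>K'. (\<Sum>j\<in>I. (f j - g j)\<^sup>2) \<le> d\<^sup>2) \<and> (\<forall>j\<in>J. \<forall>f\<in>K'. f(j := - f j) \<in> K')"
    if "finite J" "J \<subseteq> I" for J
    using that
  proof (induction J)
    case empty
    show ?case using K d by (intro bexI[of _ K]) auto
  next
    case (insert i J)
    then obtain K' where K': "K' \<in> sets ?M" "emeasure ?M K' = emeasure ?M K"
      "\<And>f g. f \<in> K' \<Longrightarrow> g \<in> K' \<Longrightarrow> (\<Sum>j\<in>I. (f j - g j)\<^sup>2) \<le> d\<^sup>2"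
      "\<And>j f. j \<in> J \<Longrightarrow> f \<in> K' \<Longrightarrow> f(j := - f j) \<in> K'" by blast
    have "i \<in> I" using insert by auto
    note st = sets_steiner[OF \<open>i \<in> I\<close> K'(1)] emeasure_steiner[OF I \<open>i \<in> I\<close> K'(1)]
    show ?case
    proof (intro bexI[of _ "steiner I i K'"] conjI ballI)
      fix j f assume j: "j \<in> insert i J" and f: "f \<in> steiner I i K'"
      show "f(j := - f j) \<in> steiner I i K'"
      proof (cases "j = i")
        case True
        then show ?thesis using steiner_reflect_same[OF f \<open>i \<in> I\<close>] by simp
      next
        case False
        then have "j \<in> J" using j by simp
        moreover then have "j \<in> I" using insert by auto
        ultimately show ?thesis using steiner_reflect_other[OF f] K'(4) False by metis
      qed
    next
      show "emeasure ?M (steiner I i K') = emeasure ?M K" using st(2) K'(2) by simp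
    next
      fix f g assume "f \<in> steiner I i K'" "g \<in> steiner I i K'"
      then show "(\<Sum>j\<in>I. (f j - g j)\<^sup>2) \<le> d\<^sup>2"
        by (rule steiner_diameter[OF I \<open>i \<in> I\<close> K'(1), rotated]) (rule K'(3))
    next
      show "steiner I i K' \<in> sets ?M" by (rule st(1))
    qed
  qed
  from this[OF I] obtain K' where K': "K' \<in> sets ?M" "emeasure ?M K' = emeasure ?M K"
      "\<And>f g. f \<in> K' \<Longrightarrow> g \<in> K' \<Longrightarrow> (\<Sum>j\<in>I. (f j - g j)\<^sup>2) \<le> d\<^sup>2"
      "\<And>j f. j \<in> I \<Longrightarrow> f \<in> K' \<Longrightarrow> f(j := - f j) \<in> K'" by blast
  \<comment> \<open>The coordinate reflections are composed one at a time; for \<open>J = I\<close>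
    the result is the antipode of \<open>f\<close>, at distance twice the norm of
    \<open>f\<close>.\<close>
  have flip: "(\<lambda>j. if j \<in> J then - f j else f j) \<in> K'" if "f \<in> K'" "finite J" "J \<subseteq> I" for f J
    using that(2,3)
  proof (induction J)
    case (insert i J)
    let ?g = "\<lambda>j. if j \<in> J then - f j else f j"
    have "?g(i := - ?g i) \<in> K'" using insert by (intro K'(4)) blast+
    also have "?g(i := - ?g i) = (\<lambda>j. if j \<in> insert i J then - f j else f j)"
      using insert by (auto simp: fun_eq_iff)
    finally show ?case .
  qed (use that in simp)
  have sub: "K' \<subseteq> {f. sqrt (\<Sum>i\<in>I. (f i)\<^sup>2) \<le> d / 2} \<inter> space ?M"
  proof (intro subsetI IntI CollectI)
    fix f assume f: "f \<in> K'"
    then show "f \<in> space ?M" using sets.sets_into_space[OF K'(1)] by auto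
    have "(\<Sum>j\<in>I. (f j - (if j \<in> I then - f j else f j))\<^sup>2) \<le> d\<^sup>2"
      using K'(3)[OF f flip[OF f I order_refl]] .
    also have "(\<Sum>j\<in>I. (f j - (if j \<in> I then - f j else f j))\<^sup>2) = (\<Sum>j\<in>I. 4 * (f j)\<^sup>2)"
      by (intro sum.cong) (auto simp: power2_eq_square)
    finally have "(\<Sum>i\<in>I. (f i)\<^sup>2) \<le> (d / 2)\<^sup>2" by (simp add: sum_distrib_left[symmetric] power_divide)
    then show "sqrt (\<Sum>i\<in>I. (f i)\<^sup>2) \<le> d / 2" using \<open>0 < d\<close> by (intro real_le_lsqrt) auto
  qed
  have "emeasure ?M K \<le> emeasure ?M ({f. sqrt (\<Sum>i\<in>I. (f i)\<^sup>2) \<le> d / 2} \<inter> space ?M)"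
    unfolding K'(2)[symmetric] by (intro emeasure_mono sub) measurable
  also have "\<dots> = ennreal (unit_ball_vol (card I) * (d / 2) ^ card I)"
    using \<open>0 < d\<close> by (intro emeasure_cball_aux I) auto
  finally show ?thesis .
qed

subsection \<open>Hausdorff measure of expanding images\<close>

text \<open>Sets of a covering are arbitrary, so a measurable hull is needed. The closure in the
  product topology serves: the bound on squared distances is a closed condition on pairs and
  therefore survives.\<close>

lemma isodiametric_PiM_outer:
  fixes P :: "(nat \<Rightarrow> real) set"
  assumes P: "P \<subseteq> space (Pi\<^sub>M {..<n} (\<lambda>_. lborel))" and "0 \<le> d"
    and d: "\<And>f g. f \<in> P \<Longrightarrow> g \<in> P \<Longrightarrow> (\<Sum>j<n. (f j - g j)\<^sup>2) \<le> d\<^sup>2"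
  obtains K where "K \<in> sets (Pi\<^sub>M {..<n} (\<lambda>_. lborel))" "P \<subseteq> K"
    "emeasure (Pi\<^sub>M {..<n} (\<lambda>_. lborel)) K \<le> ennreal (unit_ball_vol n * (d / 2) ^ n)"
proof -
  let ?M = "Pi\<^sub>M {..<n} (\<lambda>_. lborel :: real measure)"
  define K where "K = (\<lambda>f. f) -` closure P \<inter> space ?M"
  \<comment> \<open>The topology is that of all functions on \<open>nat\<close>, so coordinates
    beyond \<open>n\<close> count too; on the space of the product measure they are constantly
    \<open>undefined\<close>.\<close>
  have "(\<lambda>f. f j) \<in> borel_measurable ?M" for j
  proof (cases "j < n")
    case True
    then show ?thesis using measurable_component_singleton[of j "{..<n}" "\<lambda>_. lborel :: real measure"] by simp
  next
    case False
    then have "(\<lambda>f. f j) \<in> borel_measurable ?M \<longleftrightarrow> (\<lambda>f. undefined :: real) \<in> borel_measurable ?M"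
      by (intro measurable_cong) (auto simp: space_PiM PiE_def extensional_def)
    then show ?thesis by simp
  qed
  then have "(\<lambda>f. f) \<in> borel_measurable ?M" by (intro measurable_coordinatewise_then_product) auto
  then have K: "K \<in> sets ?M" unfolding K_def by (rule measurable_sets) simp
  have cl: "closed {p :: (nat \<Rightarrow> real) \<times> (nat \<Rightarrow> real). (\<Sum>j<n. (fst p j - snd p j)\<^sup>2) \<le> d\<^sup>2}"
    by (intro closed_Collect_le continuous_intros continuous_on_compose2[OF continuous_on_product_coordinates] subset_UNIV)
  have "P \<times> P \<subseteq> {p. (\<Sum>j<n. (fst p j - snd p j)\<^sup>2) \<le> d\<^sup>2}" using d by auto
  from closure_minimal[OF this cl] have KK: "(\<Sum>j<n. (f j - g j)\<^sup>2) \<le> d\<^sup>2" if "f \<in> K" "g \<in> K" for f g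
    using that by (auto simp: K_def closure_Times)
  \<comment> \<open>A covering set may be a single point, with \<open>d = 0\<close>, whereas
    \<open>isodiametric_PiM\<close> asks for a positive diameter; hence the approximation from
    above.\<close>
  have "emeasure ?M K \<le> ennreal (unit_ball_vol n * ((d + 1 / Suc k) / 2) ^ n)" for k
  proof -
    have "emeasure ?M K \<le> ennreal (unit_ball_vol (card {..<n}) * ((d + 1 / Suc k) / 2) ^ card {..<n})"
    proof (rule isodiametric_PiM[OF _ K])
      show "0 < d + 1 / Suc k" using \<open>0 \<le> d\<close> by (intro add_nonneg_pos) auto
      have "d\<^sup>2 \<le> (d + 1 / Suc k)\<^sup>2" using \<open>0 \<le> d\<close> by (intro power_mono) auto
      then show "(\<Sum>j<n. (f j - g j)\<^sup>2) \<le> (d + 1 / Suc k)\<^sup>2" if "f \<in> K" "g \<in> K" for f g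
        using KK[OF that] by linarith
    qed simp
    then show ?thesis by simp
  qed
  moreover have "(\<lambda>k. 1 / real (Suc k)) \<longlonglongrightarrow> 0" by (rule LIMSEQ_Suc[OF lim_1_over_n])
  then have "(\<lambda>k. ennreal (unit_ball_vol n * ((d + 1 / Suc k) / 2) ^ n))
      \<longlonglongrightarrow> ennreal (unit_ball_vol n * ((d + 0) / 2) ^ n)"
    by (intro tendsto_intros tendsto_ennrealI) simp_all
  ultimately have "emeasure ?M K \<le> ennreal (unit_ball_vol n * (d / 2) ^ n)"
    by (intro LIMSEQ_le_const) auto
  moreover have "P \<subseteq> K" using P closure_subset[of P] by (auto simp: K_def)
  ultimately show thesis using that K by blast
qed

text \<open>As \<open>l\<close> does not see coordinate \<open>i\<close>, the map is affine of slope
  \<open>r\<close> on every line in that direction, and Fubini gives the factor. Triangular maps are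
  composed of such steps.\<close>

lemma emeasure_affine_coordinate:
  assumes "finite I" "i \<in> I" "0 < r" and K: "K \<in> sets (Pi\<^sub>M I (\<lambda>_. lborel :: real measure))"
    and l: "l \<in> borel_measurable (Pi\<^sub>M I (\<lambda>_. lborel))" "\<And>f t. l (f(i := t)) = l f"
  shows "{f \<in> space (Pi\<^sub>M I (\<lambda>_. lborel)). f(i := r * f i + l f) \<in> K} \<in> sets (Pi\<^sub>M I (\<lambda>_. lborel))"
    and "ennreal r * emeasure (Pi\<^sub>M I (\<lambda>_. lborel)) {f \<in> space (Pi\<^sub>M I (\<lambda>_. lborel)). f(i := r * f i + l f) \<in> K}
       = emeasure (Pi\<^sub>M I (\<lambda>_. lborel)) K"
proof -
  define J where "J = I - {i}"
  have J: "finite J" "i \<notin> J" "I = insert i J" using assms by (auto simp: J_def)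
  interpret product_sigma_finite "\<lambda>_. lborel :: real measure" by standard
  let ?M = "Pi\<^sub>M (insert i J) (\<lambda>_. lborel :: real measure)"
  let ?S = "{f \<in> space ?M. f(i := r * f i + l f) \<in> K}"
  have l' [measurable]: "l \<in> borel_measurable ?M" using l J by simp
  have [measurable]: "(\<lambda>f. f i) \<in> borel_measurable ?M"
    using measurable_component_singleton[of i "insert i J" "\<lambda>_. lborel :: real measure"] by simp
  have [measurable]: "(\<lambda>f. f(i := r * f i + l f)) \<in> ?M \<rightarrow>\<^sub>M ?M"
    by (rule measurable_fun_upd[where J = "insert i J"]) auto
  have K' [measurable]: "K \<in> sets ?M" using K J by simp
  have S: "?S \<in> sets ?M" by measurable
  then show "{f \<in> space (Pi\<^sub>M I (\<lambda>_. lborel)). f(i := r * f i + l f) \<in> K} \<in> sets (Pi\<^sub>M I (\<lambda>_. lborel))"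
    by (simp add: J(3))
  have "emeasure ?M K = (\<integral>\<^sup>+x. \<integral>\<^sup>+y. indicator K (x(i := y)) \<partial>lborel \<partial>Pi\<^sub>M J (\<lambda>_. lborel))"
    using K' J by (subst nn_integral_indicator[OF K', symmetric], subst product_nn_integral_insert) auto
  also have "\<dots> = (\<integral>\<^sup>+x. ennreal r * (\<integral>\<^sup>+y. indicator ?S (x(i := y)) \<partial>lborel) \<partial>Pi\<^sub>M J (\<lambda>_. lborel))"
  proof (rule nn_integral_cong)
    fix x assume x: "x \<in> space (Pi\<^sub>M J (\<lambda>_. lborel :: real measure))"
    have sp: "x(i := y) \<in> space ?M" for y using x by (auto simp: space_PiM PiE_def extensional_def)
    have [measurable]: "(\<lambda>y. x(i := y)) \<in> lborel \<rightarrow>\<^sub>M ?M"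
      by (rule measurable_fun_upd[where J = J]) (use x in auto)
    have "(\<integral>\<^sup>+y. indicator K (x(i := y)) \<partial>lborel) = ennreal \<bar>r\<bar> * (\<integral>\<^sup>+y. indicator K (x(i := l x + r * y)) \<partial>lborel)"
      using \<open>0 < r\<close> by (intro nn_integral_real_affine) auto
    also have "(\<integral>\<^sup>+y. indicator K (x(i := l x + r * y)) \<partial>lborel) = (\<integral>\<^sup>+y. indicator ?S (x(i := y)) \<partial>lborel)"
      using sp by (intro nn_integral_cong) (auto simp: indicator_def l(2) add.commute)
    finally show "(\<integral>\<^sup>+y. indicator K (x(i := y)) \<partial>lborel) = ennreal r * (\<integral>\<^sup>+y. indicator ?S (x(i := y)) \<partial>lborel)"
      using \<open>0 < r\<close> by (simp only: abs_of_pos)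
  qed
  also have "\<dots> = ennreal r * (\<integral>\<^sup>+x. \<integral>\<^sup>+y. indicator ?S (x(i := y)) \<partial>lborel \<partial>Pi\<^sub>M J (\<lambda>_. lborel))"
  proof (rule nn_integral_cmult)
    have [measurable]: "(\<lambda>x. (fst x)(i := snd x)) \<in>
      Pi\<^sub>M J (\<lambda>_. lborel :: real measure) \<Otimes>\<^sub>M lborel \<rightarrow>\<^sub>M ?M"
      by (rule measurable_fun_upd[where J = J]) auto
    have [measurable]: "?S \<in> sets ?M" by fact
    show "(\<lambda>x. \<integral>\<^sup>+y. indicator ?S (x(i := y)) \<partial>lborel) \<in> borel_measurable (Pi\<^sub>M J (\<lambda>_. lborel))"
      by (rule sigma_finite_measure.borel_measurable_nn_integral[OF lborel.sigma_finite_measure_axioms])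
         (auto simp: case_prod_beta)
  qed
  also have "(\<integral>\<^sup>+x. \<integral>\<^sup>+y. indicator ?S (x(i := y)) \<partial>lborel \<partial>Pi\<^sub>M J (\<lambda>_. lborel)) = emeasure ?M ?S"
    using S J by (subst nn_integral_indicator[OF S, symmetric], subst product_nn_integral_insert) auto
  finally show "ennreal r * emeasure (Pi\<^sub>M I (\<lambda>_. lborel)) {f \<in> space (Pi\<^sub>M I (\<lambda>_. lborel)). f(i := r * f i + l f) \<in> K}
       = emeasure (Pi\<^sub>M I (\<lambda>_. lborel)) K" by (simp add: J(3))
qed

text \<open>An upper triangular matrix with diagonal \<open>r\<close> and entries \<open>s\<close>
  above it, of which only the first \<open>k\<close> rows are in force while the others act as the
  identity. The intermediate values of \<open>k\<close> serve the induction; \<open>k = n\<close> is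
  the full map.\<close>

definition triangular :: "nat \<Rightarrow> (nat \<Rightarrow> real) \<Rightarrow> (nat \<Rightarrow> nat \<Rightarrow> real) \<Rightarrow> nat \<Rightarrow> (nat \<Rightarrow> real) \<Rightarrow> nat \<Rightarrow> real" where
  "triangular n r s k f i = (if i < k then r i * f i + (\<Sum>j\<in>{i<..<n}. s i j * f j) else f i)"

lemma emeasure_triangular:
  assumes r: "\<And>i. i < n \<Longrightarrow> 0 < r i" and "k \<le> n"
    and K: "K \<in> sets (Pi\<^sub>M {..<n} (\<lambda>_. lborel :: real measure))"
  shows "{f \<in> space (Pi\<^sub>M {..<n} (\<lambda>_. lborel)). triangular n r s k f \<in> K} \<in> sets (Pi\<^sub>M {..<n} (\<lambda>_. lborel)) \<and>
    ennreal (\<Prod>i<k. r i) * emeasure (Pi\<^sub>M {..<n} (\<lambda>_. lborel))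
      {f \<in> space (Pi\<^sub>M {..<n} (\<lambda>_. lborel)). triangular n r s k f \<in> K}
     = emeasure (Pi\<^sub>M {..<n} (\<lambda>_. lborel)) K"
  using assms(2) K
proof (induction k arbitrary: K)
  case 0
  have "{f \<in> space (Pi\<^sub>M {..<n} (\<lambda>_. lborel)). triangular n r s 0 f \<in> K} = K"
    using sets.sets_into_space[OF 0(2)] by (auto simp: triangular_def[abs_def])
  then show ?case using 0 by simp
next
  case (Suc k K)
  let ?M = "Pi\<^sub>M {..<n} (\<lambda>_. lborel :: real measure)"
  define l where "l f = (\<Sum>j\<in>{k<..<n}. s k j * f j)" for f :: "nat \<Rightarrow> real"
  let ?S = "{f \<in> space ?M. f(k := r k * f k + l f) \<in> K}"
  have "k < n" using Suc by simp
  have l: "l \<in> borel_measurable ?M" unfolding l_def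
    using measurable_component_singleton[of _ "{..<n}" "\<lambda>_. lborel :: real measure"]
    by (intro borel_measurable_sum borel_measurable_times borel_measurable_const) auto
  have l2: "l (f(k := t)) = l f" for f t unfolding l_def by (intro sum.cong) auto
  note aff = emeasure_affine_coordinate[OF _ _ r[OF \<open>k < n\<close>] Suc.prems(2) l l2, simplified, OF \<open>k < n\<close>]
  have IH: "{f \<in> space ?M. triangular n r s k f \<in> ?S} \<in> sets ?M"
    "ennreal (\<Prod>i<k. r i) * emeasure ?M {f \<in> space ?M. triangular n r s k f \<in> ?S} = emeasure ?M ?S"
    using Suc.IH[OF _ aff(1)] \<open>k < n\<close> by auto
  \<comment> \<open>Row \<open>k\<close> reads only coordinates from \<open>k\<close> upwards, which
    the first \<open>k\<close> rows have left unchanged. So the rows may be applied one after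
    another in increasing order.\<close>
  have "triangular n r s (Suc k) f = (triangular n r s k f)(k := r k * triangular n r s k f k + l (triangular n r s k f))" for f
    unfolding l_def by (auto simp: triangular_def fun_eq_iff less_Suc_eq)
  moreover have "triangular n r s k f \<in> space ?M" if "f \<in> space ?M" for f
    using that \<open>k < n\<close> by (auto simp: space_PiM PiE_def extensional_def triangular_def)
  ultimately have eq: "{f \<in> space ?M. triangular n r s (Suc k) f \<in> K} = {f \<in> space ?M. triangular n r s k f \<in> ?S}"
    by auto
  have "ennreal (\<Prod>i<Suc k. r i) = ennreal (r k) * ennreal (\<Prod>i<k. r i)"
    using r[OF \<open>k < n\<close>] r \<open>k < n\<close> by (subst ennreal_mult[symmetric]) (auto intro!: prod_pos less_imp_le simp: mult.commute)
  then have "ennreal (\<Prod>i<Suc k. r i) * emeasure ?M {f \<in> space ?M. triangular n r s k f \<in> ?S} = emeasure ?M K"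
    by (simp only: mult.assoc IH(2) aff(2))
  with IH(1) show ?case unfolding eq by (rule conjI)
qed

text \<open>A covering set of diameter \<open>D\<close> pulls back to a set whose triangular image
  has diameter at most \<open>D / c\<close>. The isodiametric inequality bounds the volume of that
  image, the product of the \<open>r i\<close> converts it back, and countable subadditivity sums
  up. A linear map in the hypothesis in place of a bare constant is what captures the area element
  to second order.\<close>

lemma hausdorff_outer_ge_PiM:
  fixes G :: "(nat \<Rightarrow> real) \<Rightarrow> 'a::metric_space"
  assumes A: "A \<in> sets (Pi\<^sub>M {..<n} (\<lambda>_. lborel :: real measure))"
    and r: "\<And>i. i < n \<Longrightarrow> 0 < r i" and "0 < c"
    and G: "\<And>f g. f \<in> A \<Longrightarrow> g \<in> A \<Longrightarrow>
      c\<^sup>2 * (\<Sum>i<n. (triangular n r s n f i - triangular n r s n g i)\<^sup>2) \<le> (dist (G f) (G g))\<^sup>2"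
  shows "ennreal (c ^ n * (\<Prod>i<n. r i)) * emeasure (Pi\<^sub>M {..<n} (\<lambda>_. lborel)) A \<le> hausdorff_outer n (G ` A)"
proof -
  let ?M = "Pi\<^sub>M {..<n} (\<lambda>_. lborel :: real measure)"
  let ?T = "triangular n r s n" and ?p = "ennreal (\<Prod>i<n. r i)"
  have "ennreal (c ^ n * (\<Prod>i<n. r i)) * emeasure ?M A \<le>
      (\<Sum>i. if C i = {} then 0 else ennreal (unit_ball_vol (real n) * (diameter (C i) / 2) ^ n))"
    if cov: "G ` A \<subseteq> (\<Union>i. C i)" and bd: "\<And>i. bounded (C i)" for C :: "nat \<Rightarrow> 'a set"
  proof -
    have "\<exists>K. K \<in> sets ?M \<and> ?T ` {f \<in> A. G f \<in> C i} \<subseteq> K \<and>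
        ennreal (c ^ n) * emeasure ?M K \<le> (if C i = {} then 0 else ennreal (unit_ball_vol (real n) * (diameter (C i) / 2) ^ n))" for i
    proof (cases "C i = {}")
      case False
      obtain K where K: "K \<in> sets ?M" "?T ` {f \<in> A. G f \<in> C i} \<subseteq> K"
        "emeasure ?M K \<le> ennreal (unit_ball_vol n * (diameter (C i) / c / 2) ^ n)"
      proof (rule isodiametric_PiM_outer)
        show "?T ` {f \<in> A. G f \<in> C i} \<subseteq> space ?M"
          using sets.sets_into_space[OF A] by (auto simp: space_PiM PiE_def extensional_def triangular_def)
        show "0 \<le> diameter (C i) / c" using \<open>0 < c\<close> diameter_ge_0[OF bd] by simp
        fix f' g' assume "f' \<in> ?T ` {f \<in> A. G f \<in> C i}" "g' \<in> ?T ` {f \<in> A. G f \<in> C i}"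
        then obtain f g where fg: "f' = ?T f" "g' = ?T g" "f \<in> A" "g \<in> A" "G f \<in> C i" "G g \<in> C i" by auto
        have "c\<^sup>2 * (\<Sum>j<n. (f' j - g' j)\<^sup>2) \<le> (dist (G f) (G g))\<^sup>2"
          unfolding fg(1,2) by (rule G[OF fg(3,4)])
        also have "\<dots> \<le> (diameter (C i))\<^sup>2" using diameter_bounded_bound[OF bd fg(5,6)] by (intro power_mono) auto
        finally show "(\<Sum>j<n. (f' j - g' j)\<^sup>2) \<le> (diameter (C i) / c)\<^sup>2"
          using \<open>0 < c\<close> by (simp add: power_divide field_simps)
      qed
      have "ennreal (c ^ n) * emeasure ?M K \<le> ennreal (c ^ n) * ennreal (unit_ball_vol n * (diameter (C i) / c / 2) ^ n)"
        by (intro mult_left_mono K) auto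
      also have "\<dots> = ennreal (unit_ball_vol (real n) * (diameter (C i) / 2) ^ n)"
        using \<open>0 < c\<close> diameter_ge_0[OF bd] by (subst ennreal_mult[symmetric]) (auto simp: power_divide)
      finally show ?thesis using K False by auto
    qed (auto intro!: exI[of _ "{}"])
    then have "\<forall>i. \<exists>K. K \<in> sets ?M \<and> ?T ` {f \<in> A. G f \<in> C i} \<subseteq> K \<and>
        ennreal (c ^ n) * emeasure ?M K \<le> (if C i = {} then 0 else ennreal (unit_ball_vol (real n) * (diameter (C i) / 2) ^ n))"
      by (rule allI)
    from choice[OF this] obtain K where K: "\<And>i. K i \<in> sets ?M" "\<And>i. ?T ` {f \<in> A. G f \<in> C i} \<subseteq> K i"
      "\<And>i. ennreal (c ^ n) * emeasure ?M (K i) \<le> (if C i = {} then 0 else ennreal (unit_ball_vol (real n) * (diameter (C i) / 2) ^ n))"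
      by (elim exE) (rule that; blast)
    have tri: "{f \<in> space ?M. ?T f \<in> K i} \<in> sets ?M" "?p * emeasure ?M {f \<in> space ?M. ?T f \<in> K i} = emeasure ?M (K i)" for i
      using emeasure_triangular[OF r order_refl K(1)] by auto
    have "A \<subseteq> (\<Union>i. {f \<in> space ?M. ?T f \<in> K i})"
    proof
      fix f assume f: "f \<in> A"
      then obtain i where "G f \<in> C i" using cov by blast
      then have "?T f \<in> K i" using f K(2)[of i] by auto
      then show "f \<in> (\<Union>i. {f \<in> space ?M. ?T f \<in> K i})" using f sets.sets_into_space[OF A] by auto
    qed
    then have "emeasure ?M A \<le> emeasure ?M (\<Union>i. {f \<in> space ?M. ?T f \<in> K i})"
      using tri by (intro emeasure_mono) auto
    also have "\<dots> \<le> (\<Sum>i. emeasure ?M {f \<in> space ?M. ?T f \<in> K i})"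
      using tri by (intro emeasure_subadditive_countably) auto
    finally have "ennreal (c ^ n) * (?p * emeasure ?M A) \<le>
        ennreal (c ^ n) * (?p * (\<Sum>i. emeasure ?M {f \<in> space ?M. ?T f \<in> K i}))"
      by (intro mult_left_mono) auto
    also have "\<dots> = (\<Sum>i. ennreal (c ^ n) * emeasure ?M (K i))"
      by (simp only: ennreal_suminf_cmult[symmetric] tri)
    also have "\<dots> \<le> (\<Sum>i. if C i = {} then 0 else ennreal (unit_ball_vol (real n) * (diameter (C i) / 2) ^ n))"
      by (intro suminf_le K) auto
    also have "ennreal (c ^ n) * (?p * emeasure ?M A) = ennreal (c ^ n * (\<Prod>i<n. r i)) * emeasure ?M A"
      using \<open>0 < c\<close> r by (subst ennreal_mult) (auto intro!: prod_pos less_imp_le simp: mult.assoc)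
    finally show ?thesis .
  qed
  \<comment> \<open>The estimate holds for coverings of any mesh, so a single value of \<delta>
    suffices.\<close>
  then have "ennreal (c ^ n * (\<Prod>i<n. r i)) * emeasure ?M A \<le> hausdorff_pre n 1 (G ` A)"
    unfolding hausdorff_pre_def by (intro Inf_greatest) auto
  also have "\<dots> \<le> hausdorff_outer n (G ` A)"
    unfolding hausdorff_outer_def by (intro SUP_upper) auto
  finally show ?thesis .
qed

subsection \<open>Integration over graphs\<close>

text \<open>If \<^const>\<open>hausdorff_outer\<close> failed to be countably additive on Borel sets, \<^const>\<open>measure_of\<close> would
  return the zero measure and the entropy would vanish.\<close>

lemma emeasure_hausdorff_measure:
  fixes \<Sigma> :: "'a::euclidean_space set"
  assumes "entropy n \<Sigma> \<noteq> 0" and B: "B \<in> sets borel"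
  shows "emeasure (hausdorff_measure n) B = hausdorff_outer n (B :: 'a set)"
proof -
  have sg: "sigma_sets UNIV (sets (borel :: 'a measure)) = sets borel"
    using sets.sigma_sets_eq[of "borel :: 'a measure"] by simp
  have "measure_space UNIV (sets borel) (hausdorff_outer n :: 'a set \<Rightarrow> ennreal)"
  proof (rule ccontr)
    assume not: "\<not> measure_space UNIV (sets borel) (hausdorff_outer n :: 'a set \<Rightarrow> ennreal)"
    have "hausdorff_measure n = null_measure (borel :: 'a measure)"
    proof (rule measure_eqI)
      show "sets (hausdorff_measure n) = sets (null_measure (borel :: 'a measure))"
        unfolding hausdorff_measure_def by (simp add: sg)
      show "emeasure (hausdorff_measure n) A = emeasure (null_measure borel) A" for A :: "'a set"
        unfolding hausdorff_measure_def emeasure_measure_of_conv sg using not by simp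
    qed
    then have "entropy n \<Sigma> = 0" by (simp add: entropy_def)
    then show False using assms by simp
  qed
  then show ?thesis unfolding hausdorff_measure_def emeasure_measure_of_conv sg using B by simp
qed

lemma sets_hausdorff_measure [simp, measurable_cong]: "sets (hausdorff_measure n) = sets borel"
  unfolding hausdorff_measure_def using sets.sigma_sets_eq[of borel] by simp

lemma space_hausdorff_measure [simp]: "space (hausdorff_measure n) = UNIV"
  unfolding hausdorff_measure_def by simp

text \<open>By Lindelof countably many of the given neighbourhoods cover the space; making them
  disjoint turns the local inequalities into a sum over a Borel partition. \<open>N\<close> leaves
  room for an error measure.\<close>

lemma emeasure_le_locally:
  fixes M1 M2 N :: "'a::second_countable_topology measure"
  assumes [simp]: "sets M1 = sets borel" "sets M2 = sets borel" "sets N = sets borel"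
    and loc: "\<And>x. \<exists>U. open U \<and> x \<in> U \<and>
      (\<forall>D\<in>sets borel. D \<subseteq> U \<longrightarrow> emeasure M1 D \<le> emeasure M2 D + emeasure N D)"
  shows "emeasure M1 UNIV \<le> emeasure M2 UNIV + emeasure N UNIV"
proof -
  obtain U where U: "\<And>x. open (U x)" "\<And>x. x \<in> U x"
    "\<And>x D. D \<in> sets borel \<Longrightarrow> D \<subseteq> U x \<Longrightarrow> emeasure M1 D \<le> emeasure M2 D + emeasure N D"
    using loc by metis
  obtain F where F: "F \<subseteq> range U" "countable F" "\<Union>F = \<Union>(range U)"
    using Lindelof[of "range U"] U(1) by blast
  have "\<Union>F = UNIV" using F(3) U(2) by blast
  then have "F \<noteq> {}" by auto
  define D where "D = disjointed (from_nat_into F)"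
  have dis: "disjoint_family D" unfolding D_def by (rule disjoint_family_disjointed)
  have UD: "(\<Union>i. D i) = UNIV"
    unfolding D_def UN_disjointed_eq using \<open>\<Union>F = UNIV\<close> range_from_nat_into[OF \<open>F \<noteq> {}\<close> F(2)] by simp
  have FU: "from_nat_into F i \<in> range U" for i using F(1) from_nat_into[OF \<open>F \<noteq> {}\<close>] by blast
  have "open (from_nat_into F i)" for i using FU[of i] U(1) by auto
  then have "range (from_nat_into F) \<subseteq> sets borel" by auto
  then have Dm: "D i \<in> sets borel" for i unfolding D_def using sets.range_disjointed_sets by blast
  have le: "emeasure M1 (D i) \<le> emeasure M2 (D i) + emeasure N (D i)" for i
  proof -
    obtain x where "from_nat_into F i = U x" using FU by blast
    then have "D i \<subseteq> U x" using disjointed_subset[of "from_nat_into F" i] by (simp add: D_def)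
    then show ?thesis using U(3) Dm by blast
  qed
  have sums: "(\<Sum>i. emeasure M (D i)) = emeasure M UNIV" if "sets M = sets borel" for M :: "'a measure"
    unfolding UD[symmetric] using that Dm dis by (intro suminf_emeasure) auto
  have "emeasure M1 UNIV \<le> (\<Sum>i. emeasure M2 (D i) + emeasure N (D i))"
    unfolding sums[of M1, symmetric, simplified] by (intro suminf_le le) auto
  also have "\<dots> = emeasure M2 UNIV + emeasure N UNIV"
    using sums[of M2] sums[of N] by (simp add: suminf_add[symmetric])
  finally show ?thesis .
qed

section \<open>Coordinates on an n-dimensional plane with an orthonormal frame\<close>

definition orthonormal :: "nat \<Rightarrow> (nat \<Rightarrow> 'a::euclidean_space) \<Rightarrow> bool" where
  "orthonormal n \<tau> \<longleftrightarrow> (\<forall>i<n. \<forall>j<n. \<tau> i \<bullet> \<tau> j = (if i = j then 1 else 0))"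

definition lincomb :: "nat \<Rightarrow> (nat \<Rightarrow> 'a::euclidean_space) \<Rightarrow> (nat \<Rightarrow> real) \<Rightarrow> 'a" where
  "lincomb n \<tau> f = (\<Sum>i<n. f i *\<^sub>R \<tau> i)"

text \<open>The dimension \<open>n\<close> is a term and not a type, so Lebesgue measure on a
  tangent plane is represented by the product measure on coordinate functions, transported by
  \<open>lincomb n \<tau>\<close>.\<close>

abbreviation lebesgue_coords :: "nat \<Rightarrow> (nat \<Rightarrow> real) measure" where
  "lebesgue_coords n \<equiv> Pi\<^sub>M {..<n} (\<lambda>_. lborel)"

lemma measurable_coord [measurable]: "i < n \<Longrightarrow> (\<lambda>f. f i) \<in> borel_measurable (lebesgue_coords n)"
  using measurable_component_singleton[of i "{..<n}" "\<lambda>_. lborel :: real measure"] by simp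

lemma measurable_lincomb [measurable]: "lincomb n \<tau> \<in> borel_measurable (lebesgue_coords n)"
  unfolding lincomb_def[abs_def] by measurable

lemma inner_lincomb:
  assumes "orthonormal n \<tau>" "i < n"
  shows "lincomb n \<tau> f \<bullet> \<tau> i = f i"
proof -
  have "lincomb n \<tau> f \<bullet> \<tau> i = (\<Sum>j<n. if j = i then f j else 0)"
    unfolding lincomb_def inner_sum_left using assms by (intro sum.cong) (auto simp: orthonormal_def)
  then show ?thesis using assms by simp
qed

lemma norm_lincomb:
  assumes "orthonormal n \<tau>"
  shows "(norm (lincomb n \<tau> f))\<^sup>2 = (\<Sum>i<n. (f i)\<^sup>2)"
proof -
  have "(norm (lincomb n \<tau> f))\<^sup>2 = lincomb n \<tau> f \<bullet> (\<Sum>i<n. f i *\<^sub>R \<tau> i)"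
    by (simp add: power2_norm_eq_inner lincomb_def)
  also have "\<dots> = (\<Sum>i<n. f i * (lincomb n \<tau> f \<bullet> \<tau> i))" by (simp add: inner_sum_right)
  also have "\<dots> = (\<Sum>i<n. (f i)\<^sup>2)"
    using inner_lincomb[OF assms] by (intro sum.cong) (auto simp: power2_eq_square)
  finally show ?thesis .
qed

lemma emeasure_lincomb_bounded:
  assumes "orthonormal n \<tau>" "bounded K" "K \<in> sets borel"
  shows "emeasure (lebesgue_coords n) (lincomb n \<tau> -` K \<inter> space (lebesgue_coords n)) < \<infinity>"
proof -
  obtain r where r: "r > 0" "\<And>x. x \<in> K \<Longrightarrow> norm x \<le> r" using assms(2) by (auto simp: bounded_pos)
  have "lincomb n \<tau> -` K \<inter> space (lebesgue_coords n) \<subseteq> {f. sqrt (\<Sum>i\<in>{..<n}. (f i)\<^sup>2) \<le> r} \<inter> space (lebesgue_coords n)"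
    using r norm_lincomb[OF assms(1), symmetric] by auto
  then have "emeasure (lebesgue_coords n) (lincomb n \<tau> -` K \<inter> space (lebesgue_coords n)) \<le>
      emeasure (lebesgue_coords n) ({f. sqrt (\<Sum>i\<in>{..<n}. (f i)\<^sup>2) \<le> r} \<inter> space (lebesgue_coords n))"
    by (intro emeasure_mono) measurable
  also have "\<dots> < \<infinity>" using r by (subst emeasure_cball_aux) auto
  finally show ?thesis .
qed

lemma ennreal_le_add_small:
  assumes "\<And>\<epsilon>::real. 0 < \<epsilon> \<Longrightarrow> a \<le> b + ennreal \<epsilon> * c" "c < \<infinity>"
  shows "a \<le> (b::ennreal)"
proof -
  have "((\<lambda>\<epsilon>. b + ennreal \<epsilon> * c) \<longlongrightarrow> b + ennreal 0 * c) (at_right 0)"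
    using assms(2) by (intro tendsto_intros tendsto_ennrealI ennreal_tendsto_cmult)
      (auto intro!: tendsto_intros)
  moreover have "\<forall>\<^sub>F \<epsilon> in at_right 0. a \<le> b + ennreal \<epsilon> * c"
    using assms(1) by (auto simp: eventually_at_right_field intro!: exI[of _ 1])
  ultimately show ?thesis using tendsto_lowerbound by fastforce
qed

text \<open>A substitute for one half of the area formula: lower bounds on the density of Hausdorff
  measure, known only near each point and up to \<epsilon>, integrate to a global inequality.
  Continuity of \<open>g\<close> and \<open>j\<close> makes them nearly constant on small balls,
  \<open>emeasure_le_locally\<close> glues, and the total error is \<epsilon> times the finite
  volume of \<open>K\<close>.\<close>

lemma nn_integral_graph_ge:
  fixes \<gamma> \<pi> :: "'a::euclidean_space \<Rightarrow> 'a" and g j :: "'a \<Rightarrow> real"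
  assumes ortho: "orthonormal n \<tau>"
    and haus: "\<And>B. B \<in> sets borel \<Longrightarrow> emeasure (hausdorff_measure n) B = hausdorff_outer n (B :: 'a set)"
    and K: "compact K" "K \<subseteq> lincomb n \<tau> ` space (lebesgue_coords n)"
    and \<gamma>: "continuous_on K \<gamma>"
    and \<pi>: "\<pi> \<in> borel_measurable borel" "\<And>x. x \<in> K \<Longrightarrow> \<pi> (\<gamma> x) = x"
    and dens: "\<And>x \<epsilon>. x \<in> K \<Longrightarrow> 0 < \<epsilon> \<Longrightarrow> \<exists>\<delta>>0. \<forall>A\<in>sets (lebesgue_coords n).
       lincomb n \<tau> ` A \<subseteq> K \<inter> ball x \<delta> \<longrightarrow>
       ennreal (j x - \<epsilon>) * emeasure (lebesgue_coords n) A \<le> hausdorff_outer n (\<gamma> ` lincomb n \<tau> ` A)"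
    and g: "continuous_on UNIV g" "\<And>x. 0 < g x"
    and j: "continuous_on UNIV j" "\<And>x. x \<in> K \<Longrightarrow> 0 \<le> j x"
  shows "(\<integral>\<^sup>+f. indicator K (lincomb n \<tau> f) * ennreal (g (\<gamma> (lincomb n \<tau> f)) * j (lincomb n \<tau> f)) \<partial>lebesgue_coords n)
     \<le> (\<integral>\<^sup>+y\<in>\<gamma> ` K. ennreal (g y) \<partial>hausdorff_measure n)"
proof -
  let ?M = "lebesgue_coords n" and ?H = "hausdorff_measure n :: 'a measure" and ?E = "lincomb n \<tau>"
  have [measurable]: "K \<in> sets borel" using K(1) by (simp add: borel_compact)
  have \<gamma>K: "compact (\<gamma> ` K)" using compact_continuous_image[OF \<gamma> K(1)] .
  then have [measurable]: "\<gamma> ` K \<in> sets borel" by (simp add: borel_compact)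
  have [measurable]: "g \<in> borel_measurable borel" "j \<in> borel_measurable borel"
    using borel_measurable_continuous_onI g(1) j(1) by blast+
  note \<pi>(1)[measurable]
  have gamma_m: "(\<lambda>x. indicator K x *\<^sub>R \<gamma> x) \<in> borel_measurable borel"
    by (rule borel_measurable_continuous_on_indicator[OF _ \<gamma>]) measurable
  define w where "w x = indicator K x * ennreal (g (\<gamma> x) * j x)" for x
  have w_eq: "w x = indicator K x * ennreal (g (indicator K x *\<^sub>R \<gamma> x) * j x)" for x
    by (auto simp: w_def indicator_def)
  note gamma_m[measurable]
  have w_m [measurable]: "w \<in> borel_measurable borel" unfolding w_eq[abs_def] by measurable
  \<comment> \<open>Both sides become measures on the ambient space: \<open>M1\<close> is the
    weighted Lebesgue measure moved into the plane, \<open>M2\<close> the weighted Hausdorff measure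
    of the graph moved back to the plane by \<pi>.\<close>
  define M1 where "M1 = distr (density ?M (\<lambda>f. w (?E f))) borel ?E"
  define M2 where "M2 = distr (density ?H (\<lambda>y. ennreal (g y) * indicator (\<gamma> ` K) y)) borel \<pi>"
  have fin: "emeasure ?M (?E -` K \<inter> space ?M) < \<infinity>"
    using emeasure_lincomb_bounded[OF ortho compact_imp_bounded[OF K(1)]] by simp
  have M1: "emeasure M1 D = (\<integral>\<^sup>+f. w (?E f) * indicator (?E -` D \<inter> space ?M) f \<partial>?M)" if "D \<in> sets borel" for D
    unfolding M1_def using that by (subst emeasure_distr; simp add: emeasure_density)
  have M2: "emeasure M2 D = (\<integral>\<^sup>+y. ennreal (g y) * indicator (\<gamma> ` (K \<inter> D)) y \<partial>?H)" if [measurable]: "D \<in> sets borel" for D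
  proof -
    have "\<pi> -` D \<inter> space borel \<in> sets borel" by measurable
    then have "emeasure M2 D = (\<integral>\<^sup>+y. (ennreal (g y) * indicator (\<gamma> ` K) y) * indicator (\<pi> -` D \<inter> UNIV) y \<partial>?H)"
      unfolding M2_def by (subst emeasure_distr; (subst emeasure_density)?; simp)
    also have "\<dots> = (\<integral>\<^sup>+y. ennreal (g y) * indicator (\<gamma> ` (K \<inter> D)) y \<partial>?H)"
      using \<pi>(2) by (intro nn_integral_cong) (auto simp: indicator_def)
    finally show ?thesis .
  qed
  have main: "emeasure M1 UNIV \<le> emeasure M2 UNIV + ennreal \<epsilon> * emeasure ?M (?E -` K \<inter> space ?M)"
    if "0 < \<epsilon>" for \<epsilon> :: real
  proof -
    define N where "N = distr (density ?M (\<lambda>f. ennreal \<epsilon> * indicator K (?E f))) borel ?E"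
    have N: "emeasure N D = ennreal \<epsilon> * emeasure ?M (?E -` (K \<inter> D) \<inter> space ?M)" if [measurable]: "D \<in> sets borel" for D
    proof -
      have "emeasure N D = (\<integral>\<^sup>+f. ennreal \<epsilon> * indicator K (?E f) * indicator (?E -` D \<inter> space ?M) f \<partial>?M)"
        unfolding N_def by (subst emeasure_distr; simp add: emeasure_density)
      also have "\<dots> = (\<integral>\<^sup>+f. ennreal \<epsilon> * indicator (?E -` (K \<inter> D) \<inter> space ?M) f \<partial>?M)"
        by (intro nn_integral_cong) (auto simp: indicator_def)
      also have "\<dots> = ennreal \<epsilon> * emeasure ?M (?E -` (K \<inter> D) \<inter> space ?M)"
        by (intro nn_integral_cmult_indicator) measurable
      finally show ?thesis .
    qed
    have "emeasure M1 UNIV \<le> emeasure M2 UNIV + emeasure N UNIV"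
    proof (rule emeasure_le_locally)
      fix x
      show "\<exists>U. open U \<and> x \<in> U \<and> (\<forall>D\<in>sets borel. D \<subseteq> U \<longrightarrow> emeasure M1 D \<le> emeasure M2 D + emeasure N D)"
      proof (cases "x \<in> K")
        case False
        have "emeasure M1 D = 0" if "D \<in> sets borel" "D \<subseteq> - K" for D
        proof -
          have "emeasure M1 D = (\<integral>\<^sup>+f. 0 \<partial>?M)"
            unfolding M1[OF that(1)] using that(2) by (intro nn_integral_cong) (auto simp: w_def indicator_def)
          then show ?thesis by simp
        qed
        then show ?thesis using False compact_imp_closed[OF K(1)] by (intro exI[of _ "- K"]) auto
      next
        case x: True
        define a b where "a = g (\<gamma> x)" and "b = j x"
        have ab: "0 < a" "0 \<le> b" using g(2) j(2)[OF x] by (auto simp: a_def b_def)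
        \<comment> \<open>The gap between \<open>(a + e) * (b + e)\<close> and
          \<open>(a - e) * (b - e)\<close> is \<open>2 * e * (a + b)\<close>, which has to stay
          below \<epsilon>; the minimum with \<open>a\<close> keeps \<open>a - e\<close>
          nonnegative.\<close>
        define e where "e = min a (\<epsilon> / (2 * (a + b)))"
        have e: "0 < e" "e \<le> a" "2 * e * (a + b) \<le> \<epsilon>"
        proof -
          show "0 < e" "e \<le> a" using ab \<open>0 < \<epsilon>\<close> by (auto simp: e_def)
          have "e \<le> \<epsilon> / (2 * (a + b))" by (simp add: e_def)
          then show "2 * e * (a + b) \<le> \<epsilon>" using ab by (simp add: field_simps)
        qed
        obtain d1 where d1: "d1 > 0" "\<And>A. A \<in> sets ?M \<Longrightarrow> ?E ` A \<subseteq> K \<inter> ball x d1 \<Longrightarrow>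
            ennreal (b - e) * emeasure ?M A \<le> hausdorff_outer n (\<gamma> ` ?E ` A)"
          using dens[OF x e(1)] unfolding b_def by blast
        have "continuous_on K (\<lambda>x. g (\<gamma> x))"
          by (rule continuous_on_compose2[OF g(1) \<gamma>]) auto
        then obtain d2 where d2: "d2 > 0" "\<And>y. y \<in> K \<Longrightarrow> dist y x < d2 \<Longrightarrow> \<bar>g (\<gamma> y) - a\<bar> < e"
          using x e(1) unfolding continuous_on_iff a_def dist_real_def by metis
        obtain d3 where d3: "d3 > 0" "\<And>y. dist y x < d3 \<Longrightarrow> \<bar>j y - b\<bar> < e"
          using j(1) e(1) unfolding continuous_on_iff b_def dist_real_def by (metis UNIV_I)
        define d where "d = min d1 (min d2 d3)"
        have "d > 0" using d1 d2 d3 by (simp add: d_def)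
        have "emeasure M1 D \<le> emeasure M2 D + emeasure N D" if D [measurable]: "D \<in> sets borel" and sub: "D \<subseteq> ball x d" for D
        proof -
          define A where "A = ?E -` (K \<inter> D) \<inter> space ?M"
          have A [measurable]: "A \<in> sets ?M" unfolding A_def by measurable
          have EA: "?E ` A = K \<inter> D" using K(2) by (auto simp: A_def)
          have near: "dist y x < d1" "dist y x < d2" "dist y x < d3" if "y \<in> D" for y
            using sub that by (auto simp: d_def dist_commute)
          have "emeasure M1 D \<le> (\<integral>\<^sup>+f. ennreal ((a + e) * (b + e)) * indicator A f \<partial>?M)"
            unfolding M1[OF D]
          proof (intro nn_integral_mono)
            fix f
            show "w (?E f) * indicator (?E -` D \<inter> space ?M) f \<le> ennreal ((a + e) * (b + e)) * indicator A f"
            proof (cases "f \<in> A")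
              case True
              then have f: "?E f \<in> K" "?E f \<in> D" by (auto simp: A_def)
              have "g (\<gamma> (?E f)) \<le> a + e" "j (?E f) \<le> b + e"
                using d2(2)[OF f(1) near(2)[OF f(2)]] d3(2)[OF near(3)[OF f(2)]] by auto
              then have "g (\<gamma> (?E f)) * j (?E f) \<le> (a + e) * (b + e)"
                using g(2)[of "\<gamma> (?E f)"] j(2)[OF f(1)] e ab by (intro mult_mono) auto
              then show ?thesis using True f by (auto simp: w_def A_def intro: ennreal_leI)
            next
              case False
              then show ?thesis by (auto simp: w_def A_def indicator_def)
            qed
          qed
          also have "\<dots> = ennreal ((a + e) * (b + e)) * emeasure ?M A"
            by (rule nn_integral_cmult_indicator[OF A])
          also have "\<dots> \<le> (ennreal (a - e) * ennreal (b - e) + ennreal \<epsilon>) * emeasure ?M A"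
          proof (intro mult_right_mono)
            have "(a + e) * (b + e) = (a - e) * (b - e) + 2 * e * (a + b)" by (simp add: algebra_simps)
            also have "\<dots> \<le> (a - e) * (b - e) + \<epsilon>" using e(3) by simp
            \<comment> \<open>\<open>b - e\<close> may be negative, and \<open>ennreal\<close> sends
              negative numbers to 0; the \<open>max\<close> anticipates this truncation.\<close>
            also have "\<dots> \<le> (a - e) * max 0 (b - e) + \<epsilon>" using e by (intro add_right_mono mult_left_mono) auto
            finally have "ennreal ((a + e) * (b + e)) \<le> ennreal ((a - e) * max 0 (b - e) + \<epsilon>)" by (rule ennreal_leI)
            also have "\<dots> = ennreal (a - e) * ennreal (max 0 (b - e)) + ennreal \<epsilon>"
              using e \<open>0 < \<epsilon>\<close> by (simp add: ennreal_mult)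
            also have "ennreal (max 0 (b - e)) = ennreal (b - e)" by (auto simp: max_def ennreal_neg)
            finally show "ennreal ((a + e) * (b + e)) \<le> ennreal (a - e) * ennreal (b - e) + ennreal \<epsilon>" .
          qed simp
          also have "\<dots> = ennreal (a - e) * (ennreal (b - e) * emeasure ?M A) + ennreal \<epsilon> * emeasure ?M A"
            by (simp add: algebra_simps)
          also have "ennreal (a - e) * (ennreal (b - e) * emeasure ?M A) \<le> ennreal (a - e) * hausdorff_outer n (\<gamma> ` ?E ` A)"
          proof (intro mult_left_mono d1(2) A)
            show "?E ` A \<subseteq> K \<inter> ball x d1" unfolding EA using near(1) by (auto simp: dist_commute)
          qed simp
          also have "hausdorff_outer n (\<gamma> ` ?E ` A) = emeasure ?H (\<gamma> ` (K \<inter> D))"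
          proof -
            \<comment> \<open>The left inverse \<pi> shows that the image of this Borel set is
              Borel, which continuity of \<gamma> alone would not give.\<close>
            have "\<gamma> ` (K \<inter> D) = \<gamma> ` K \<inter> (\<pi> -` D \<inter> space borel)" using \<pi>(2) by auto
            also have "\<dots> \<in> sets borel" by measurable
            finally show ?thesis unfolding EA by (simp add: haus)
          qed
          also have "ennreal (a - e) * emeasure ?H (\<gamma> ` (K \<inter> D)) = (\<integral>\<^sup>+y. ennreal (a - e) * indicator (\<gamma> ` (K \<inter> D)) y \<partial>?H)"
          proof -
            have "\<gamma> ` (K \<inter> D) = \<gamma> ` K \<inter> (\<pi> -` D \<inter> space borel)" using \<pi>(2) by auto
            also have "\<dots> \<in> sets ?H" by measurable
            finally show ?thesis by (intro nn_integral_cmult_indicator[symmetric])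
          qed
          also have "\<dots> \<le> emeasure M2 D" unfolding M2[OF D]
          proof (intro nn_integral_mono)
            fix y
            show "ennreal (a - e) * indicator (\<gamma> ` (K \<inter> D)) y \<le> ennreal (g y) * indicator (\<gamma> ` (K \<inter> D)) y"
            proof (cases "y \<in> \<gamma> ` (K \<inter> D)")
              case True
              then obtain z where z: "z \<in> K" "z \<in> D" "y = \<gamma> z" by auto
              have "a - e \<le> g y" using d2(2)[OF z(1) near(2)[OF z(2)]] z(3) by auto
              then show ?thesis by (intro mult_right_mono ennreal_leI) auto
            qed simp
          qed
          also have "ennreal \<epsilon> * emeasure ?M A = emeasure N D" unfolding N[OF D] A_def by simp
          finally show ?thesis by (simp add: add_right_mono)
        qed
        then show ?thesis using \<open>d > 0\<close> by (intro exI[of _ "ball x d"]) auto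
      qed
    qed (simp_all add: M1_def M2_def N_def)
    then show ?thesis using N[of UNIV] by simp
  qed
  have "emeasure M1 UNIV \<le> emeasure M2 UNIV"
    by (rule ennreal_le_add_small[OF main fin])
  also have "emeasure M2 UNIV = (\<integral>\<^sup>+y\<in>\<gamma> ` K. ennreal (g y) \<partial>?H)" using M2[of UNIV] by simp
  also have "emeasure M1 UNIV = (\<integral>\<^sup>+f. w (?E f) \<partial>?M)"
    unfolding M1[of UNIV, simplified] by (intro nn_integral_cong) (auto simp: indicator_def)
  finally show ?thesis unfolding w_def .
qed

subsection \<open>Gaussian moments\<close>

definition gauss_moment :: "real \<Rightarrow> nat \<Rightarrow> real" where
  "gauss_moment \<sigma> k = (\<integral>x. normal_density 0 \<sigma> x * x ^ k \<partial>lborel)"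

lemma gauss_moment_simps:
  assumes "0 < \<sigma>"
  shows "gauss_moment \<sigma> 0 = 1" "gauss_moment \<sigma> (Suc 0) = 0" "gauss_moment \<sigma> 2 = \<sigma>\<^sup>2"
    "gauss_moment \<sigma> 3 = 0" "gauss_moment \<sigma> 4 = 3 * \<sigma> ^ 4" "gauss_moment \<sigma> 6 = 15 * \<sigma> ^ 6"
proof -
  have even: "gauss_moment \<sigma> (2 * k) = fact (2 * k) / ((2 / \<sigma>\<^sup>2) ^ k * fact k)" for k
    using integral_normal_moment_even[OF assms, of 0 k] by (simp add: gauss_moment_def)
  have odd: "gauss_moment \<sigma> (2 * k + 1) = 0" for k
    using integral_normal_moment_odd[OF assms, of 0 k] by (simp add: gauss_moment_def)
  show "gauss_moment \<sigma> 0 = 1" "gauss_moment \<sigma> 2 = \<sigma>\<^sup>2" "gauss_moment \<sigma> 4 = 3 * \<sigma> ^ 4" "gauss_moment \<sigma> 6 = 15 * \<sigma> ^ 6"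
    using even[of 0] even[of 1] even[of 2] even[of 3] assms
    by (simp_all add: fact_numeral power_divide power_mult[symmetric] field_simps numeral_2_eq_2[symmetric])
  show "gauss_moment \<sigma> (Suc 0) = 0" "gauss_moment \<sigma> 3 = 0"
    using odd[of 0] odd[of 1] by simp_all
qed

definition gauss_density :: "nat \<Rightarrow> real \<Rightarrow> (nat \<Rightarrow> real) \<Rightarrow> real" where
  "gauss_density n \<sigma> f = (\<Prod>i<n. normal_density 0 \<sigma> (f i))"

lemma gauss_monomial:
  assumes "0 < \<sigma>"
  shows "has_bochner_integral (lebesgue_coords n) (\<lambda>f. gauss_density n \<sigma> f * (\<Prod>i<n. f i ^ c i))
     (\<Prod>i<n. gauss_moment \<sigma> (c i))"
proof -
  interpret product_sigma_finite "\<lambda>_. lborel :: real measure" by standard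
  have int: "integrable lborel (\<lambda>x. normal_density 0 \<sigma> x * x ^ c i)" for i
    using integrable_normal_moment[OF assms, of 0] by simp
  have eq: "(\<lambda>f. gauss_density n \<sigma> f * (\<Prod>i<n. f i ^ c i)) = (\<lambda>f. \<Prod>i<n. normal_density 0 \<sigma> (f i) * f i ^ c i)"
    by (simp add: gauss_density_def prod.distrib)
  show ?thesis unfolding eq gauss_moment_def
    using product_integrable_prod[of "{..<n}" "\<lambda>i x. normal_density 0 \<sigma> x * x ^ c i"] int
      product_integral_prod[of "{..<n}" "\<lambda>i x. normal_density 0 \<sigma> x * x ^ c i"]
    by (simp add: has_bochner_integral_iff)
qed

lemma gauss_total:
  assumes "0 < \<sigma>"
  shows "has_bochner_integral (lebesgue_coords n) (gauss_density n \<sigma>) 1"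
  using gauss_monomial[OF assms, where c = "\<lambda>_. 0"] gauss_moment_simps(1)[OF assms] by simp

lemma prod_power_delta: "finite I \<Longrightarrow> i \<in> I \<Longrightarrow> (\<Prod>m\<in>I. (f m :: real) ^ of_bool (m = i)) = f i"
  by (subst prod.remove[of _ i]) (auto intro!: prod.neutral)

lemma gauss_moment2:
  assumes "0 < \<sigma>" "i < n" "j < n"
  shows "has_bochner_integral (lebesgue_coords n) (\<lambda>f. gauss_density n \<sigma> f * (f i * f j)) (if i = j then \<sigma>\<^sup>2 else 0)"
proof -
  define c :: "nat \<Rightarrow> nat" where "c m = of_bool (m = i) + of_bool (m = j)" for m
  have "(\<Prod>m<n. f m ^ c m) = f i * f j" for f :: "nat \<Rightarrow> real"
    using assms by (simp add: c_def power_add prod.distrib prod_power_delta)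
  moreover have "(\<Prod>m<n. gauss_moment \<sigma> (c m)) = (if i = j then \<sigma>\<^sup>2 else 0)"
  proof -
    have "(\<Prod>m<n. gauss_moment \<sigma> (c m)) = (\<Prod>m\<in>{i, j}. gauss_moment \<sigma> (c m))"
      using assms by (intro prod.mono_neutral_right) (auto simp: c_def gauss_moment_simps)
    also have "\<dots> = (if i = j then \<sigma>\<^sup>2 else 0)"
      using assms by (auto simp: c_def gauss_moment_simps numeral_2_eq_2[symmetric])
    finally show ?thesis .
  qed
  ultimately show ?thesis using gauss_monomial[OF assms(1), of n c] by simp
qed

text \<open>Isserlis' formula: each of the three pairings of the four indices contributes once. The
  exponent \<open>c m\<close> counts how often \<open>m\<close> occurs among them, the product is
  cut down to the occurring indices, and all patterns of coincidence are checked.\<close>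

lemma gauss_moment4:
  assumes "0 < \<sigma>" "i < n" "j < n" "k < n" "l < n"
  shows "has_bochner_integral (lebesgue_coords n) (\<lambda>f. gauss_density n \<sigma> f * (f i * f j * (f k * f l)))
    (\<sigma> ^ 4 * (of_bool (i = j) * of_bool (k = l) + of_bool (i = k) * of_bool (j = l) + of_bool (i = l) * of_bool (j = k)))"
proof -
  define c :: "nat \<Rightarrow> nat" where
    "c m = of_bool (m = i) + of_bool (m = j) + of_bool (m = k) + of_bool (m = l)" for m
  have "(\<Prod>m<n. f m ^ c m) = f i * f j * (f k * f l)" for f :: "nat \<Rightarrow> real"
    using assms by (simp add: c_def power_add prod.distrib prod_power_delta)
  moreover have "(\<Prod>m<n. gauss_moment \<sigma> (c m)) = \<sigma> ^ 4 *
    (of_bool (i = j) * of_bool (k = l) + of_bool (i = k) * of_bool (j = l) + of_bool (i = l) * of_bool (j = k))"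
  proof -
    have nums: "Suc (Suc 0) = 2" "Suc 2 = 3" "Suc 3 = 4" "Suc (Suc (Suc 0)) = 3" "Suc (Suc (Suc (Suc 0))) = 4" by simp_all
    have "(\<Prod>m<n. gauss_moment \<sigma> (c m)) = (\<Prod>m\<in>{i, j, k, l}. gauss_moment \<sigma> (c m))"
      using assms by (intro prod.mono_neutral_right) (auto simp: c_def gauss_moment_simps)
    also have "\<dots> = \<sigma> ^ 4 * (of_bool (i = j) * of_bool (k = l) + of_bool (i = k) * of_bool (j = l) + of_bool (i = l) * of_bool (j = k))"
      using gauss_moment_simps[OF assms(1)]
      by (cases "i = j"; cases "i = k"; cases "i = l"; cases "j = k"; cases "j = l"; cases "k = l")
         (simp_all add: c_def nums prod.insert_if power_add[symmetric])
    finally show ?thesis .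
  qed
  ultimately show ?thesis using gauss_monomial[OF assms(1), of n c] by simp
qed

lemma gauss_moment6:
  assumes "0 < \<sigma>" "i < n"
  shows "has_bochner_integral (lebesgue_coords n) (\<lambda>f. gauss_density n \<sigma> f * (f i) ^ 6) (15 * \<sigma> ^ 6)"
proof -
  define c :: "nat \<Rightarrow> nat" where "c m = 6 * of_bool (m = i)" for m
  have "(\<Prod>m<n. f m ^ c m) = f i ^ 6" for f :: "nat \<Rightarrow> real"
    using assms by (subst prod.remove[of _ i]) (auto simp: c_def intro!: prod.neutral)
  moreover have "(\<Prod>m<n. gauss_moment \<sigma> (c m)) = 15 * \<sigma> ^ 6"
    using assms by (subst prod.remove[of _ i]) (auto simp: c_def gauss_moment_simps intro!: prod.neutral)
  ultimately show ?thesis using gauss_monomial[OF assms(1), of n c] by simp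
qed

lemma gauss_quadratic:
  fixes a :: "nat \<Rightarrow> nat \<Rightarrow> 'b::euclidean_space"
  assumes "0 < \<sigma>"
  shows "has_bochner_integral (lebesgue_coords n) (\<lambda>f. gauss_density n \<sigma> f * (norm (\<Sum>j<n. f j *\<^sub>R a i j))\<^sup>2)
    (\<sigma>\<^sup>2 * (\<Sum>j<n. (norm (a i j))\<^sup>2))"
proof -
  have "(\<lambda>f. gauss_density n \<sigma> f * (norm (\<Sum>j<n. f j *\<^sub>R a i j))\<^sup>2) =
     (\<lambda>f. \<Sum>j<n. \<Sum>k<n. gauss_density n \<sigma> f * (f j * f k) * (a i j \<bullet> a i k))"
    by (simp add: power2_norm_eq_inner inner_sum_left inner_sum_right sum_distrib_left sum_distrib_right mult_ac inner_commute)
  moreover have "has_bochner_integral (lebesgue_coords n) \<dots> (\<Sum>j<n. \<Sum>k<n. (if j = k then \<sigma>\<^sup>2 else 0) * (a i j \<bullet> a i k))"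
    using gauss_moment2[OF assms] by (intro has_bochner_integral_sum has_bochner_integral_mult_left) auto
  moreover have "(\<Sum>j<n. \<Sum>k<n. (if j = k then \<sigma>\<^sup>2 else 0) * (a i j \<bullet> a i k)) = \<sigma>\<^sup>2 * (\<Sum>j<n. (norm (a i j))\<^sup>2)"
    by (simp add: sum_distrib_left power2_norm_eq_inner if_distrib[of "\<lambda>x. x * _"] cong: if_cong)
  ultimately show ?thesis by metis
qed

text \<open>Standard deviation \<open>sqrt (2 * t)\<close> gives covariance \<open>2 * t\<close>
  times the identity, so \<open>t *\<^sub>R \<eta>\<close> is the mean of the quadratic form. Of the
  three pairings in Isserlis' formula, the one that traces \<open>a\<close> twice yields
  \<open>|\<eta>|^2\<close> and cancels against the shift; by symmetry each of the other two yields
  the sum of the squared norms.\<close>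

lemma gauss_variance:
  fixes n :: nat and a :: "nat \<Rightarrow> nat \<Rightarrow> 'b::euclidean_space"
  assumes "0 < t" and sym: "\<And>i j. a i j = a j i"
  defines "\<eta> \<equiv> \<Sum>i<n. a i i"
  shows "has_bochner_integral (lebesgue_coords n) (\<lambda>f. gauss_density n (sqrt (2 * t)) f *
      (norm ((1/2) *\<^sub>R (\<Sum>i<n. \<Sum>j<n. (f i * f j) *\<^sub>R a i j) - t *\<^sub>R \<eta>))\<^sup>2)
    (2 * t\<^sup>2 * (\<Sum>i<n. \<Sum>j<n. (norm (a i j))\<^sup>2))"
proof -
  define \<sigma> where "\<sigma> = sqrt (2 * t)"
  have \<sigma>: "0 < \<sigma>" "\<sigma>\<^sup>2 = 2 * t" using assms(1) by (auto simp: \<sigma>_def)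
  have \<sigma>4: "\<sigma> ^ 4 = 4 * t\<^sup>2"
  proof -
    have "\<sigma> ^ 4 = (\<sigma>\<^sup>2)\<^sup>2" by simp
    then show ?thesis unfolding \<sigma>(2) by (simp add: power_mult_distrib)
  qed
  let ?g = "gauss_density n \<sigma>"
  have 1: "(norm ((1/2) *\<^sub>R (\<Sum>i<n. \<Sum>j<n. (f i * f j) *\<^sub>R a i j) - t *\<^sub>R \<eta>))\<^sup>2 =
      (1/4) * (\<Sum>i<n. \<Sum>j<n. \<Sum>k<n. \<Sum>l<n. f i * f j * (f k * f l) * (a i j \<bullet> a k l))
      - t * (\<Sum>i<n. \<Sum>j<n. f i * f j * (a i j \<bullet> \<eta>)) + t\<^sup>2 * (norm \<eta>)\<^sup>2" for f
  proof -
    let ?S = "\<Sum>i<n. \<Sum>j<n. (f i * f j) *\<^sub>R a i j"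
    have "(norm ((1/2) *\<^sub>R ?S - t *\<^sub>R \<eta>))\<^sup>2 = (1/4) * (?S \<bullet> ?S) - t * (?S \<bullet> \<eta>) + t\<^sup>2 * (norm \<eta>)\<^sup>2"
      unfolding power2_norm_eq_inner
      by (simp add: inner_diff_left inner_diff_right inner_commute power2_eq_square algebra_simps)
    moreover have "?S \<bullet> ?S = (\<Sum>i<n. \<Sum>j<n. \<Sum>k<n. \<Sum>l<n. f i * f j * (f k * f l) * (a i j \<bullet> a k l))"
      unfolding inner_sum_left by (simp add: inner_sum_right sum_distrib_left mult_ac)
    moreover have "?S \<bullet> \<eta> = (\<Sum>i<n. \<Sum>j<n. f i * f j * (a i j \<bullet> \<eta>))"
      by (simp add: inner_sum_left)
    ultimately show ?thesis by simp
  qed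
  have 2: "(\<lambda>f. ?g f * (norm ((1/2) *\<^sub>R (\<Sum>i<n. \<Sum>j<n. (f i * f j) *\<^sub>R a i j) - t *\<^sub>R \<eta>))\<^sup>2) =
      (\<lambda>f. (1/4) * (\<Sum>i<n. \<Sum>j<n. \<Sum>k<n. \<Sum>l<n. ?g f * (f i * f j * (f k * f l)) * (a i j \<bullet> a k l))
      - t * (\<Sum>i<n. \<Sum>j<n. ?g f * (f i * f j) * (a i j \<bullet> \<eta>)) + t\<^sup>2 * (norm \<eta>)\<^sup>2 * ?g f)"
    unfolding 1 by (simp add: fun_eq_iff algebra_simps sum_distrib_left)
  let ?D = "\<lambda>i j k l. of_bool (i = j) * of_bool (k = l) + of_bool (i = k) * of_bool (j = l) + of_bool (i = l) * of_bool (j = k) :: real"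
  have 3: "has_bochner_integral (lebesgue_coords n) (\<lambda>f. ?g f * (norm ((1/2) *\<^sub>R (\<Sum>i<n. \<Sum>j<n. (f i * f j) *\<^sub>R a i j) - t *\<^sub>R \<eta>))\<^sup>2)
     ((1/4) * (\<Sum>i<n. \<Sum>j<n. \<Sum>k<n. \<Sum>l<n. \<sigma> ^ 4 * ?D i j k l * (a i j \<bullet> a k l))
      - t * (\<Sum>i<n. \<Sum>j<n. (if i = j then \<sigma>\<^sup>2 else 0) * (a i j \<bullet> \<eta>)) + t\<^sup>2 * (norm \<eta>)\<^sup>2 * 1)"
    unfolding 2 using \<sigma>(1) gauss_moment2[OF \<sigma>(1)] gauss_moment4[OF \<sigma>(1)] gauss_total[OF \<sigma>(1)]
    by (intro has_bochner_integral_add has_bochner_integral_diff has_bochner_integral_mult_right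
         has_bochner_integral_sum has_bochner_integral_mult_left) auto
  have "(\<Sum>i<n. \<Sum>j<n. \<Sum>k<n. \<Sum>l<n. \<sigma> ^ 4 * ?D i j k l * (a i j \<bullet> a k l)) =
      \<sigma> ^ 4 * ((\<Sum>i<n. \<Sum>k<n. a i i \<bullet> a k k) + (\<Sum>i<n. \<Sum>j<n. a i j \<bullet> a i j) + (\<Sum>i<n. \<Sum>j<n. a i j \<bullet> a j i))"
  proof -
    have d: "(\<Sum>i<n. of_bool (P i) * g i) = (\<Sum>i<n. if P i then g i else 0)" for P and g :: "nat \<Rightarrow> real"
      by (intro sum.cong) auto
    have "(\<Sum>i<n. \<Sum>j<n. \<Sum>k<n. \<Sum>l<n. \<sigma> ^ 4 * ?D i j k l * (a i j \<bullet> a k l)) =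
       \<sigma> ^ 4 * ((\<Sum>i<n. \<Sum>j<n. of_bool (i = j) * (\<Sum>k<n. \<Sum>l<n. of_bool (k = l) * (a i j \<bullet> a k l)))
        + (\<Sum>i<n. \<Sum>j<n. \<Sum>k<n. of_bool (i = k) * (\<Sum>l<n. of_bool (j = l) * (a i j \<bullet> a k l)))
        + (\<Sum>i<n. \<Sum>j<n. \<Sum>k<n. of_bool (j = k) * (\<Sum>l<n. of_bool (i = l) * (a i j \<bullet> a k l))))"
      unfolding sum_distrib_left sum.distrib[symmetric] distrib_left
      by (intro sum.cong refl) (simp add: algebra_simps)
    also have "\<dots> = \<sigma> ^ 4 * ((\<Sum>i<n. \<Sum>k<n. a i i \<bullet> a k k) + (\<Sum>i<n. \<Sum>j<n. a i j \<bullet> a i j) + (\<Sum>i<n. \<Sum>j<n. a i j \<bullet> a j i))"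
      unfolding d by (simp add: sum.delta)
    finally show ?thesis .
  qed
  also have "(\<Sum>i<n. \<Sum>k<n. a i i \<bullet> a k k) = (norm \<eta>)\<^sup>2"
    unfolding \<eta>_def power2_norm_eq_inner by (simp add: inner_sum_left inner_sum_right)
       (rule sum.swap)
  also have "(\<Sum>i<n. \<Sum>j<n. a i j \<bullet> a j i) = (\<Sum>i<n. \<Sum>j<n. (norm (a i j))\<^sup>2)"
    using sym by (intro sum.cong) (auto simp: power2_norm_eq_inner)
  also have "(\<Sum>i<n. \<Sum>j<n. a i j \<bullet> a i j) = (\<Sum>i<n. \<Sum>j<n. (norm (a i j))\<^sup>2)"
    by (simp add: power2_norm_eq_inner)
  finally have 4: "(\<Sum>i<n. \<Sum>j<n. \<Sum>k<n. \<Sum>l<n. \<sigma> ^ 4 * ?D i j k l * (a i j \<bullet> a k l)) =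
     \<sigma> ^ 4 * ((norm \<eta>)\<^sup>2 + (\<Sum>i<n. \<Sum>j<n. (norm (a i j))\<^sup>2) + (\<Sum>i<n. \<Sum>j<n. (norm (a i j))\<^sup>2))" .
  have 5: "(\<Sum>i<n. \<Sum>j<n. (if i = j then \<sigma>\<^sup>2 else 0) * (a i j \<bullet> \<eta>)) = \<sigma>\<^sup>2 * (norm \<eta>)\<^sup>2"
  proof -
    have "(\<Sum>i<n. \<Sum>j<n. (if i = j then \<sigma>\<^sup>2 else 0) * (a i j \<bullet> \<eta>)) = (\<Sum>i<n. \<sigma>\<^sup>2 * (a i i \<bullet> \<eta>))"
      by (simp add: if_distrib[of "\<lambda>x. x * _"] cong: if_cong)
    also have "\<dots> = \<sigma>\<^sup>2 * (norm \<eta>)\<^sup>2"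
      by (simp add: sum_distrib_left[symmetric] inner_sum_left[symmetric] \<eta>_def[symmetric] power2_norm_eq_inner)
    finally show ?thesis .
  qed
  show ?thesis using 3[unfolded 4 5] unfolding \<sigma>4 \<sigma>(2) \<sigma>_def[symmetric]
    by (rule back_subst[of "has_bochner_integral _ _"]) (simp add: algebra_simps power2_eq_square)
qed

text \<open>Reduces the sixth power of the norm to pure sixth powers of coordinates, whose Gaussian
  moment \<open>gauss_moment6\<close> supplies. A product of three nonnegative numbers is at most
  the cube of their maximum, hence at most the sum of their cubes.\<close>

lemma sum_squares_cube_le: "(\<Sum>i<n. (f i :: real)\<^sup>2) ^ 3 \<le> 3 * (real n)\<^sup>2 * (\<Sum>i<n. f i ^ 6)"
proof -
  have abc: "a * b * c \<le> a ^ 3 + b ^ 3 + c ^ 3" if "0 \<le> a" "0 \<le> b" "0 \<le> c" for a b c :: real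
  proof -
    define m where "m = max a (max b c)"
    have "a * b * c \<le> m * m * m" using that by (intro mult_mono) (auto simp: m_def)
    also have "\<dots> = m ^ 3" by (simp add: power3_eq_cube)
    also have "\<dots> \<le> a ^ 3 + b ^ 3 + c ^ 3" using that by (auto simp: m_def max_def)
    finally show ?thesis .
  qed
  have "(\<Sum>i<n. (f i)\<^sup>2) ^ 3 = (\<Sum>i<n. \<Sum>j<n. \<Sum>k<n. (f i)\<^sup>2 * (f j)\<^sup>2 * (f k)\<^sup>2)"
    by (simp add: power3_eq_cube sum_product sum_distrib_left sum_distrib_right mult_ac)
  also have "\<dots> \<le> (\<Sum>i<n. \<Sum>j<n. \<Sum>k<n. (f i) ^ 6 + (f j) ^ 6 + (f k) ^ 6)"
    using abc[of "(f _)\<^sup>2" "(f _)\<^sup>2" "(f _)\<^sup>2"] by (intro sum_mono) (simp add: power_mult[symmetric])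
  also have "\<dots> = 3 * (real n)\<^sup>2 * (\<Sum>i<n. f i ^ 6)"
    by (simp add: sum.distrib power2_eq_square sum_distrib_left[symmetric])
  finally show ?thesis .
qed

subsection \<open>Graphs with a second-order expansion\<close>

text \<open>With \<open>Z = |x|^2 / t\<close>, every error term of the expansion is a polynomial of
  degree at most 3 in \<open>Z\<close>; all of them are put under the one majorant
  \<open>1 + Z ^ 3\<close>.\<close>

lemma cube_bounds:
  fixes Z :: real
  assumes "0 \<le> Z"
  shows "Z \<le> 1 + Z ^ 3" "Z\<^sup>2 \<le> 1 + Z ^ 3" "Z ^ 3 \<le> 1 + Z ^ 3"
proof -
  have "Z \<le> 1 + Z ^ 3 \<and> Z\<^sup>2 \<le> 1 + Z ^ 3"
  proof (cases "Z \<le> 1")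
    case True
    then have "Z\<^sup>2 \<le> 1" using assms by (simp add: power_le_one)
    then show ?thesis using True zero_le_power[OF assms, of 3] by linarith
  next
    case False
    then have "Z ^ 1 \<le> Z ^ 3" "Z ^ 2 \<le> Z ^ 3" by (intro power_increasing; simp)+
    then show ?thesis by simp
  qed
  then show "Z \<le> 1 + Z ^ 3" "Z\<^sup>2 \<le> 1 + Z ^ 3" "Z ^ 3 \<le> 1 + Z ^ 3" by auto
qed

text \<open>In the application \<open>Z = |x|^2 / t\<close>, \<open>b\<close> is the second-order
  gain in area, \<open>D\<close> the distance of \<open>B x x / 2\<close> from
  \<open>t *\<^sub>R \<eta>\<close>, \<open>d\<close> that of the true height \<open>u x\<close>,
  and \<alpha> the relative loss in the area density. After \<open>exp (- s) \<ge> 1 - s\<close>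
  with \<open>s = d^2 / (4 * t)\<close>, three errors remain: replacing \<open>d\<close> by
  \<open>D\<close> and the factor \<open>1 - \<alpha>\<close> cost multiples of
  \<open>\<epsilon> * t\<close>, while \<open>s * b\<close> is a product of two first-order
  quantities and costs \<open>t^2\<close>.\<close>

lemma weight_lower_bound:
  fixes C \<epsilon> t Z b D d \<alpha> N :: real
  assumes C: "1 \<le> C" and N: "0 \<le> N" and \<epsilon>: "0 \<le> \<epsilon>" "\<epsilon> \<le> 1" and t: "0 < t" and Z: "0 \<le> Z" "t * Z \<le> 1"
    and b: "0 \<le> b" "b \<le> N * C\<^sup>2 * (t * Z)" and D: "0 \<le> D" "D \<le> C * t * (Z + N)"
    and d: "0 \<le> d" "d \<le> D + \<epsilon> * (t * Z)" and \<alpha>: "\<alpha> = 3 * C * N * \<epsilon> * (t * Z)" "\<alpha> \<le> 1"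
  shows "1 + b - D\<^sup>2 / (4 * t) - t * ((2 * C * (N + 1) + 3 * C * N * (1 + N * C\<^sup>2)) * \<epsilon> + N * C ^ 4 * (2 + N\<^sup>2) * t) * (1 + Z ^ 3)
    \<le> exp (- (d\<^sup>2 / (4 * t))) * ((1 - \<alpha>) * (1 + b))"
proof -
  define s w where "s = d\<^sup>2 / (4 * t)" and "w = 1 + Z ^ 3"
  have w: "Z \<le> w" "Z\<^sup>2 \<le> w" "Z ^ 3 \<le> w" "0 \<le> w" using cube_bounds[OF Z(1)] Z by (auto simp: w_def)
  have s0: "0 \<le> s" using t by (simp add: s_def)
  have \<alpha>0: "0 \<le> \<alpha>" using \<alpha> C N \<epsilon> t Z by simp
  have tZ: "0 \<le> t * Z" using t Z by simp
  have s1: "s \<le> D\<^sup>2 / (4 * t) + t * (2 * C * (N + 1) * \<epsilon>) * w"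
  proof -
    have "d\<^sup>2 \<le> (D + \<epsilon> * (t * Z))\<^sup>2" using d by (intro power_mono) auto
    also have "\<dots> = D\<^sup>2 + 2 * D * (\<epsilon> * (t * Z)) + \<epsilon> * (\<epsilon> * (t * Z)\<^sup>2)" by (simp add: power2_eq_square algebra_simps)
    also have "\<dots> \<le> D\<^sup>2 + 2 * (C * t * (Z + N)) * (\<epsilon> * (t * Z)) + 1 * (\<epsilon> * (t * Z)\<^sup>2)"
      using D \<epsilon> tZ by (intro add_mono mult_mono order_refl) auto
    finally have "s \<le> (D\<^sup>2 + 2 * (C * t * (Z + N)) * (\<epsilon> * (t * Z)) + 1 * (\<epsilon> * (t * Z)\<^sup>2)) / (4 * t)"
      unfolding s_def using t by (intro divide_right_mono) auto
    also have "\<dots> = D\<^sup>2 / (4 * t) + t * \<epsilon> * (2 * C * Z\<^sup>2 + 2 * C * N * Z + Z\<^sup>2) / 4"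
      using t by (simp add: field_simps power2_eq_square)
    also have "\<dots> \<le> D\<^sup>2 / (4 * t) + t * \<epsilon> * (2 * C * w + 2 * C * N * w + C * w) / 4"
    proof -
      have "1 * Z\<^sup>2 \<le> C * w" using C w by (intro mult_mono) auto
      moreover have "2 * C * Z\<^sup>2 \<le> 2 * C * w" "2 * C * N * Z \<le> 2 * C * N * w" using C N w by (auto intro!: mult_left_mono)
      ultimately have "2 * C * Z\<^sup>2 + 2 * C * N * Z + Z\<^sup>2 \<le> 2 * C * w + 2 * C * N * w + C * w" by linarith
      then show ?thesis using t \<epsilon> by (intro add_left_mono divide_right_mono mult_left_mono) auto
    qed
    also have "\<dots> \<le> D\<^sup>2 / (4 * t) + t * (2 * C * (N + 1) * \<epsilon>) * w"
    proof -
      have "0 \<le> t * \<epsilon> * (C * w) " "0 \<le> t * \<epsilon> * (C * N * w)" using t \<epsilon> C N w by auto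
      then show ?thesis by (simp add: algebra_simps)
    qed
    finally show ?thesis .
  qed
  have sb: "s * b \<le> t * (N * C ^ 4 * (2 + N\<^sup>2) * t) * w"
  proof -
    have "d \<le> C * t * (2 * Z + N)"
    proof -
      have "\<epsilon> * (t * Z) \<le> C * (t * Z)" using \<epsilon> C tZ by (intro mult_right_mono) auto
      then have "d \<le> C * t * (Z + N) + C * (t * Z)" using d D by linarith
      also have "\<dots> = C * t * (2 * Z + N)" by (simp add: algebra_simps)
      finally show ?thesis .
    qed
    then have "d\<^sup>2 \<le> (C * t * (2 * Z + N))\<^sup>2" using d by (intro power_mono) auto
    also have "\<dots> \<le> (C * t)\<^sup>2 * (8 * Z\<^sup>2 + 2 * N\<^sup>2)"
    proof -
      have "(2 * Z + N)\<^sup>2 \<le> 8 * Z\<^sup>2 + 2 * N\<^sup>2" using zero_le_power2[of "2 * Z - N"] by (simp add: power2_eq_square algebra_simps)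
      then show ?thesis unfolding power_mult_distrib[of "C * t"] by (intro mult_left_mono) auto
    qed
    finally have "s \<le> (C * t)\<^sup>2 * (8 * Z\<^sup>2 + 2 * N\<^sup>2) / (4 * t)" unfolding s_def using t by (intro divide_right_mono) auto
    also have "\<dots> = t * C\<^sup>2 * (2 * Z\<^sup>2 + N\<^sup>2 / 2)" using t by (simp add: field_simps power2_eq_square)
    finally have "s * b \<le> (t * C\<^sup>2 * (2 * Z\<^sup>2 + N\<^sup>2 / 2)) * (N * C\<^sup>2 * (t * Z))"
      using s0 b t by (intro mult_mono) auto
    also have "\<dots> = t * t * N * C ^ 4 * (2 * Z ^ 3 + N\<^sup>2 / 2 * Z)"
      by (simp add: power2_eq_square power3_eq_cube power4_eq_xxxx algebra_simps)
    also have "\<dots> \<le> t * t * N * C ^ 4 * (2 * w + N\<^sup>2 * w)"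
    proof -
      have "N\<^sup>2 / 2 * Z \<le> N\<^sup>2 * w" using w Z by (intro mult_mono) auto
      then show ?thesis using t N C w by (intro mult_left_mono add_mono) auto
    qed
    finally show ?thesis by (simp add: algebra_simps)
  qed
  have ab: "\<alpha> * (1 + b) \<le> t * (3 * C * N * (1 + N * C\<^sup>2) * \<epsilon>) * w"
  proof -
    have "N * C\<^sup>2 * (t * Z) \<le> N * C\<^sup>2 * 1" using N Z by (intro mult_left_mono) auto
    then have "b \<le> N * C\<^sup>2" using b by simp
    then have "\<alpha> * (1 + b) \<le> \<alpha> * (1 + N * C\<^sup>2)" using \<alpha>0 by (intro mult_left_mono) auto
    also have "\<dots> = (3 * C * N * (1 + N * C\<^sup>2) * \<epsilon> * t) * Z" by (simp add: \<alpha>(1))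
    also have "\<dots> \<le> (3 * C * N * (1 + N * C\<^sup>2) * \<epsilon> * t) * w" using C N \<epsilon> t w by (intro mult_left_mono) auto
    finally show ?thesis by (simp add: mult_ac)
  qed
  have "1 + b - D\<^sup>2 / (4 * t) - t * ((2 * C * (N + 1) + 3 * C * N * (1 + N * C\<^sup>2)) * \<epsilon> + N * C ^ 4 * (2 + N\<^sup>2) * t) * w
      = 1 + b - (D\<^sup>2 / (4 * t) + t * (2 * C * (N + 1) * \<epsilon>) * w) - t * (3 * C * N * (1 + N * C\<^sup>2) * \<epsilon>) * w - t * (N * C ^ 4 * (2 + N\<^sup>2) * t) * w"
    by (simp add: algebra_simps)
  also have "\<dots> \<le> 1 + b - s - \<alpha> * (1 + b) - s * b" using s1 sb ab by linarith
  also have "\<dots> \<le> (1 - s) * ((1 - \<alpha>) * (1 + b))"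
  proof -
    have "0 \<le> s * (\<alpha> * (1 + b))" using s0 \<alpha>0 b by simp
    then show ?thesis by (simp add: algebra_simps)
  qed
  also have "\<dots> \<le> exp (- s) * ((1 - \<alpha>) * (1 + b))"
    using exp_ge_add_one_self[of "- s"] \<alpha> b by (intro mult_right_mono) auto
  finally show ?thesis unfolding s_def w_def .
qed

text \<open>\<open>P\<close> may be negative and is cut off at 0 first. For \<open>F\<close> only
  monotonicity of the nonnegative integral is used, so an integrand containing the graph function
  can be inserted directly.\<close>

lemma ennreal_integral_le_nn_integral:
  fixes F P :: "'b \<Rightarrow> real"
  assumes P: "integrable M P" and le: "\<And>x. P x \<le> F x" and F: "\<And>x. 0 \<le> F x"
  shows "ennreal (integral\<^sup>L M P) \<le> (\<integral>\<^sup>+x. ennreal (F x) \<partial>M)"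
proof -
  have int: "integrable M (\<lambda>x. max 0 (P x))" using P by auto
  have "ennreal (integral\<^sup>L M P) \<le> ennreal (\<integral>x. max 0 (P x) \<partial>M)"
    using P int by (intro ennreal_leI integral_mono) auto
  also have "\<dots> = (\<integral>\<^sup>+x. ennreal (max 0 (P x)) \<partial>M)"
    using int by (intro nn_integral_eq_integral[symmetric]) auto
  also have "\<dots> \<le> (\<integral>\<^sup>+x. ennreal (F x) \<partial>M)"
    using le F by (intro nn_integral_mono ennreal_leI) auto
  finally show ?thesis .
qed

lemma prod_one_plus_ge:
  fixes n :: nat
  assumes "\<And>i. i < n \<Longrightarrow> 0 \<le> (x i :: real)"
  shows "1 + (\<Sum>i<n. x i) \<le> (\<Prod>i<n. 1 + x i)"
  using assms
proof (induction n)
  case (Suc n)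
  have "0 \<le> x n * (\<Sum>i<n. x i)" using Suc.prems by (intro mult_nonneg_nonneg sum_nonneg) auto
  then have "1 + (\<Sum>i<Suc n. x i) \<le> (1 + (\<Sum>i<n. x i)) * (1 + x n)"
    by (simp add: algebra_simps)
  also have "\<dots> \<le> (\<Prod>i<n. 1 + x i) * (1 + x n)"
    using Suc by (intro mult_right_mono) auto
  finally show ?case by simp
qed simp

lemma sum_symmetric_split:
  fixes s :: "nat \<Rightarrow> nat \<Rightarrow> real"
  assumes "\<And>i j. s i j = s j i"
  shows "(\<Sum>i<n. \<Sum>j<n. s i j) = (\<Sum>i<n. s i i + 2 * (\<Sum>j\<in>{i<..<n}. s i j))"
proof (induction n)
  case (Suc n)
  have "(\<Sum>j\<in>{i<..<Suc n}. s i j) = (\<Sum>j\<in>{i<..<n}. s i j) + s i n" if "i < n" for i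
  proof -
    have "{i<..<Suc n} = insert n {i<..<n}" using that by auto
    then show ?thesis by simp
  qed
  moreover have "{n<..<Suc n} = {}" by auto
  ultimately have "(\<Sum>i<Suc n. s i i + 2 * (\<Sum>j\<in>{i<..<Suc n}. s i j)) =
      (\<Sum>i<n. s i i + 2 * (\<Sum>j\<in>{i<..<n}. s i j)) + 2 * (\<Sum>i<n. s i n) + s n n"
    by (simp add: sum.distrib sum_distrib_left[symmetric])
  also have "\<dots> = (\<Sum>i<n. \<Sum>j<n. s i j) + (\<Sum>i<n. s i n) + (\<Sum>j<n. s n j) + s n n"
    using Suc assms by simp
  also have "\<dots> = (\<Sum>i<Suc n. \<Sum>j<Suc n. s i j)" by (simp add: sum.distrib)
  finally show ?case by simp
qed simp

text \<open>A first-order Cholesky factorization. Let \<open>w\<close> be half the diagonal plus the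
  strict upper triangle of \<open>s\<close>, applied to \<open>v = f - g\<close>. Twice the inner
  product of \<open>v\<close> and \<open>w\<close> is the quadratic form of \<open>s\<close>, so
  \<open>|v + w|^2\<close> differs from the form of the identity plus \<open>s\<close> only by
  \<open>|w|^2\<close>, which is quadratic in the size of \<open>s\<close>.\<close>

lemma triangular_norm_bound:
  fixes s :: "nat \<Rightarrow> nat \<Rightarrow> real"
  assumes sym: "\<And>i j. s i j = s j i" and m: "\<And>i j. i < n \<Longrightarrow> j < n \<Longrightarrow> \<bar>s i j\<bar> \<le> m"
  shows "(\<Sum>i<n. (triangular n (\<lambda>i. 1 + s i i / 2) s n f i - triangular n (\<lambda>i. 1 + s i i / 2) s n g i)\<^sup>2)
    \<le> (\<Sum>i<n. (f i - g i)\<^sup>2) + (\<Sum>i<n. \<Sum>j<n. s i j * ((f i - g i) * (f j - g j))) + real n ^ 3 * m\<^sup>2 * (\<Sum>i<n. (f i - g i)\<^sup>2)"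
proof -
  define v w where "v i = f i - g i" and "w i = s i i / 2 * v i + (\<Sum>j\<in>{i<..<n}. s i j * v j)" for i
  define V where "V = (\<Sum>i<n. (v i)\<^sup>2)"
  have tri: "triangular n (\<lambda>i. 1 + s i i / 2) s n f i - triangular n (\<lambda>i. 1 + s i i / 2) s n g i = v i + w i" if "i < n" for i
    using that by (simp add: triangular_def v_def w_def algebra_simps sum_subtractf diff_divide_distrib add_divide_distrib)
  have "(\<Sum>i<n. 2 * (v i * w i)) = (\<Sum>i<n. s i i * (v i * v i) + 2 * (\<Sum>j\<in>{i<..<n}. s i j * (v i * v j)))"
    unfolding w_def by (intro sum.cong refl) (simp add: algebra_simps sum_distrib_left)
  also have "\<dots> = (\<Sum>i<n. \<Sum>j<n. s i j * (v i * v j))"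
    by (rule sum_symmetric_split[symmetric]) (simp add: sym mult.commute)
  finally have vw: "(\<Sum>i<n. 2 * (v i * w i)) = (\<Sum>i<n. \<Sum>j<n. s i j * (v i * v j))" .
  have "(w i)\<^sup>2 \<le> (real n)\<^sup>2 * m\<^sup>2 * V" if i: "i < n" for i
  proof -
    have "m \<ge> 0" using m[OF i i] by linarith
    have vV: "\<bar>v j\<bar> \<le> sqrt V" if "j < n" for j
    proof -
      have "(v j)\<^sup>2 \<le> V" unfolding V_def using that by (intro member_le_sum) auto
      then show ?thesis by (metis real_sqrt_abs real_sqrt_le_iff)
    qed
    have "\<bar>w i\<bar> \<le> \<bar>s i i / 2 * v i\<bar> + (\<Sum>j\<in>{i<..<n}. \<bar>s i j * v j\<bar>)"
      unfolding w_def by (intro order_trans[OF abs_triangle_ineq] add_left_mono sum_abs)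
    also have "\<dots> \<le> \<bar>s i i * v i\<bar> + (\<Sum>j\<in>{i<..<n}. \<bar>s i j * v j\<bar>)" by (simp add: abs_mult)
    also have "\<dots> = (\<Sum>j\<in>{i..<n}. \<bar>s i j * v j\<bar>)"
    proof -
      have "{i..<n} = insert i {i<..<n}" using i by auto
      then show ?thesis by simp
    qed
    also have "\<dots> \<le> (\<Sum>j<n. \<bar>s i j * v j\<bar>)" by (intro sum_mono2) auto
    also have "\<dots> \<le> (\<Sum>j<n. m * sqrt V)"
      unfolding abs_mult using m[OF i] vV \<open>m \<ge> 0\<close> by (intro sum_mono mult_mono) auto
    finally have "\<bar>w i\<bar> \<le> real n * (m * sqrt V)" by simp
    then have "(w i)\<^sup>2 \<le> (real n * (m * sqrt V))\<^sup>2" by (metis abs_ge_zero power2_abs power_mono)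
    also have "\<dots> = (real n)\<^sup>2 * m\<^sup>2 * V" by (simp add: power_mult_distrib V_def sum_nonneg)
    finally show ?thesis .
  qed
  then have "(\<Sum>i<n. (w i)\<^sup>2) \<le> (\<Sum>i<n. (real n)\<^sup>2 * m\<^sup>2 * V)" by (intro sum_mono) auto
  also have "\<dots> = real n ^ 3 * m\<^sup>2 * V" by (simp add: power3_eq_cube power2_eq_square)
  finally have ww: "(\<Sum>i<n. (w i)\<^sup>2) \<le> real n ^ 3 * m\<^sup>2 * V" .
  have "(\<Sum>i<n. (triangular n (\<lambda>i. 1 + s i i / 2) s n f i - triangular n (\<lambda>i. 1 + s i i / 2) s n g i)\<^sup>2) = (\<Sum>i<n. (v i + w i)\<^sup>2)"
    using tri by (intro sum.cong) auto
  also have "\<dots> = V + (\<Sum>i<n. 2 * (v i * w i)) + (\<Sum>i<n. (w i)\<^sup>2)"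
    unfolding V_def by (simp add: power2_sum sum.distrib mult_ac)
  finally show ?thesis using ww vw unfolding V_def v_def by simp
qed

text \<open>For orthonormal \<tau> this is the orthogonal projection onto the span of the frame, and
  \<open>frame_proj n \<tau> x = x\<close> serves as the membership test for that plane.\<close>

definition frame_proj :: "nat \<Rightarrow> (nat \<Rightarrow> 'a::euclidean_space) \<Rightarrow> 'a \<Rightarrow> 'a" where
  "frame_proj n \<tau> x = lincomb n \<tau> (\<lambda>i. x \<bullet> \<tau> i)"

lemma bounded_linear_frame_proj: "bounded_linear (frame_proj n \<tau>)"
  unfolding frame_proj_def[abs_def] lincomb_def
  by (intro bounded_linear_sum bounded_linear_compose[OF bounded_linear_scaleR_left] bounded_linear_inner_left)

lemma frame_proj_lincomb:
  assumes "orthonormal n \<tau>"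
  shows "frame_proj n \<tau> (lincomb n \<tau> f) = lincomb n \<tau> f"
proof -
  have "lincomb n \<tau> (\<lambda>i. lincomb n \<tau> f \<bullet> \<tau> i) = lincomb n \<tau> f"
    unfolding lincomb_def[of n \<tau> "\<lambda>i. lincomb n \<tau> f \<bullet> \<tau> i"] lincomb_def[of n \<tau> f, symmetric]
    using inner_lincomb[OF assms] by (simp add: lincomb_def)
  then show ?thesis by (simp add: frame_proj_def)
qed

lemma lincomb_diff: "lincomb n \<tau> f - lincomb n \<tau> g = lincomb n \<tau> (\<lambda>i. f i - g i)"
  by (simp add: lincomb_def sum_subtractf scaleR_left_diff_distrib)

lemma inner_lincomb_eq_0: "(\<And>i. i < n \<Longrightarrow> y \<bullet> \<tau> i = 0) \<Longrightarrow> lincomb n \<tau> f \<bullet> y = 0"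
  unfolding lincomb_def inner_sum_left by (rule sum.neutral) (simp add: inner_commute)

lemma norm_add_orthogonal: "x \<bullet> y = 0 \<Longrightarrow> (norm (x + y))\<^sup>2 = (norm x)\<^sup>2 + (norm y)\<^sup>2"
  by (simp add: power2_norm_eq_inner inner_add_left inner_add_right inner_commute)

text \<open>\<open>B\<close> stands for the form \<open>A\<close> of the overview: symmetric, with
  values normal to the frame. It acts on all ambient vectors, so that the bilinearity of the library
  applies, and \<open>C \<ge> 1\<close> allows powers of \<open>C\<close> to be compared without
  case distinctions.\<close>

locale graph_expansion =
  fixes n :: nat and \<tau> :: "nat \<Rightarrow> 'a::euclidean_space" and B :: "'a \<Rightarrow> 'a \<Rightarrow> 'a" and C :: real
  assumes ortho: "orthonormal n \<tau>" and bb: "bounded_bilinear B" and sym: "B x y = B y x"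
    and normal: "i < n \<Longrightarrow> B x y \<bullet> \<tau> i = 0"
    and C1: "1 \<le> C" and B_le: "norm (B x y) \<le> C * norm x * norm y"
begin

abbreviation "E \<equiv> lincomb n \<tau>"
abbreviation "M \<equiv> lebesgue_coords n"

text \<open>The expansion \<open>u x = B x x / 2 + o(|x|^2)\<close> in its C^1 form: the remainder
  has small Lipschitz constant of order \<open>\<epsilon> * |x|\<close>. A bound on values alone
  would not control distances within the graph, which is what coverings see.\<close>

definition remainder_bound :: "('a \<Rightarrow> 'a) \<Rightarrow> real \<Rightarrow> real \<Rightarrow> bool" where
  "remainder_bound u \<epsilon> \<rho> \<longleftrightarrow> (\<forall>x y. frame_proj n \<tau> x = x \<and> frame_proj n \<tau> y = y \<and> norm x \<le> \<rho> \<and> norm y \<le> \<rho> \<longrightarrow>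
     norm ((u x - (1/2) *\<^sub>R B x x) - (u y - (1/2) *\<^sub>R B y y)) \<le> \<epsilon> * max (norm x) (norm y) * norm (x - y))"

text \<open>The second factor is the Taylor expansion of the area element, the square root of the
  determinant of the induced metric at \<open>x\<close>. The first factor pays for the remainder of
  \<open>u\<close>.\<close>

definition area_weight :: "real \<Rightarrow> 'a \<Rightarrow> real" where
  "area_weight \<epsilon> x = (1 - 3 * C * n * \<epsilon> * (norm x)\<^sup>2) * (1 + (\<Sum>i<n. (norm (B x (\<tau> i)))\<^sup>2) / 2)"

lemma norm_frame: "i < n \<Longrightarrow> norm (\<tau> i) = 1"
  using ortho by (simp add: orthonormal_def norm_eq_sqrt_inner)

lemma B_lincomb: "B x (E f) = (\<Sum>i<n. f i *\<^sub>R B x (\<tau> i))"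
proof -
  interpret bounded_bilinear B by (rule bb)
  show ?thesis by (simp add: lincomb_def sum_right scaleR_right)
qed

lemma norm_B_lincomb:
  "(norm (B x (E f)))\<^sup>2 = (\<Sum>i<n. \<Sum>j<n. (B x (\<tau> i) \<bullet> B x (\<tau> j)) * (f i * f j))"
  unfolding B_lincomb power2_norm_eq_inner by (simp add: inner_sum_left inner_sum_right sum_distrib_left mult_ac inner_commute)

text \<open>Tangential and normal increments are orthogonal, so their squares add. The normal
  increment is \<open>B x0 v\<close> up to an error of relative size
  \<open>\<epsilon> * (norm x0 + \<delta>) + C * \<delta>\<close>: the first part is the remainder
  of \<open>u\<close>, the second the variation of the base point.\<close>

lemma graph_increment:
  assumes rem: "remainder_bound u \<epsilon> \<rho>" and \<epsilon>: "0 \<le> \<epsilon>"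
    and u: "\<And>x i. frame_proj n \<tau> x = x \<Longrightarrow> norm x \<le> \<rho> \<Longrightarrow> i < n \<Longrightarrow> u x \<bullet> \<tau> i = 0"
    and fg: "norm (E f) \<le> \<rho>" "norm (E g) \<le> \<rho>"
    and near: "dist x0 (E f) \<le> \<delta>" "dist x0 (E g) \<le> \<delta>" and \<delta>: "0 \<le> \<delta>"
  shows "(norm (E f - E g))\<^sup>2 + (norm (B x0 (E f - E g)))\<^sup>2
      - 2 * (\<epsilon> * (norm x0 + \<delta>) + C * \<delta>) * C * norm x0 * (norm (E f - E g))\<^sup>2
    \<le> (dist (p + E f + u (E f)) (p + E g + u (E g)))\<^sup>2"
proof -
  interpret bounded_bilinear B by (rule bb)
  define v where "v = E f - E g"
  define \<beta> where "\<beta> = \<epsilon> * (norm x0 + \<delta>) + C * \<delta>"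
  define m where "m = (1/2) *\<^sub>R (E f + E g)"
  define e where "e x = u x - (1/2) *\<^sub>R B x x" for x
  have \<beta>: "0 \<le> \<beta>" using \<epsilon> \<delta> C1 by (simp add: \<beta>_def)
  have "norm (E f) \<le> norm x0 + dist x0 (E f)" "norm (E g) \<le> norm x0 + dist x0 (E g)"
    using norm_triangle_ineq[of x0 "E f - x0"] norm_triangle_ineq[of x0 "E g - x0"]
    by (simp_all add: dist_norm norm_minus_commute)
  then have mx: "max (norm (E f)) (norm (E g)) \<le> norm x0 + \<delta>" using near by auto
  have "norm (e (E f) - e (E g)) \<le> \<epsilon> * max (norm (E f)) (norm (E g)) * norm v"
    using rem fg frame_proj_lincomb[OF ortho] unfolding remainder_bound_def e_def v_def by blast
  also have "\<dots> \<le> \<epsilon> * (norm x0 + \<delta>) * norm v" using mx \<epsilon> by (intro mult_right_mono mult_left_mono) auto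
  finally have e: "norm (e (E f) - e (E g)) \<le> \<epsilon> * (norm x0 + \<delta>) * norm v" .
  \<comment> \<open>For a symmetric form the difference of the two quadratic terms is exactly
    \<open>B m v\<close> with \<open>m\<close> the midpoint, so no further error arises
    here.\<close>
  have "u (E f) - u (E g) = B m v + (e (E f) - e (E g))"
  proof -
    have "B m v = (1/2) *\<^sub>R B (E f) (E f) - (1/2) *\<^sub>R B (E g) (E g)"
      unfolding m_def v_def
      by (simp add: scaleR_left add_left diff_right sym[of "E g" "E f"] scaleR_right_diff_distrib[symmetric])
    then show ?thesis by (simp add: e_def)
  qed
  also have "B m v = B x0 v + B (m - x0) v" by (simp add: diff_left)
  finally have ud: "u (E f) - u (E g) = B x0 v + (B (m - x0) v + (e (E f) - e (E g)))" by simp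
  have "norm (m - x0) \<le> \<delta>"
  proof -
    have "m - x0 = (1/2) *\<^sub>R (E f - x0) + (1/2) *\<^sub>R (E g - x0)"
    proof -
      have hh: "x0 = (1/2) *\<^sub>R x0 + (1/2) *\<^sub>R x0" by (simp flip: scaleR_left.add)
      show ?thesis by (subst (1) hh) (simp add: m_def scaleR_right_diff_distrib scaleR_right_distrib)
    qed
    then have "norm (m - x0) \<le> norm ((1/2) *\<^sub>R (E f - x0)) + norm ((1/2) *\<^sub>R (E g - x0))"
      by (simp only: norm_triangle_ineq)
    then show ?thesis using near by (simp add: dist_norm norm_minus_commute)
  qed
  then have "norm (B (m - x0) v) \<le> C * \<delta> * norm v"
    using B_le[of "m - x0" v] C1 by (smt (verit) mult_left_mono mult_right_mono norm_ge_zero)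
  then have "norm (B (m - x0) v + (e (E f) - e (E g))) \<le> \<beta> * norm v"
    using e norm_triangle_ineq[of "B (m - x0) v" "e (E f) - e (E g)"] unfolding \<beta>_def by (simp add: algebra_simps)
  then have lo: "norm (B x0 v) - \<beta> * norm v \<le> norm (u (E f) - u (E g))"
    unfolding ud using norm_triangle_ineq4[of "B x0 v + (B (m - x0) v + (e (E f) - e (E g)))" "B (m - x0) v + (e (E f) - e (E g))"]
    by simp
  define a where "a = norm (B x0 v)"
  define b where "b = \<beta> * norm v"
  have ab: "0 \<le> a" "0 \<le> b" using \<beta> by (auto simp: a_def b_def)
  have "a\<^sup>2 - 2 * a * b \<le> (norm (u (E f) - u (E g)))\<^sup>2"
  proof (cases "a \<ge> b")
    case True
    have "a\<^sup>2 - 2 * a * b \<le> (a - b)\<^sup>2" by (simp add: power2_eq_square algebra_simps)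
    also have "\<dots> \<le> (norm (u (E f) - u (E g)))\<^sup>2" using lo True by (intro power_mono) (auto simp: a_def b_def)
    finally show ?thesis .
  next
    case False
    then have "a * a \<le> a * b" "0 \<le> a * b" using ab by (auto intro: mult_left_mono)
    then have "a\<^sup>2 - 2 * a * b \<le> 0" by (simp add: power2_eq_square)
    also have "0 \<le> (norm (u (E f) - u (E g)))\<^sup>2" by simp
    finally show ?thesis .
  qed
  moreover have "a * b \<le> (C * norm x0 * norm v) * b" using ab B_le[of x0 v] unfolding a_def by (intro mult_right_mono) auto
  ultimately have 1: "(norm (B x0 v))\<^sup>2 - 2 * \<beta> * C * norm x0 * (norm v)\<^sup>2 \<le> (norm (u (E f) - u (E g)))\<^sup>2"
    unfolding a_def b_def by (simp add: power2_eq_square algebra_simps)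
  have "E (\<lambda>i. f i - g i) \<bullet> (u (E f) - u (E g)) = 0"
    using u fg frame_proj_lincomb[OF ortho] by (intro inner_lincomb_eq_0) (simp add: inner_diff_left)
  then have "(norm (v + (u (E f) - u (E g))))\<^sup>2 = (norm v)\<^sup>2 + (norm (u (E f) - u (E g)))\<^sup>2"
    unfolding v_def lincomb_diff by (rule norm_add_orthogonal)
  moreover have "dist (p + E f + u (E f)) (p + E g + u (E g)) = norm (v + (u (E f) - u (E g)))"
    by (simp add: dist_norm v_def algebra_simps)
  ultimately show ?thesis using 1 unfolding v_def \<beta>_def by simp
qed

text \<open>Near \<open>x0\<close> the squared distance on the graph dominates, up to the factor
  \<open>(1 - \<kappa>)^2\<close>, the form of the identity plus \<open>s\<close>, of which
  \<open>triangular\<close> is an approximate square root. The resulting factor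
  \<open>(1 - \<kappa>) ^ n\<close> times the product of the diagonal is bounded below by
  Bernoulli's inequality and \<open>prod_one_plus_ge\<close>.\<close>

lemma hausdorff_density:
  assumes rem: "remainder_bound u \<epsilon> \<rho>" and \<epsilon>: "0 < \<epsilon>" "\<epsilon> \<le> 1" and \<rho>: "0 < \<rho>" "\<rho> \<le> 1"
    "real n ^ 3 * C ^ 4 * \<rho>\<^sup>2 \<le> \<epsilon>" "12 * C * (n + 1) * \<rho>\<^sup>2 \<le> 1"
    and u: "\<And>x i. frame_proj n \<tau> x = x \<Longrightarrow> norm x \<le> \<rho> \<Longrightarrow> i < n \<Longrightarrow> u x \<bullet> \<tau> i = 0"
    and x0: "norm x0 \<le> \<rho>" and \<epsilon>1: "0 < \<epsilon>1"
  shows "\<exists>\<delta>>0. \<forall>A\<in>sets M. E ` A \<subseteq> cball 0 \<rho> \<inter> ball x0 \<delta> \<longrightarrow>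
     ennreal (area_weight \<epsilon> x0 - \<epsilon>1) * emeasure M A \<le> hausdorff_outer n ((\<lambda>x. p + x + u x) ` E ` A)"
proof -
  define X where "X = norm x0"
  define s where "s i j = B x0 (\<tau> i) \<bullet> B x0 (\<tau> j)" for i j
  define r where "r i = 1 + s i i / 2" for i
  define Q where "Q = 1 + (\<Sum>i<n. (norm (B x0 (\<tau> i)))\<^sup>2) / 2"
  have Q: "1 \<le> Q" by (simp add: Q_def sum_nonneg)
  define K where "K = (real n + 1) * C\<^sup>2"
  \<comment> \<open>The first entry keeps \<kappa> at most 1/2; the second makes the part of the
    loss that depends on \<delta> at most \<open>\<epsilon>1\<close>.\<close>
  define \<delta> where "\<delta> = min (1 / (16 * K)) (\<epsilon>1 / (4 * K * Q))"
  \<comment> \<open>The first summand collects what remains at \<open>x0\<close> itself: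
    \<open>2 * C * \<epsilon> * X\<^sup>2\<close> from the cross term of
    \<open>graph_increment\<close> and \<open>\<epsilon> * X\<^sup>2\<close> from the defect of the
    triangular root. The second collects what stems from the extent of the ball.\<close>
  define \<kappa> where "\<kappa> = 3 * C * \<epsilon> * X\<^sup>2 + 4 * C\<^sup>2 * \<delta>"
  have X: "0 \<le> X" "X \<le> \<rho>" "X \<le> 1" using x0 \<rho> by (auto simp: X_def)
  have Cp: "0 < C" "1 \<le> C\<^sup>2" using C1 by auto
  have K: "0 < K" using Cp by (simp add: K_def)
  have \<delta>0: "0 < \<delta>" using K Q \<epsilon>1 by (simp add: \<delta>_def)
  have d1: "4 * C\<^sup>2 * \<delta> * (n + 1) \<le> 1 / 4"
  proof -
    have "\<delta> \<le> 1 / (16 * K)" by (simp add: \<delta>_def)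
    then have "4 * K * \<delta> \<le> 1 / 4" using K by (simp add: field_simps)
    then show ?thesis by (simp add: K_def mult_ac add.commute)
  qed
  have d2: "(n + 1) * (4 * C\<^sup>2 * \<delta>) * Q \<le> \<epsilon>1"
  proof -
    have "\<delta> \<le> \<epsilon>1 / (4 * K * Q)" by (simp add: \<delta>_def)
    then have "4 * K * \<delta> * Q \<le> \<epsilon>1" using K Q by (simp add: field_simps)
    then show ?thesis by (simp add: K_def mult_ac add.commute)
  qed
  have xx: "3 * C * \<epsilon> * X\<^sup>2 * (n + 1) \<le> 1 / 4"
  proof -
    have "C * \<epsilon> * X\<^sup>2 * (n + 1) \<le> C * 1 * \<rho>\<^sup>2 * (n + 1)"
      using X Cp \<epsilon> by (intro mult_right_mono mult_mono power_mono) auto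
    moreover have "C * 1 * \<rho>\<^sup>2 * (n + 1) * 12 \<le> 1" using \<rho>(4) by (simp only: mult_ac mult_1)
    ultimately show ?thesis by linarith
  qed
  have \<kappa>: "0 \<le> \<kappa>" "\<kappa> * (n + 1) \<le> 1 / 2"
    using Cp \<epsilon> X \<delta>0 d1 xx unfolding \<kappa>_def by (auto simp: distrib_right)
  have \<kappa>1: "\<kappa> \<le> 1 / 2"
  proof -
    have "\<kappa> * 1 \<le> \<kappa> * (n + 1)" using \<kappa> by (intro mult_left_mono) auto
    then show ?thesis using \<kappa> by simp
  qed
  have r: "0 < r i" for i by (simp add: r_def s_def add_pos_nonneg)
  have s_sym: "s i j = s j i" for i j by (simp add: s_def inner_commute)
  have s_le: "\<bar>s i j\<bar> \<le> C\<^sup>2 * X\<^sup>2" if "i < n" "j < n" for i j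
  proof -
    have "\<bar>s i j\<bar> \<le> norm (B x0 (\<tau> i)) * norm (B x0 (\<tau> j))" unfolding s_def by (rule Cauchy_Schwarz_ineq2)
    also have "\<dots> \<le> (C * X) * (C * X)"
      using B_le[of x0 "\<tau> i"] B_le[of x0 "\<tau> j"] norm_frame that Cp X by (intro mult_mono) (auto simp: X_def)
    finally show ?thesis by (simp add: power2_eq_square mult_ac)
  qed
  have main: "ennreal (area_weight \<epsilon> x0 - \<epsilon>1) * emeasure M A \<le> hausdorff_outer n ((\<lambda>x. p + x + u x) ` E ` A)"
    if A: "A \<in> sets M" and EA: "E ` A \<subseteq> cball 0 \<rho> \<inter> ball x0 \<delta>" for A
  proof -
    have "ennreal ((1 - \<kappa>) ^ n * (\<Prod>i<n. r i)) * emeasure M A \<le> hausdorff_outer n ((\<lambda>f. p + E f + u (E f)) ` A)"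
    proof (rule hausdorff_outer_ge_PiM[OF A])
      fix f g assume fg: "f \<in> A" "g \<in> A"
      then have n1: "norm (E f) \<le> \<rho>" "norm (E g) \<le> \<rho>" "dist x0 (E f) \<le> \<delta>" "dist x0 (E g) \<le> \<delta>"
        using EA by (auto simp: subset_eq)
      define V where "V = (norm (E f - E g))\<^sup>2"
      define W where "W = (norm (B x0 (E f - E g)))\<^sup>2"
      have V: "V = (\<Sum>i<n. (f i - g i)\<^sup>2)" unfolding V_def lincomb_diff using norm_lincomb[OF ortho] by simp
      have W: "W = (\<Sum>i<n. \<Sum>j<n. s i j * ((f i - g i) * (f j - g j)))"
        unfolding W_def lincomb_diff norm_B_lincomb s_def ..
      have VW: "0 \<le> V" "0 \<le> W" by (auto simp: V_def W_def)
      have "(\<Sum>i<n. (triangular n r s n f i - triangular n r s n g i)\<^sup>2) \<le> V + W + real n ^ 3 * (C\<^sup>2 * X\<^sup>2)\<^sup>2 * V"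
        unfolding V W r_def[abs_def] by (rule triangular_norm_bound[OF s_sym s_le])
      also have "real n ^ 3 * (C\<^sup>2 * X\<^sup>2)\<^sup>2 * V \<le> \<epsilon> * X\<^sup>2 * V"
      proof -
        have "real n ^ 3 * (C\<^sup>2 * X\<^sup>2)\<^sup>2 = (real n ^ 3 * C ^ 4 * X\<^sup>2) * X\<^sup>2"
          by (simp add: power_mult_distrib power_mult[symmetric] power_add[symmetric])
        also have "\<dots> \<le> (real n ^ 3 * C ^ 4 * \<rho>\<^sup>2) * X\<^sup>2" using X Cp by (intro mult_right_mono mult_left_mono power_mono) auto
        also have "\<dots> \<le> \<epsilon> * X\<^sup>2" using \<rho>(3) by (intro mult_right_mono) auto
        finally show ?thesis using VW by (intro mult_right_mono) auto
      qed
      finally have tri: "(\<Sum>i<n. (triangular n r s n f i - triangular n r s n g i)\<^sup>2) \<le> V + W + \<epsilon> * X\<^sup>2 * V" by simp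
      have gi: "V + W - 2 * (\<epsilon> * (X + \<delta>) + C * \<delta>) * C * X * V \<le> (dist (p + E f + u (E f)) (p + E g + u (E g)))\<^sup>2"
        unfolding V_def W_def X_def using \<epsilon> n1 \<delta>0 by (intro graph_increment[OF rem _ u]) auto
      have "2 * (\<epsilon> * (X + \<delta>) + C * \<delta>) * C * X + \<epsilon> * X\<^sup>2 \<le> \<kappa>"
      proof -
        have "\<epsilon> * \<delta> * C * X \<le> 1 * \<delta> * C * C" using \<epsilon> \<delta>0 Cp C1 X by (intro mult_mono) auto
        moreover have "C * \<delta> * C * X \<le> C * \<delta> * C * 1" using \<delta>0 Cp X by (intro mult_left_mono) auto
        moreover have "1 * (\<epsilon> * X\<^sup>2) \<le> C * (\<epsilon> * X\<^sup>2)" using \<epsilon> C1 by (intro mult_right_mono) auto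
        ultimately show ?thesis unfolding \<kappa>_def by (simp add: algebra_simps power2_eq_square)
      qed
      then have k: "2 * (\<epsilon> * (X + \<delta>) + C * \<delta>) * C * X * V + \<epsilon> * X\<^sup>2 * V \<le> \<kappa> * V"
        using VW by (simp add: distrib_right[symmetric] mult_right_mono)
      \<comment> \<open>One of the two factors \<open>1 - \<kappa>\<close> is dropped. The other
        releases \<open>\<kappa> * V\<close>, which by \<open>k\<close> pays for the error in
        \<open>gi\<close> together with the excess in \<open>tri\<close>.\<close>
      have "(1 - \<kappa>)\<^sup>2 * (\<Sum>i<n. (triangular n r s n f i - triangular n r s n g i)\<^sup>2) \<le> (1 - \<kappa>) * (V + W + \<epsilon> * X\<^sup>2 * V)"
        using tri VW \<epsilon> \<kappa> \<kappa>1 by (intro mult_mono) (auto simp: power2_eq_square mult_left_le intro!: sum_nonneg)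
      also have "\<dots> \<le> V + W + \<epsilon> * X\<^sup>2 * V - \<kappa> * V"
      proof -
        have "0 \<le> \<kappa> * W" "0 \<le> \<kappa> * (\<epsilon> * X\<^sup>2 * V)" using \<kappa> VW \<epsilon> by auto
        then show ?thesis by (simp add: algebra_simps)
      qed
      also have "\<dots> \<le> (dist (p + E f + u (E f)) (p + E g + u (E g)))\<^sup>2" using gi k by linarith
      finally show "(1 - \<kappa>)\<^sup>2 * (\<Sum>i<n. (triangular n r s n f i - triangular n r s n g i)\<^sup>2)
          \<le> (dist (p + E f + u (E f)) (p + E g + u (E g)))\<^sup>2" .
    qed (use r \<kappa>1 in auto)
    moreover have "area_weight \<epsilon> x0 - \<epsilon>1 \<le> (1 - \<kappa>) ^ n * (\<Prod>i<n. r i)"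
    proof -
      have nk: "real n * \<kappa> \<le> 1 / 2"
      proof -
        have "real n * \<kappa> \<le> (n + 1) * \<kappa>" using \<kappa> by (intro mult_right_mono) auto
        then show ?thesis using \<kappa> by (simp add: mult.commute)
      qed
      have "area_weight \<epsilon> x0 - \<epsilon>1 \<le> area_weight \<epsilon> x0 - (n + 1) * (4 * C\<^sup>2 * \<delta>) * Q" using d2 by simp
      also have "\<dots> \<le> area_weight \<epsilon> x0 - n * (4 * C\<^sup>2 * \<delta>) * Q"
      proof -
        have "n * (4 * C\<^sup>2 * \<delta>) * Q \<le> (n + 1) * (4 * C\<^sup>2 * \<delta>) * Q" using \<delta>0 Q by (intro mult_right_mono) auto
        then show ?thesis by simp
      qed
      also have "\<dots> = (1 - n * \<kappa>) * Q"
        unfolding area_weight_def Q_def[symmetric] \<kappa>_def X_def by (simp add: algebra_simps)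
      also have "\<dots> \<le> (1 - \<kappa>) ^ n * (\<Prod>i<n. r i)"
      proof (intro mult_mono)
        show "1 - n * \<kappa> \<le> (1 - \<kappa>) ^ n" using Bernoulli_inequality[of "- \<kappa>" n] \<kappa>1 by simp
        have "Q = 1 + (\<Sum>i<n. s i i / 2)" by (simp add: Q_def s_def power2_norm_eq_inner sum_divide_distrib)
        also have "\<dots> \<le> (\<Prod>i<n. r i)" unfolding r_def by (intro prod_one_plus_ge) (simp add: s_def)
        finally show "Q \<le> (\<Prod>i<n. r i)" .
      qed (use \<kappa>1 Q in auto)
      finally show ?thesis .
    qed
    ultimately show ?thesis
      by (simp add: image_image) (meson ennreal_leI mult_right_mono order_trans zero_le)
  qed
  then show ?thesis using \<delta>0 by blast
qed

end

lemma gauss_density_eq: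
  assumes "orthonormal n \<tau>" "0 < t"
  shows "gauss_density n (sqrt (2 * t)) f
    = 1 / (4 * pi * t) powr (real n / 2) * exp (- ((norm (lincomb n \<tau> f))\<^sup>2 / (4 * t)))"
proof -
  have "gauss_density n (sqrt (2 * t)) f = (\<Prod>i<n. 1 / sqrt (4 * pi * t) * exp (- ((f i)\<^sup>2 / (4 * t))))"
    unfolding gauss_density_def normal_density_def using assms(2) by (intro prod.cong) (auto simp: mult_ac)
  also have "\<dots> = (1 / sqrt (4 * pi * t)) ^ n * exp (\<Sum>i<n. - ((f i)\<^sup>2 / (4 * t)))"
    unfolding prod.distrib exp_sum[OF finite_lessThan] by simp
  also have "(1 / sqrt (4 * pi * t)) ^ n = 1 / (4 * pi * t) powr (real n / 2)"
  proof -
    have "sqrt (4 * pi * t) ^ n = ((4 * pi * t) powr (1 / 2)) powr real n"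
      using assms(2) by (simp add: powr_half_sqrt powr_realpow)
    also have "\<dots> = (4 * pi * t) powr (real n / 2)" by (simp add: powr_powr)
    finally show ?thesis by (simp add: power_divide)
  qed
  also have "(\<Sum>i<n. - ((f i)\<^sup>2 / (4 * t))) = - ((norm (lincomb n \<tau> f))\<^sup>2 / (4 * t))"
    by (simp add: norm_lincomb[OF assms(1)] sum_negf sum_divide_distrib)
  finally show ?thesis .
qed

context graph_expansion
begin

lemma remainder_bound_mono: "remainder_bound u \<epsilon> \<rho> \<Longrightarrow> \<rho>' \<le> \<rho> \<Longrightarrow> remainder_bound u \<epsilon> \<rho>'"
  unfolding remainder_bound_def by (meson order_trans)

lemma frame_ball_eq_image: "{x. frame_proj n \<tau> x = x} \<subseteq> E ` space M"
proof
  fix x assume "x \<in> {x. frame_proj n \<tau> x = x}"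
  then have "x = E (restrict (\<lambda>i. x \<bullet> \<tau> i) {..<n})" by (simp add: frame_proj_def lincomb_def)
  moreover have "restrict (\<lambda>i. x \<bullet> \<tau> i) {..<n} \<in> space M" by (auto simp: space_PiM)
  ultimately show "x \<in> E ` space M" by blast
qed

text \<open>Entropy 1 enters twice: as the upper bound for the Gaussian integral with centre
  \<open>c\<close> and scale \<open>t\<close>, and, being nonzero, as the guarantee that
  \<open>hausdorff_measure\<close> agrees with \<open>hausdorff_outer\<close> on Borel sets. The
  projection onto the plane recovers the base point of a point of the graph.\<close>

lemma gaussian_area_ge:
  assumes ent: "entropy n \<Sigma> = 1"
    and u: "\<And>x i. frame_proj n \<tau> x = x \<Longrightarrow> norm x \<le> \<rho> \<Longrightarrow> i < n \<Longrightarrow> u x \<bullet> \<tau> i = 0"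
    and graph: "\<And>x. frame_proj n \<tau> x = x \<Longrightarrow> norm x \<le> \<rho> \<Longrightarrow> p + x + u x \<in> \<Sigma>"
    and rem: "remainder_bound u \<epsilon> \<rho>" and \<epsilon>: "0 < \<epsilon>" "\<epsilon> \<le> 1" and \<rho>: "0 < \<rho>" "\<rho> \<le> 1"
    "real n ^ 3 * C ^ 4 * \<rho>\<^sup>2 \<le> \<epsilon>" "12 * C * (n + 1) * \<rho>\<^sup>2 \<le> 1"
    and t: "0 < t"
  shows "(\<integral>\<^sup>+f. ennreal (if norm (E f) \<le> \<rho> then 1 / (4 * pi * t) powr (real n / 2) *
       exp (- ((norm (p + E f + u (E f) - c))\<^sup>2 / (4 * t))) * area_weight \<epsilon> (E f) else 0) \<partial>M) \<le> 1"
proof -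
  interpret bounded_bilinear B by (rule bb)
  interpret P: bounded_linear "frame_proj n \<tau>" by (rule bounded_linear_frame_proj)
  define K where "K = {x. frame_proj n \<tau> x = x} \<inter> cball 0 \<rho>"
  define \<gamma> where "\<gamma> x = p + x + u x" for x
  define g where "g y = 1 / (4 * pi * t) powr (real n / 2) * exp (- ((norm (y - c))\<^sup>2 / (4 * t)))" for y :: 'a
  have EK: "E f \<in> K \<longleftrightarrow> norm (E f) \<le> \<rho>" for f
    using frame_proj_lincomb[OF ortho] by (auto simp: K_def)
  have "closed {x. frame_proj n \<tau> x = x}"
    by (intro closed_Collect_eq continuous_intros P.continuous_on)
  then have K: "compact K" unfolding K_def by (intro closed_Int_compact compact_cball)
  have cB: "continuous_on S (\<lambda>x. B (h x) (k x))" if "continuous_on S h" "continuous_on S k" for S and h k :: "'a \<Rightarrow> 'a"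
    by (rule continuous_on[OF that])
  \<comment> \<open>Since \<epsilon> and \<rho> are at most 1, the remainder bound makes
    \<open>u x - B x x / 2\<close> Lipschitz with constant 1; this is the source of the continuity
    of \<open>u\<close>.\<close>
  have "continuous_on K (\<lambda>x. u x - (1/2) *\<^sub>R B x x)"
  proof (rule continuous_on_iff[THEN iffD2], intro ballI allI impI)
    fix x and e :: real assume x: "x \<in> K" and e: "0 < e"
    have "dist (u y - (1/2) *\<^sub>R B y y) (u x - (1/2) *\<^sub>R B x x) < e" if y: "y \<in> K" "dist y x < e" for y
    proof -
      have mm: "max (norm y) (norm x) \<le> 1" using x y \<rho> by (auto simp: K_def)
      have "norm ((u y - (1/2) *\<^sub>R B y y) - (u x - (1/2) *\<^sub>R B x x)) \<le> \<epsilon> * max (norm y) (norm x) * norm (y - x)"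
        using rem x y unfolding remainder_bound_def K_def by auto
      also have "\<dots> \<le> 1 * 1 * norm (y - x)" using \<epsilon> mm by (intro mult_right_mono mult_mono) (auto simp: le_max_iff_disj)
      finally show ?thesis using y by (simp add: dist_norm)
    qed
    then show "\<exists>d>0. \<forall>x'\<in>K. dist x' x < d \<longrightarrow> dist (u x' - (1/2) *\<^sub>R B x' x') (u x - (1/2) *\<^sub>R B x x) < e"
      using e by blast
  qed
  then have "continuous_on K (\<lambda>x. (u x - (1/2) *\<^sub>R B x x) + (1/2) *\<^sub>R B x x)"
    by (rule continuous_on_add) (intro continuous_intros cB)
  then have cu: "continuous_on K u" by (simp only: diff_add_cancel)
  have "(\<integral>\<^sup>+f. indicator K (E f) * ennreal (g (\<gamma> (E f)) * area_weight \<epsilon> (E f)) \<partial>M)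
     \<le> (\<integral>\<^sup>+y\<in>\<gamma> ` K. ennreal (g y) \<partial>hausdorff_measure n)"
  proof (rule nn_integral_graph_ge[where \<pi> = "\<lambda>y. frame_proj n \<tau> (y - p)", OF ortho _ K])
    show "emeasure (hausdorff_measure n) B = hausdorff_outer n B" if "B \<in> sets borel" for B :: "'a set"
      using emeasure_hausdorff_measure[OF _ that, of n \<Sigma>] ent by simp
    show "K \<subseteq> E ` space M" using frame_ball_eq_image by (auto simp: K_def)
    show "continuous_on K \<gamma>" unfolding \<gamma>_def by (intro continuous_intros cu)
    show "(\<lambda>y. frame_proj n \<tau> (y - p)) \<in> borel_measurable borel"
      by (intro borel_measurable_continuous_onI P.continuous_on continuous_intros)
    show "frame_proj n \<tau> (\<gamma> x - p) = x" if "x \<in> K" for x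
    proof -
      have "frame_proj n \<tau> (u x) = 0" using u that by (auto simp: frame_proj_def lincomb_def K_def)
      then show ?thesis using that by (simp add: \<gamma>_def K_def P.add)
    qed
    show "\<exists>\<delta>>0. \<forall>A\<in>sets M. E ` A \<subseteq> K \<inter> ball x \<delta> \<longrightarrow>
       ennreal (area_weight \<epsilon> x - e) * emeasure M A \<le> hausdorff_outer n (\<gamma> ` E ` A)" if "x \<in> K" "0 < e" for x e
    proof -
      have "norm x \<le> \<rho>" using that by (simp add: K_def)
      from hausdorff_density[OF rem \<epsilon> \<rho> u this that(2), of p]
      obtain \<delta> where "\<delta> > 0" "\<forall>A\<in>sets M. E ` A \<subseteq> cball 0 \<rho> \<inter> ball x \<delta> \<longrightarrow>
        ennreal (area_weight \<epsilon> x - e) * emeasure M A \<le> hausdorff_outer n (\<gamma> ` E ` A)"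
        unfolding \<gamma>_def by blast
      then show ?thesis by (intro exI[of _ \<delta>]) (auto simp: K_def)
    qed
    show "continuous_on UNIV g" unfolding g_def by (intro continuous_intros) (use t in auto)
    show "0 < g x" for x unfolding g_def using t by simp
    show "continuous_on UNIV (area_weight \<epsilon>)" unfolding area_weight_def[abs_def] by (intro continuous_intros cB) auto
    show "0 \<le> area_weight \<epsilon> x" if "x \<in> K" for x
    proof -
      have "3 * C * n * \<epsilon> * (norm x)\<^sup>2 \<le> 3 * C * n * 1 * \<rho>\<^sup>2"
        using that C1 \<epsilon> by (intro mult_mono power_mono) (auto simp: K_def)
      also have "\<dots> \<le> 12 * C * (n + 1) * \<rho>\<^sup>2"
      proof -
        have "0 \<le> C * real n * \<rho>\<^sup>2" "0 \<le> C * \<rho>\<^sup>2" using C1 by auto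
        then show ?thesis by (simp add: algebra_simps)
      qed
      finally have "3 * C * n * \<epsilon> * (norm x)\<^sup>2 \<le> 1" using \<rho> by linarith
      then show ?thesis unfolding area_weight_def by (intro mult_nonneg_nonneg add_nonneg_nonneg divide_nonneg_nonneg sum_nonneg) auto
    qed
  qed
  \<comment> \<open>The graph lies in \<Sigma> and the integrand is nonnegative, so the rest of
    \<Sigma> can be discarded.\<close>
  also have "\<dots> \<le> (\<integral>\<^sup>+y\<in>\<Sigma>. ennreal (g y) \<partial>hausdorff_measure n)"
    using graph by (intro nn_integral_mono mult_left_mono) (auto simp: indicator_def \<gamma>_def K_def)
  also have "\<dots> \<le> entropy n \<Sigma>"
    unfolding entropy_def g_def using t by (intro SUP_upper2[of c] SUP_upper2[of t]) auto
  finally have "(\<integral>\<^sup>+f. indicator K (E f) * ennreal (g (\<gamma> (E f)) * area_weight \<epsilon> (E f)) \<partial>M) \<le> 1"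
    by (simp add: ent)
  moreover have "(\<integral>\<^sup>+f. indicator K (E f) * ennreal (g (\<gamma> (E f)) * area_weight \<epsilon> (E f)) \<partial>M) =
     (\<integral>\<^sup>+f. ennreal (if norm (E f) \<le> \<rho> then 1 / (4 * pi * t) powr (real n / 2) *
       exp (- ((norm (p + E f + u (E f) - c))\<^sup>2 / (4 * t))) * area_weight \<epsilon> (E f) else 0) \<partial>M)"
    by (intro nn_integral_cong) (auto simp: EK indicator_def g_def \<gamma>_def)
  ultimately show ?thesis by simp
qed

end

section \<open>Gaussian expectation of the weight and the vanishing of the second-order term\<close>

context graph_expansion
begin

definition sff_sq :: real where
  "sff_sq = (\<Sum>i<n. \<Sum>j<n. (norm (B (\<tau> i) (\<tau> j)))\<^sup>2)"

lemma B_diag_lincomb: "B (E f) (E f) = (\<Sum>i<n. \<Sum>j<n. (f i * f j) *\<^sub>R B (\<tau> i) (\<tau> j))"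
proof -
  have "B (E f) (\<tau> j) = (\<Sum>i<n. f i *\<^sub>R B (\<tau> i) (\<tau> j))" for j
    using B_lincomb[of "\<tau> j" f] by (simp add: sym)
  then have "B (E f) (E f) = (\<Sum>j<n. \<Sum>i<n. (f i * f j) *\<^sub>R B (\<tau> i) (\<tau> j))"
    by (simp add: B_lincomb[of "E f"] scaleR_sum_right mult.commute)
  also have "\<dots> = (\<Sum>i<n. \<Sum>j<n. (f i * f j) *\<^sub>R B (\<tau> i) (\<tau> j))" by (rule sum.swap)
  finally show ?thesis .
qed

text \<open>The area term has expectation \<open>t * sff_sq\<close> and the distance term costs
  \<open>t * sff_sq / 2\<close>. The constant 360 is the product of the 3 from
  \<open>sum_squares_cube_le\<close>, the 15 of the sixth moment and the 8 from
  \<open>sqrt (2 * t) ^ 6 = 8 * t ^ 3\<close>.\<close>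

lemma expected_weight:
  assumes t: "0 < t"
  defines "\<eta> \<equiv> \<Sum>i<n. B (\<tau> i) (\<tau> i)"
  shows "has_bochner_integral M (\<lambda>f. gauss_density n (sqrt (2 * t)) f *
      (1 + (\<Sum>i<n. (norm (B (E f) (\<tau> i)))\<^sup>2) / 2 - (norm ((1/2) *\<^sub>R B (E f) (E f) - t *\<^sub>R \<eta>))\<^sup>2 / (4 * t)
        - \<kappa> * (1 + 3 * (real n)\<^sup>2 * (\<Sum>i<n. f i ^ 6) / t ^ 3)))
    (1 + t * sff_sq / 2 - \<kappa> * (1 + 360 * real n ^ 3))"
proof -
  let ?g = "gauss_density n (sqrt (2 * t))"
  have \<sigma>: "0 < sqrt (2 * t)" using t by simp
  have s2: "(sqrt (2 * t))\<^sup>2 = 2 * t" using t by simp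
  have s6: "sqrt (2 * t) ^ 6 = 8 * t ^ 3"
  proof -
    have "sqrt (2 * t) ^ 6 = ((sqrt (2 * t))\<^sup>2) ^ 3" by (simp only: power_mult[symmetric]) simp
    then show ?thesis unfolding s2 by (simp add: power_mult_distrib)
  qed
  have 1: "has_bochner_integral M (\<lambda>f. ?g f * (norm (B (E f) (\<tau> i)))\<^sup>2) (2 * t * (\<Sum>j<n. (norm (B (\<tau> i) (\<tau> j)))\<^sup>2))" for i
  proof -
    have "(\<lambda>f. B (E f) (\<tau> i)) = (\<lambda>f. \<Sum>j<n. f j *\<^sub>R B (\<tau> i) (\<tau> j))"
      using B_lincomb[of "\<tau> i"] by (simp add: sym fun_eq_iff)
    then show ?thesis using gauss_quadratic[OF \<sigma>, of n "\<lambda>i j. B (\<tau> i) (\<tau> j)" i] unfolding s2 by metis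
  qed
  have 2: "has_bochner_integral M (\<lambda>f. ?g f * (norm ((1/2) *\<^sub>R B (E f) (E f) - t *\<^sub>R \<eta>))\<^sup>2) (2 * t\<^sup>2 * sff_sq)"
    unfolding B_diag_lincomb \<eta>_def sff_sq_def by (rule gauss_variance[OF t sym])
  have eq: "(\<lambda>f. ?g f *
      (1 + (\<Sum>i<n. (norm (B (E f) (\<tau> i)))\<^sup>2) / 2 - (norm ((1/2) *\<^sub>R B (E f) (E f) - t *\<^sub>R \<eta>))\<^sup>2 / (4 * t)
        - \<kappa> * (1 + 3 * (real n)\<^sup>2 * (\<Sum>i<n. f i ^ 6) / t ^ 3))) =
     (\<lambda>f. (1 - \<kappa>) * ?g f + (1/2) * (\<Sum>i<n. ?g f * (norm (B (E f) (\<tau> i)))\<^sup>2)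
        - 1 / (4 * t) * (?g f * (norm ((1/2) *\<^sub>R B (E f) (E f) - t *\<^sub>R \<eta>))\<^sup>2)
        - (\<kappa> * 3 * (real n)\<^sup>2 / t ^ 3) * (\<Sum>i<n. ?g f * f i ^ 6))"
  proof
    fix f
    have "G * (1 + A / 2 - D / (4 * t) - \<kappa> * (1 + 3 * (real n)\<^sup>2 * S / t ^ 3)) =
      (1 - \<kappa>) * G + (1/2) * (G * A) - 1 / (4 * t) * (G * D) - (\<kappa> * 3 * (real n)\<^sup>2 / t ^ 3) * (G * S)" for G A D S
      by (simp add: algebra_simps)
    then show "?g f * (1 + (\<Sum>i<n. (norm (B (E f) (\<tau> i)))\<^sup>2) / 2 - (norm ((1/2) *\<^sub>R B (E f) (E f) - t *\<^sub>R \<eta>))\<^sup>2 / (4 * t)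
        - \<kappa> * (1 + 3 * (real n)\<^sup>2 * (\<Sum>i<n. f i ^ 6) / t ^ 3)) =
      (1 - \<kappa>) * ?g f + (1/2) * (\<Sum>i<n. ?g f * (norm (B (E f) (\<tau> i)))\<^sup>2)
        - 1 / (4 * t) * (?g f * (norm ((1/2) *\<^sub>R B (E f) (E f) - t *\<^sub>R \<eta>))\<^sup>2)
        - (\<kappa> * 3 * (real n)\<^sup>2 / t ^ 3) * (\<Sum>i<n. ?g f * f i ^ 6)"
      unfolding sum_distrib_left[symmetric] .
  qed
  have "has_bochner_integral M (\<lambda>f. (1 - \<kappa>) * ?g f + (1/2) * (\<Sum>i<n. ?g f * (norm (B (E f) (\<tau> i)))\<^sup>2)
        - 1 / (4 * t) * (?g f * (norm ((1/2) *\<^sub>R B (E f) (E f) - t *\<^sub>R \<eta>))\<^sup>2)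
        - (\<kappa> * 3 * (real n)\<^sup>2 / t ^ 3) * (\<Sum>i<n. ?g f * f i ^ 6))
     ((1 - \<kappa>) * 1 + (1/2) * (\<Sum>i<n. 2 * t * (\<Sum>j<n. (norm (B (\<tau> i) (\<tau> j)))\<^sup>2))
        - 1 / (4 * t) * (2 * t\<^sup>2 * sff_sq) - (\<kappa> * 3 * (real n)\<^sup>2 / t ^ 3) * (\<Sum>i<n. 15 * sqrt (2 * t) ^ 6))"
    using 1 2 gauss_total[OF \<sigma>] gauss_moment6[OF \<sigma>]
    by (intro has_bochner_integral_add has_bochner_integral_diff has_bochner_integral_mult_right
         has_bochner_integral_sum) auto
  moreover have "(1 - \<kappa>) * 1 + (1/2) * (\<Sum>i<n. 2 * t * (\<Sum>j<n. (norm (B (\<tau> i) (\<tau> j)))\<^sup>2))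
        - 1 / (4 * t) * (2 * t\<^sup>2 * sff_sq) - (\<kappa> * 3 * (real n)\<^sup>2 / t ^ 3) * (\<Sum>i<n. 15 * sqrt (2 * t) ^ 6)
      = 1 + t * sff_sq / 2 - \<kappa> * (1 + 360 * real n ^ 3)"
  proof -
    have "(\<Sum>i<n. 2 * t * (\<Sum>j<n. (norm (B (\<tau> i) (\<tau> j)))\<^sup>2)) = 2 * t * sff_sq"
      by (simp add: sff_sq_def sum_distrib_left)
    moreover have "(\<kappa> * 3 * (real n)\<^sup>2 / t ^ 3) * (\<Sum>i<n. 15 * sqrt (2 * t) ^ 6) = \<kappa> * 360 * real n ^ 3"
      unfolding s6 using t by (simp add: power2_eq_square power3_eq_cube)
    moreover have "1 / (4 * t) * (2 * t\<^sup>2 * sff_sq) = t * sff_sq / 2" using t by (simp add: power2_eq_square)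
    ultimately show ?thesis by (simp add: algebra_simps)
  qed
  ultimately show ?thesis unfolding eq by (simp only:)
qed

text \<open>Extends the lower bound to the whole plane, so that it can be integrated exactly with
  Gaussian moments. Inside radius \<rho> it is \<open>weight_lower_bound\<close>; outside, where the
  right side is 0, the error term must make the left side nonpositive.\<close>

lemma weight_pointwise:
  assumes u: "\<And>x i. frame_proj n \<tau> x = x \<Longrightarrow> norm x \<le> \<rho> \<Longrightarrow> i < n \<Longrightarrow> u x \<bullet> \<tau> i = 0" and u0: "u 0 = 0"
    and rem: "remainder_bound u \<epsilon> \<rho>" and \<epsilon>: "0 < \<epsilon>" "\<epsilon> \<le> 1" and \<rho>: "0 < \<rho>" "\<rho> \<le> 1"
    "12 * C * (n + 1) * \<rho>\<^sup>2 \<le> 1"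
    and t: "0 < t"
  defines "\<eta> \<equiv> \<Sum>i<n. B (\<tau> i) (\<tau> i)"
    and "c1 \<equiv> 2 * C * (real n + 1) + 3 * C * real n * (1 + real n * C\<^sup>2)"
    and "c2 \<equiv> real n * C ^ 4 * (2 + (real n)\<^sup>2) + 1 / \<rho> ^ 4 + real n * C\<^sup>2 / \<rho>\<^sup>2"
  shows "gauss_density n (sqrt (2 * t)) f *
      (1 + (\<Sum>i<n. (norm (B (E f) (\<tau> i)))\<^sup>2) / 2 - (norm ((1/2) *\<^sub>R B (E f) (E f) - t *\<^sub>R \<eta>))\<^sup>2 / (4 * t)
        - t * (c1 * \<epsilon> + c2 * t) * (1 + 3 * (real n)\<^sup>2 * (\<Sum>i<n. f i ^ 6) / t ^ 3))
    \<le> (if norm (E f) \<le> \<rho> then 1 / (4 * pi * t) powr (real n / 2) *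
       exp (- ((norm (p + E f + u (E f) - (p + t *\<^sub>R \<eta>)))\<^sup>2 / (4 * t))) * area_weight \<epsilon> (E f) else 0)"
proof -
  interpret bounded_bilinear B by (rule bb)
  define X where "X = norm (E f)"
  define Z where "Z = X\<^sup>2 / t"
  define N where "N = real n"
  define b where "b = (\<Sum>i<n. (norm (B (E f) (\<tau> i)))\<^sup>2) / 2"
  define D where "D = norm ((1/2) *\<^sub>R B (E f) (E f) - t *\<^sub>R \<eta>)"
  define G where "G = gauss_density n (sqrt (2 * t)) f"
  define W where "W = 1 + 3 * N\<^sup>2 * (\<Sum>i<n. f i ^ 6) / t ^ 3"
  have G: "0 \<le> G" unfolding G_def gauss_density_def by (intro prod_nonneg) auto
  have Z: "0 \<le> Z" "t * Z = X\<^sup>2" using t by (auto simp: Z_def)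
  have N: "0 \<le> N" by (simp add: N_def)
  have c: "0 \<le> c1" "0 \<le> c2" using C1 \<rho> by (auto simp: c1_def c2_def)
  have ZW: "1 + Z ^ 3 \<le> W"
  proof -
    have "Z ^ 3 = (\<Sum>i<n. (f i)\<^sup>2) ^ 3 / t ^ 3" by (simp add: Z_def X_def norm_lincomb[OF ortho] power_divide)
    also have "\<dots> \<le> 3 * (real n)\<^sup>2 * (\<Sum>i<n. f i ^ 6) / t ^ 3"
      using sum_squares_cube_le[of f n] t by (intro divide_right_mono) auto
    finally show ?thesis by (simp add: W_def N_def)
  qed
  have b: "0 \<le> b" "b \<le> N * C\<^sup>2 * (t * Z)"
  proof -
    show "0 \<le> b" by (simp add: b_def sum_nonneg)
    have "norm (B (E f) (\<tau> i)) \<le> C * X" if "i < n" for i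
      using B_le[of "E f" "\<tau> i"] norm_frame[OF that] by (simp add: X_def)
    then have "(\<Sum>i<n. (norm (B (E f) (\<tau> i)))\<^sup>2) \<le> (\<Sum>i<n. (C * X)\<^sup>2)"
      by (intro sum_mono power_mono) auto
    also have "\<dots> = N * C\<^sup>2 * X\<^sup>2" by (simp add: N_def power_mult_distrib)
    finally have "2 * b \<le> N * C\<^sup>2 * X\<^sup>2" by (simp add: b_def)
    then show "b \<le> N * C\<^sup>2 * (t * Z)" using \<open>0 \<le> b\<close> unfolding Z(2) by linarith
  qed
  have \<eta>: "norm \<eta> \<le> C * N"
  proof -
    have "norm \<eta> \<le> (\<Sum>i<n. norm (B (\<tau> i) (\<tau> i)))" unfolding \<eta>_def by (rule norm_sum)
    also have "\<dots> \<le> (\<Sum>i<n. C)"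
    proof (rule sum_mono)
      fix i assume "i \<in> {..<n}"
      then show "norm (B (\<tau> i) (\<tau> i)) \<le> C" using B_le[of "\<tau> i" "\<tau> i"] norm_frame[of i] by simp
    qed
    finally show ?thesis by (simp add: N_def mult.commute)
  qed
  have D: "0 \<le> D" "D \<le> C * t * (Z + N)"
  proof -
    show "0 \<le> D" by (simp add: D_def)
    have "D \<le> norm ((1/2) *\<^sub>R B (E f) (E f)) + norm (t *\<^sub>R \<eta>)" unfolding D_def by (rule norm_triangle_ineq4)
    also have "\<dots> \<le> C * X\<^sup>2 + t * (C * N)"
    proof (intro add_mono)
      have "norm (B (E f) (E f)) \<le> C * X\<^sup>2" using B_le[of "E f" "E f"] by (simp add: X_def power2_eq_square mult_ac)
      moreover have "0 \<le> C * X\<^sup>2" using C1 by simp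
      ultimately show "norm ((1/2) *\<^sub>R B (E f) (E f)) \<le> C * X\<^sup>2" by simp
      show "norm (t *\<^sub>R \<eta>) \<le> t * (C * N)" using \<eta> t by (simp add: mult_left_mono)
    qed
    finally show "D \<le> C * t * (Z + N)" unfolding Z(2)[symmetric] by (simp add: algebra_simps)
  qed
  have "G * (1 + b - D\<^sup>2 / (4 * t) - t * (c1 * \<epsilon> + c2 * t) * W) \<le>
     (if X \<le> \<rho> then 1 / (4 * pi * t) powr (real n / 2) *
       exp (- ((norm (p + E f + u (E f) - (p + t *\<^sub>R \<eta>)))\<^sup>2 / (4 * t))) * area_weight \<epsilon> (E f) else 0)"
  proof (cases "X \<le> \<rho>")
    case True
    define d where "d = norm (u (E f) - t *\<^sub>R \<eta>)"
    define \<alpha> where "\<alpha> = 3 * C * N * \<epsilon> * (t * Z)"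
    have X1: "0 \<le> X" "X \<le> 1" using True \<rho> by (auto simp: X_def)
    then have tZ: "t * Z \<le> 1" unfolding Z(2) by (simp add: power_le_one)
    have d: "0 \<le> d" "d \<le> D + \<epsilon> * (t * Z)"
    proof -
      show "0 \<le> d" by (simp add: d_def)
      have P0: "frame_proj n \<tau> 0 = 0" by (simp add: frame_proj_def lincomb_def)
      have "norm ((u (E f) - (1/2) *\<^sub>R B (E f) (E f)) - (u 0 - (1/2) *\<^sub>R B 0 0)) \<le> \<epsilon> * max (norm (E f)) (norm (0::'a)) * norm (E f - 0)"
        by (rule rem[unfolded remainder_bound_def, rule_format])
           (use frame_proj_lincomb[OF ortho, of f] P0 True \<rho> in \<open>simp add: X_def\<close>)
      then have e: "norm (u (E f) - (1/2) *\<^sub>R B (E f) (E f)) \<le> \<epsilon> * X\<^sup>2"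
        using u0 by (simp add: zero_left X_def power2_eq_square mult.assoc)
      have split: "u (E f) - t *\<^sub>R \<eta> = ((1/2) *\<^sub>R B (E f) (E f) - t *\<^sub>R \<eta>) + (u (E f) - (1/2) *\<^sub>R B (E f) (E f))"
        by simp
      have "d \<le> norm ((1/2) *\<^sub>R B (E f) (E f) - t *\<^sub>R \<eta>) + norm (u (E f) - (1/2) *\<^sub>R B (E f) (E f))"
        unfolding d_def split by (rule norm_triangle_ineq)
      then show "d \<le> D + \<epsilon> * (t * Z)" using e unfolding D_def Z(2) by linarith
    qed
    have \<alpha>: "\<alpha> \<le> 1"
    proof -
      have "\<alpha> \<le> 3 * C * N * 1 * \<rho>\<^sup>2" unfolding \<alpha>_def Z(2)
        using C1 N \<epsilon> X1 True by (intro mult_mono power_mono) auto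
      also have "\<dots> \<le> 12 * C * (n + 1) * \<rho>\<^sup>2"
      proof -
        have "0 \<le> C * real n * \<rho>\<^sup>2" "0 \<le> C * \<rho>\<^sup>2" using C1 by auto
        then show ?thesis by (simp add: algebra_simps N_def)
      qed
      finally show ?thesis using \<rho> by linarith
    qed
    have area: "area_weight \<epsilon> (E f) = (1 - \<alpha>) * (1 + b)"
      unfolding area_weight_def \<alpha>_def b_def Z(2) unfolding X_def N_def by (rule refl)
    have "1 + b - D\<^sup>2 / (4 * t) - t * (c1 * \<epsilon> + c2 * t) * W \<le>
        1 + b - D\<^sup>2 / (4 * t) - t * (c1 * \<epsilon> + N * C ^ 4 * (2 + N\<^sup>2) * t) * (1 + Z ^ 3)"
    proof -
      have "N * C ^ 4 * (2 + N\<^sup>2) \<le> c2" using \<rho> by (simp add: c2_def N_def)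
      then have "t * (c1 * \<epsilon> + N * C ^ 4 * (2 + N\<^sup>2) * t) * (1 + Z ^ 3) \<le> t * (c1 * \<epsilon> + c2 * t) * W"
        using t c \<epsilon> ZW Z N by (intro mult_mono add_mono mult_right_mono order_refl add_nonneg_nonneg) auto
      then show ?thesis by simp
    qed
    also have "\<dots> \<le> exp (- (d\<^sup>2 / (4 * t))) * ((1 - \<alpha>) * (1 + b))"
      unfolding c1_def N_def[symmetric]
      by (rule weight_lower_bound[OF C1 N _ \<epsilon>(2) t Z(1) tZ b D d \<alpha>_def \<alpha>]) (use \<epsilon> in simp)
    finally have "G * (1 + b - D\<^sup>2 / (4 * t) - t * (c1 * \<epsilon> + c2 * t) * W) \<le> G * (exp (- (d\<^sup>2 / (4 * t))) * ((1 - \<alpha>) * (1 + b)))"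
      using G by (intro mult_left_mono)
    also have "\<dots> = 1 / (4 * pi * t) powr (real n / 2) * (exp (- (X\<^sup>2 / (4 * t))) * exp (- (d\<^sup>2 / (4 * t)))) * area_weight \<epsilon> (E f)"
      unfolding area G_def gauss_density_eq[OF ortho t] X_def by simp
    also have "exp (- (X\<^sup>2 / (4 * t))) * exp (- (d\<^sup>2 / (4 * t))) = exp (- ((X\<^sup>2 + d\<^sup>2) / (4 * t)))"
      by (simp add: exp_add[symmetric] add_divide_distrib)
    also have "X\<^sup>2 + d\<^sup>2 = (norm (p + E f + u (E f) - (p + t *\<^sub>R \<eta>)))\<^sup>2"
    proof -
      have "(u (E f) - t *\<^sub>R \<eta>) \<bullet> \<tau> i = 0" if "i < n" for i
        using u[OF frame_proj_lincomb[OF ortho] _ that, of f] True normal[OF that]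
        by (simp add: inner_diff_left \<eta>_def inner_sum_left X_def)
      then have "E f \<bullet> (u (E f) - t *\<^sub>R \<eta>) = 0" by (rule inner_lincomb_eq_0)
      then have "(norm (E f + (u (E f) - t *\<^sub>R \<eta>)))\<^sup>2 = X\<^sup>2 + d\<^sup>2" unfolding X_def d_def by (rule norm_add_orthogonal)
      moreover have "p + E f + u (E f) - (p + t *\<^sub>R \<eta>) = E f + (u (E f) - t *\<^sub>R \<eta>)" by simp
      ultimately show ?thesis by metis
    qed
    finally show ?thesis using True by simp
  next
    case False
    have X: "\<rho> < X" using False by simp
    \<comment> \<open>Origin of the last two summands of \<open>c2\<close>: outside the ball, 1 is
      at most \<open>(X / \<rho>) ^ 4\<close>, and \<open>b\<close>, at most a multiple of
      \<open>X\<^sup>2\<close>, gains a further factor \<open>(X / \<rho>)^2\<close>. Both are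
      multiples of \<open>(t * Z)\<^sup>2 = X ^ 4\<close>.\<close>
    have "1 + b \<le> t * (c2 * t) * (1 + Z ^ 3)"
    proof -
      have "1 \<le> X ^ 4 / \<rho> ^ 4" using X \<rho> by (simp add: power_mono)
      also have "X ^ 4 = (t * Z)\<^sup>2" unfolding Z(2) by simp
      also have "\<dots> = t * t * Z\<^sup>2" by (simp add: power2_eq_square)
      finally have 1: "1 \<le> t * t * Z\<^sup>2 / \<rho> ^ 4" .
      have "1 \<le> X\<^sup>2 / \<rho>\<^sup>2" using X \<rho> by (simp add: power_mono)
      then have "N * C\<^sup>2 * X\<^sup>2 * 1 \<le> N * C\<^sup>2 * X\<^sup>2 * (X\<^sup>2 / \<rho>\<^sup>2)" using N by (intro mult_left_mono) auto
      also have "\<dots> = N * C\<^sup>2 / \<rho>\<^sup>2 * (t * t * Z\<^sup>2)" unfolding Z(2)[symmetric] by (simp add: power2_eq_square mult_ac)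
      finally have "b \<le> N * C\<^sup>2 / \<rho>\<^sup>2 * (t * t * Z\<^sup>2)" using b Z(2) by simp
      with 1 have "1 + b \<le> (1 / \<rho> ^ 4 + N * C\<^sup>2 / \<rho>\<^sup>2) * (t * t * Z\<^sup>2)" by (simp add: algebra_simps)
      also have "\<dots> \<le> c2 * (t * t * (1 + Z ^ 3))"
      proof (intro mult_mono)
        show "1 / \<rho> ^ 4 + N * C\<^sup>2 / \<rho>\<^sup>2 \<le> c2" using N C1 by (simp add: c2_def N_def)
      qed (use t c cube_bounds[OF Z(1)] in auto)
      finally show ?thesis by (simp add: mult_ac)
    qed
    also have "\<dots> \<le> t * (c1 * \<epsilon> + c2 * t) * W"
      using t c \<epsilon> ZW Z by (intro mult_mono) auto
    finally have "1 + b \<le> t * (c1 * \<epsilon> + c2 * t) * W" .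
    moreover have "0 \<le> D\<^sup>2 / (4 * t)" using t by simp
    ultimately have "1 + b - D\<^sup>2 / (4 * t) - t * (c1 * \<epsilon> + c2 * t) * W \<le> 0" by linarith
    then show ?thesis using False G by (simp add: mult_nonneg_nonpos)
  qed
  then show ?thesis unfolding G_def b_def D_def W_def X_def N_def .
qed

text \<open>Comparing \<open>gaussian_area_ge\<close> with the expectation gives
  \<open>sff_sq / 2 \<le> (c1 + 1) * c3 * \<epsilon>\<close>. What matters is that \<open>c1\<close>
  and \<open>c3\<close> do not depend on \<rho>, so \<epsilon> may tend to 0; all dependence on
  \<rho> sits in \<open>c2\<close>.\<close>

theorem second_order_vanishes:
  assumes ent: "entropy n \<Sigma> = 1"
    and \<rho>0: "0 < \<rho>0"
    and u: "\<And>x i. frame_proj n \<tau> x = x \<Longrightarrow> norm x \<le> \<rho>0 \<Longrightarrow> i < n \<Longrightarrow> u x \<bullet> \<tau> i = 0" and u0: "u 0 = 0"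
    and graph: "\<And>x. frame_proj n \<tau> x = x \<Longrightarrow> norm x \<le> \<rho>0 \<Longrightarrow> p + x + u x \<in> \<Sigma>"
    and rem: "\<And>\<epsilon>. 0 < \<epsilon> \<Longrightarrow> \<exists>\<rho>>0. remainder_bound u \<epsilon> \<rho>"
    and ij: "i < n" "j < n"
  shows "B (\<tau> i) (\<tau> j) = 0"
proof -
  define c1 where "c1 = 2 * C * (real n + 1) + 3 * C * real n * (1 + real n * C\<^sup>2)"
  define c3 where "c3 = 1 + 360 * real n ^ 3"
  have c: "0 \<le> c1" "1 \<le> c3" using C1 by (auto simp: c1_def c3_def)
  have key: "sff_sq / 2 \<le> (c1 + 1) * c3 * \<epsilon>" if \<epsilon>: "0 < \<epsilon>" "\<epsilon> \<le> 1" for \<epsilon>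
  proof -
    obtain \<rho>1 where \<rho>1: "\<rho>1 > 0" "remainder_bound u \<epsilon> \<rho>1" using rem[OF \<epsilon>(1)] by blast
    define k1 k2 where "k1 = real n ^ 3 * C ^ 4 + 1" and "k2 = 12 * C * (real n + 1)"
    have k: "0 < k1" "0 < k2" using C1 by (auto simp: k1_def k2_def add_nonneg_pos)
    define \<rho> where "\<rho> = min (min \<rho>0 \<rho>1) (min 1 (min (sqrt (\<epsilon> / k1)) (sqrt (1 / k2))))"
    have \<rho>: "0 < \<rho>" "\<rho> \<le> 1" "\<rho> \<le> \<rho>0" "\<rho> \<le> \<rho>1" "\<rho> \<le> sqrt (\<epsilon> / k1)" "\<rho> \<le> sqrt (1 / k2)"
      using \<rho>0 \<rho>1 \<epsilon> k by (auto simp: \<rho>_def)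
    have "\<rho>\<^sup>2 \<le> (sqrt (\<epsilon> / k1))\<^sup>2" "\<rho>\<^sup>2 \<le> (sqrt (1 / k2))\<^sup>2" using \<rho> by (intro power_mono; simp)+
    then have "\<rho>\<^sup>2 \<le> \<epsilon> / k1" "\<rho>\<^sup>2 \<le> 1 / k2" using \<epsilon> k by simp_all
    then have kr: "k1 * \<rho>\<^sup>2 \<le> \<epsilon>" "k2 * \<rho>\<^sup>2 \<le> 1" using k by (simp_all add: field_simps)
    have r3: "real n ^ 3 * C ^ 4 * \<rho>\<^sup>2 \<le> \<epsilon>"
    proof -
      have "real n ^ 3 * C ^ 4 * \<rho>\<^sup>2 \<le> k1 * \<rho>\<^sup>2" by (intro mult_right_mono) (auto simp: k1_def)
      then show ?thesis using kr by linarith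
    qed
    have r4: "12 * C * (n + 1) * \<rho>\<^sup>2 \<le> 1" using kr(2) by (simp add: k2_def add.commute)
    have rb: "remainder_bound u \<epsilon> \<rho>" by (rule remainder_bound_mono[OF \<rho>1(2) \<rho>(4)])
    have u': "u x \<bullet> \<tau> i = 0" if "frame_proj n \<tau> x = x" "norm x \<le> \<rho>" "i < n" for x i
      using u that \<rho> by auto
    have graph': "p + x + u x \<in> \<Sigma>" if "frame_proj n \<tau> x = x" "norm x \<le> \<rho>" for x
      using graph that \<rho> by auto
    define c2 where "c2 = real n * C ^ 4 * (2 + (real n)\<^sup>2) + 1 / \<rho> ^ 4 + real n * C\<^sup>2 / \<rho>\<^sup>2"
    have c2: "0 \<le> c2" using C1 \<rho> by (simp add: c2_def)
    \<comment> \<open>Chosen after \<rho>: \<open>c2\<close> may be huge, but \<open>c2 * t\<close>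
      stays below \<epsilon>.\<close>
    define t where "t = \<epsilon> / (c2 + 1)"
    have t: "0 < t" "c2 * t \<le> \<epsilon>" using \<epsilon> c2 by (auto simp: t_def field_simps)
    define \<kappa> where "\<kappa> = t * (c1 * \<epsilon> + c2 * t)"
    define \<eta> where "\<eta> = (\<Sum>i<n. B (\<tau> i) (\<tau> i))"
    define P where "P f = gauss_density n (sqrt (2 * t)) f *
      (1 + (\<Sum>i<n. (norm (B (E f) (\<tau> i)))\<^sup>2) / 2 - (norm ((1/2) *\<^sub>R B (E f) (E f) - t *\<^sub>R \<eta>))\<^sup>2 / (4 * t)
        - \<kappa> * (1 + 3 * (real n)\<^sup>2 * (\<Sum>i<n. f i ^ 6) / t ^ 3))" for f
    define F where "F f = (if norm (E f) \<le> \<rho> then 1 / (4 * pi * t) powr (real n / 2) *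
       exp (- ((norm (p + E f + u (E f) - (p + t *\<^sub>R \<eta>)))\<^sup>2 / (4 * t))) * area_weight \<epsilon> (E f) else 0)" for f
    have int: "has_bochner_integral M P (1 + t * sff_sq / 2 - \<kappa> * c3)"
      unfolding P_def[abs_def] \<eta>_def c3_def by (rule expected_weight[OF t(1)])
    have PF: "P f \<le> F f" for f
      unfolding P_def F_def \<eta>_def \<kappa>_def c1_def c2_def
      by (rule weight_pointwise[OF u' u0 rb \<epsilon> \<rho>(1,2) r4 t(1)])
    have F0: "ennreal (F f) = ennreal (max 0 (F f))" for f by (simp add: max_def ennreal_neg)
    have "ennreal (1 + t * sff_sq / 2 - \<kappa> * c3) \<le> (\<integral>\<^sup>+f. ennreal (max 0 (F f)) \<partial>M)"
      using ennreal_integral_le_nn_integral[of M P "\<lambda>f. max 0 (F f)"] int PF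
      by (simp add: has_bochner_integral_iff le_max_iff_disj)
    also have "\<dots> = (\<integral>\<^sup>+f. ennreal (F f) \<partial>M)" by (simp only: F0)
    also have "\<dots> \<le> 1" unfolding F_def
      by (rule gaussian_area_ge[OF ent u' graph' rb \<epsilon> \<rho>(1,2) r3 r4 t(1)])
    finally have "1 + t * sff_sq / 2 - \<kappa> * c3 \<le> 1" by simp
    then have "t * (sff_sq / 2) \<le> t * ((c1 * \<epsilon> + c2 * t) * c3)" by (simp add: \<kappa>_def mult_ac)
    then have "sff_sq / 2 \<le> (c1 * \<epsilon> + c2 * t) * c3" using t(1) by simp
    also have "\<dots> \<le> (c1 * \<epsilon> + \<epsilon>) * c3" using t(2) c by (intro mult_right_mono add_left_mono) auto
    finally show ?thesis by (simp add: algebra_simps)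
  qed
  have "sff_sq \<le> 0"
  proof (rule ccontr)
    assume "\<not> sff_sq \<le> 0"
    then have S: "0 < sff_sq" by simp
    define k where "k = (c1 + 1) * c3"
    have k: "0 < k" using c by (auto simp: k_def intro!: mult_pos_pos)
    define \<epsilon> where "\<epsilon> = min 1 (sff_sq / (4 * k))"
    have "0 < \<epsilon>" "\<epsilon> \<le> 1" using S k by (auto simp: \<epsilon>_def)
    from key[OF this] have "sff_sq / 2 \<le> k * \<epsilon>" by (simp add: k_def)
    also have "\<dots> \<le> k * (sff_sq / (4 * k))" using k by (intro mult_left_mono) (auto simp: \<epsilon>_def)
    also have "\<dots> = sff_sq / 4" using k by simp
    finally show False using S by simp
  qed
  moreover have "(norm (B (\<tau> i) (\<tau> j)))\<^sup>2 \<le> sff_sq"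
  proof -
    have "(norm (B (\<tau> i) (\<tau> j)))\<^sup>2 \<le> (\<Sum>j<n. (norm (B (\<tau> i) (\<tau> j)))\<^sup>2)"
      using ij by (intro member_le_sum) auto
    also have "\<dots> \<le> sff_sq" unfolding sff_sq_def using ij by (intro member_le_sum) (auto intro: sum_nonneg)
    finally show ?thesis .
  qed
  ultimately have "(norm (B (\<tau> i) (\<tau> j)))\<^sup>2 \<le> 0" by linarith
  then show ?thesis by simp
qed

end

subsection \<open>Local graph representation\<close>

text \<open>The mean value theorem is applied in the direction \<open>v\<close> to the difference of
  \<open>G\<close> along two parallel segments; the derivative of \<open>G' x v\<close> at
  \<open>x0\<close> then evaluates the result. Second-order differentiability is thus used only at
  \<open>x0\<close>.\<close>

lemma second_difference_approx:
  fixes G :: "'a::real_normed_vector \<Rightarrow> real"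
  assumes "0 < r" and G: "\<And>x. dist x0 x < r \<Longrightarrow> (G has_derivative G' x) (at x)"
    and H: "((\<lambda>x. G' x v) has_derivative H) (at x0)" and "0 < e"
  shows "\<exists>d>0. \<forall>s. 0 < s \<and> s < d \<longrightarrow>
    \<bar>(G (x0 + s *\<^sub>R u + s *\<^sub>R v) - G (x0 + s *\<^sub>R u)) - (G (x0 + s *\<^sub>R v) - G x0) - s\<^sup>2 * H u\<bar> \<le> e * s\<^sup>2"
proof -
  \<comment> \<open>The derivative is evaluated at \<open>s *\<^sub>R u + x *\<^sub>R v\<close> and
    at \<open>x *\<^sub>R v\<close>; their sizes add up to at most
    \<open>s * (norm u + 2 * norm v)\<close>, and the 1 keeps \<open>c\<close> positive.\<close>
  define c where "c = norm u + norm v + norm v + 1"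
  have c: "0 < c" by (simp add: c_def add_nonneg_pos)
  have lin: "bounded_linear H" using H by (rule has_derivative_bounded_linear)
  then interpret H: bounded_linear H .
  obtain d1 where d1: "d1 > 0" "\<And>y. norm (y - x0) < d1 \<Longrightarrow> \<bar>G' y v - G' x0 v - H (y - x0)\<bar> \<le> e / c * norm (y - x0)"
  proof -
    have "0 < e / c" using \<open>0 < e\<close> c by simp
    then have "\<exists>d>0. \<forall>y. norm (y - x0) < d \<longrightarrow> norm (G' y v - G' x0 v - H (y - x0)) \<le> e / c * norm (y - x0)"
      using H unfolding has_derivative_at_alt by blast
    then show thesis using that by auto
  qed
  define d where "d = min d1 r / c"
  have "d > 0" using d1 \<open>0 < r\<close> c by (simp add: d_def)
  moreover have "\<bar>(G (x0 + s *\<^sub>R u + s *\<^sub>R v) - G (x0 + s *\<^sub>R u)) - (G (x0 + s *\<^sub>R v) - G x0) - s\<^sup>2 * H u\<bar> \<le> e * s\<^sup>2"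
    if s: "0 < s" "s < d" for s
  proof -
    have sc: "s * c < d1" "s * c < r" using s c by (auto simp: d_def pos_less_divide_eq)
    have small1: "norm (s *\<^sub>R u + x *\<^sub>R v) \<le> s * (norm u + norm v)" "norm (x *\<^sub>R v) \<le> s * norm v" if "0 \<le> x" "x \<le> s" for x
    proof -
      show 2: "norm (x *\<^sub>R v) \<le> s * norm v" using that by (simp add: mult_right_mono)
      have "norm (s *\<^sub>R u + x *\<^sub>R v) \<le> norm (s *\<^sub>R u) + norm (x *\<^sub>R v)" by (rule norm_triangle_ineq)
      then show "norm (s *\<^sub>R u + x *\<^sub>R v) \<le> s * (norm u + norm v)" using 2 s by (simp add: distrib_left)
    qed
    have "s * (norm u + norm v) \<le> s * c" "s * norm v \<le> s * c" using s by (auto simp: c_def intro!: mult_left_mono)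
    then have small: "norm (s *\<^sub>R u + x *\<^sub>R v) \<le> s * c" "norm (x *\<^sub>R v) \<le> s * c" if "0 \<le> x" "x \<le> s" for x
      using small1[OF that] by linarith+
    define \<phi> where "\<phi> x = G (x0 + s *\<^sub>R u + x *\<^sub>R v) - G (x0 + x *\<^sub>R v)" for x
    have der: "DERIV \<phi> x :> G' (x0 + s *\<^sub>R u + x *\<^sub>R v) v - G' (x0 + x *\<^sub>R v) v" if x: "0 \<le> x" "x \<le> s" for x
    proof -
      have in1: "dist x0 (x0 + s *\<^sub>R u + x *\<^sub>R v) < r"
      proof -
        have "dist x0 (x0 + s *\<^sub>R u + x *\<^sub>R v) = norm (s *\<^sub>R u + x *\<^sub>R v)"
          by (subst dist_commute) (simp add: dist_norm add.assoc)
        then show ?thesis using small(1)[OF x] sc by simp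
      qed
      have in2: "dist x0 (x0 + x *\<^sub>R v) < r" using small(2)[OF x] sc by (simp add: dist_norm)
      have l: "((\<lambda>x. a + x *\<^sub>R v) has_derivative (\<lambda>h. h *\<^sub>R v)) (at x)" for a
        by (auto intro!: derivative_eq_intros)
      have "((\<lambda>x. G (a + x *\<^sub>R v)) has_derivative (\<lambda>h. h * G' (a + x *\<^sub>R v) v)) (at x)" if "dist x0 (a + x *\<^sub>R v) < r" for a
      proof -
        have "((\<lambda>x. G (a + x *\<^sub>R v)) has_derivative (\<lambda>h. G' (a + x *\<^sub>R v) (h *\<^sub>R v))) (at x)"
          by (rule has_derivative_compose[OF l G[OF that]])
        moreover have "G' (a + x *\<^sub>R v) (h *\<^sub>R v) = h * G' (a + x *\<^sub>R v) v" for h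
          using has_derivative_bounded_linear[OF G[OF that]] by (simp add: linear_simps)
        ultimately show ?thesis by simp
      qed
      note d12 = has_derivative_diff[OF this[OF in1] this[OF in2]]
      have eq: "(\<lambda>h. h * a - h * b) = (*) (a - b)" for a b :: real by (auto simp: fun_eq_iff algebra_simps)
      show ?thesis using d12 unfolding \<phi>_def has_field_derivative_def eq .
    qed
    obtain x where x: "0 < x" "x < s" and mvt: "\<phi> s - \<phi> 0 = (s - 0) * (G' (x0 + s *\<^sub>R u + x *\<^sub>R v) v - G' (x0 + x *\<^sub>R v) v)"
      using MVT2[OF s(1) der] by blast
    have "\<bar>G' (x0 + (s *\<^sub>R u + x *\<^sub>R v)) v - G' x0 v - H (s *\<^sub>R u + x *\<^sub>R v)\<bar> \<le> e / c * norm (s *\<^sub>R u + x *\<^sub>R v)"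
      using d1(2)[of "x0 + (s *\<^sub>R u + x *\<^sub>R v)"] small(1)[of x] x sc by simp
    also have "\<dots> \<le> e / c * (s * (norm u + norm v))" using small1(1)[of x] x \<open>0 < e\<close> c by (intro mult_left_mono) auto
    finally have 1: "\<bar>G' (x0 + s *\<^sub>R u + x *\<^sub>R v) v - G' x0 v - (s * H u + x * H v)\<bar> \<le> e / c * (s * (norm u + norm v))"
      by (simp add: H.add H.scaleR add.assoc)
    have "\<bar>G' (x0 + x *\<^sub>R v) v - G' x0 v - H (x *\<^sub>R v)\<bar> \<le> e / c * norm (x *\<^sub>R v)"
      using d1(2)[of "x0 + x *\<^sub>R v"] small(2)[of x] x sc by simp
    also have "\<dots> \<le> e / c * (s * norm v)" using small1(2)[of x] x \<open>0 < e\<close> c by (intro mult_left_mono) auto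
    finally have 2: "\<bar>G' (x0 + x *\<^sub>R v) v - G' x0 v - x * H v\<bar> \<le> e / c * (s * norm v)" by (simp add: H.scaleR)
    have "\<bar>G' (x0 + s *\<^sub>R u + x *\<^sub>R v) v - G' (x0 + x *\<^sub>R v) v - s * H u\<bar> \<le> e / c * (s * (norm u + norm v)) + e / c * (s * norm v)"
      using 1 2 by linarith
    also have "\<dots> = e / c * s * (norm u + norm v + norm v)" by (simp add: algebra_simps)
    also have "\<dots> \<le> e / c * s * c" using \<open>0 < e\<close> c s by (intro mult_left_mono) (auto simp: c_def)
    also have "\<dots> = e * s" using c by simp
    finally have 3: "\<bar>G' (x0 + s *\<^sub>R u + x *\<^sub>R v) v - G' (x0 + x *\<^sub>R v) v - s * H u\<bar> \<le> e * s" .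
    have "(G (x0 + s *\<^sub>R u + s *\<^sub>R v) - G (x0 + s *\<^sub>R u)) - (G (x0 + s *\<^sub>R v) - G x0) - s\<^sup>2 * H u = \<phi> s - \<phi> 0 - s\<^sup>2 * H u"
      by (simp add: \<phi>_def)
    also have "\<dots> = s * (G' (x0 + s *\<^sub>R u + x *\<^sub>R v) v - G' (x0 + x *\<^sub>R v) v - s * H u)"
      unfolding mvt by (simp add: algebra_simps power2_eq_square)
    also have "\<bar>\<dots>\<bar> \<le> s * (e * s)" unfolding abs_mult using 3 s by (intro mult_mono) auto
    finally show ?thesis by (simp add: power2_eq_square mult_ac)
  qed
  ultimately show ?thesis by blast
qed

text \<open>The second difference is symmetric in \<open>u\<close> and \<open>v\<close>, and
  \<open>s\<^sup>2 * Hv u\<close> and \<open>s\<^sup>2 * Hu v\<close> both approximate it to order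
  \<open>s\<^sup>2\<close>.\<close>

lemma second_derivative_symmetric_real:
  fixes G :: "'a::real_normed_vector \<Rightarrow> real"
  assumes "0 < r" and G: "\<And>x. dist x0 x < r \<Longrightarrow> (G has_derivative G' x) (at x)"
    and Hv: "((\<lambda>x. G' x v) has_derivative Hv) (at x0)" and Hu: "((\<lambda>x. G' x u) has_derivative Hu) (at x0)"
  shows "Hv u = Hu v"
proof -
  have "\<bar>Hv u - Hu v\<bar> \<le> e" if "0 < e" for e
  proof -
    have e2: "0 < e / 2" using that by simp
    obtain d1 where d1: "d1 > 0" "\<And>s. 0 < s \<Longrightarrow> s < d1 \<Longrightarrow>
       \<bar>(G (x0 + s *\<^sub>R u + s *\<^sub>R v) - G (x0 + s *\<^sub>R u)) - (G (x0 + s *\<^sub>R v) - G x0) - s\<^sup>2 * Hv u\<bar> \<le> e / 2 * s\<^sup>2"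
      using second_difference_approx[OF assms(1) G Hv e2, of u] by blast
    obtain d2 where d2: "d2 > 0" "\<And>s. 0 < s \<Longrightarrow> s < d2 \<Longrightarrow>
       \<bar>(G (x0 + s *\<^sub>R v + s *\<^sub>R u) - G (x0 + s *\<^sub>R v)) - (G (x0 + s *\<^sub>R u) - G x0) - s\<^sup>2 * Hu v\<bar> \<le> e / 2 * s\<^sup>2"
      using second_difference_approx[OF assms(1) G Hu e2, of v] by blast
    define s where "s = min d1 d2 / 2"
    have s: "0 < s" "s < d1" "s < d2" using d1 d2 by (auto simp: s_def)
    have comm: "x0 + s *\<^sub>R v + s *\<^sub>R u = x0 + s *\<^sub>R u + s *\<^sub>R v" by simp
    have "\<bar>s\<^sup>2 * Hv u - s\<^sup>2 * Hu v\<bar> \<le> e * s\<^sup>2"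
      using d1(2)[OF s(1,2)] d2(2)[OF s(1,3)] unfolding comm by linarith
    then have "s\<^sup>2 * \<bar>Hv u - Hu v\<bar> \<le> s\<^sup>2 * e"
      by (simp only: right_diff_distrib[symmetric] abs_mult abs_power2 mult.commute[of e])
    then show ?thesis using s by simp
  qed
  then have "\<bar>Hv u - Hu v\<bar> \<le> 0" by (rule field_le_epsilon) simp
  then show ?thesis by simp
qed

lemma second_derivative_symmetric:
  fixes G :: "'a::real_normed_vector \<Rightarrow> 'b::euclidean_space"
  assumes "0 < r" and G: "\<And>x. dist x0 x < r \<Longrightarrow> (G has_derivative G' x) (at x)"
    and Hv: "((\<lambda>x. G' x v) has_derivative Hv) (at x0)" and Hu: "((\<lambda>x. G' x u) has_derivative Hu) (at x0)"
  shows "Hv u = Hu v"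
proof (rule euclidean_eqI)
  fix b :: 'b
  show "Hv u \<bullet> b = Hu v \<bullet> b"
    by (rule second_derivative_symmetric_real[of r x0 "\<lambda>x. G x \<bullet> b" "\<lambda>x h. G' x h \<bullet> b" v "\<lambda>h. Hv h \<bullet> b" u "\<lambda>h. Hu h \<bullet> b"])
       (intro assms has_derivative_inner_left | assumption)+
qed

text \<open>The derivative of the remainder at \<open>x\<close> is \<open>G' x - id - B x\<close>,
  of operator norm at most \<open>\<epsilon> * norm x\<close> near 0. The mean value inequality on
  the ball of radius \<open>max (norm x) (norm y)\<close> gives the increment bound.\<close>

lemma second_order_remainder:
  fixes G :: "'a::euclidean_space \<Rightarrow> 'a"
  assumes "0 < r" and G: "\<And>x. norm x < r \<Longrightarrow> (G has_derivative G' x) (at x)"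
    and G'0: "\<And>v. G' 0 v = v" and G'': "\<And>v. ((\<lambda>x. G' x v) has_derivative (\<lambda>h. B h v)) (at 0)"
    and B: "bounded_bilinear B" and sym: "\<And>x y. B x y = B y x" and "0 < \<epsilon>"
  shows "\<exists>\<rho>>0. \<forall>x y. norm x \<le> \<rho> \<and> norm y \<le> \<rho> \<longrightarrow>
    norm ((G x - x - (1/2) *\<^sub>R B x x) - (G y - y - (1/2) *\<^sub>R B y y)) \<le> \<epsilon> * max (norm x) (norm y) * norm (x - y)"
proof -
  interpret B: bounded_bilinear B by (rule B)
  \<comment> \<open>Differentiability of \<open>G'\<close> is known for each fixed vector only;
    summing over the basis recovers an operator norm and costs the factor
    \<open>DIM('a)\<close>.\<close>
  define e where "e = \<epsilon> / DIM('a)"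
  have e: "0 < e" using \<open>0 < \<epsilon>\<close> by (simp add: e_def)
  have "\<exists>d>0. \<forall>y. norm y < d \<longrightarrow> norm (G' y b - b - B y b) \<le> e * norm y" for b
  proof -
    have "\<exists>d>0. \<forall>y. norm (y - 0) < d \<longrightarrow> norm (G' y b - G' 0 b - B (y - 0) b) \<le> e * norm (y - 0)"
      using G''[of b] e unfolding has_derivative_at_alt by blast
    then show ?thesis by (simp add: G'0)
  qed
  then obtain d where d: "\<And>b. 0 < d b" "\<And>b y. norm y < d b \<Longrightarrow> norm (G' y b - b - B y b) \<le> e * norm y"
    by metis
  define \<rho> where "\<rho> = min r (Min (d ` Basis)) / 2"
  have Mpos: "0 < Min (d ` Basis)" using d by (subst Min_gr_iff) auto
  have \<rho>: "0 < \<rho>" "\<rho> < r" "\<And>b. b \<in> Basis \<Longrightarrow> \<rho> < d b"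
  proof -
    show "0 < \<rho>" "\<rho> < r" using Mpos \<open>0 < r\<close> by (auto simp: \<rho>_def)
    show "\<rho> < d b" if "b \<in> Basis" for b
    proof -
      have "Min (d ` Basis) \<le> d b" using that by simp
      then show ?thesis using Mpos unfolding \<rho>_def by linarith
    qed
  qed
  define R where "R x = G x - x - (1/2) *\<^sub>R B x x" for x
  have derR: "(R has_derivative (\<lambda>v. G' x v - v - B x v)) (at x)" if "norm x < r" for x
  proof -
    have "((\<lambda>x. B x x) has_derivative (\<lambda>h. B x h + B h x)) (at x)"
      by (rule B.FDERIV[OF has_derivative_ident has_derivative_ident])
    then have "((\<lambda>x. (1/2) *\<^sub>R B x x) has_derivative (\<lambda>h. (1/2) *\<^sub>R (B x h + B h x))) (at x)"
      by (rule has_derivative_scaleR_right)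
    then have "((\<lambda>x. (1/2) *\<^sub>R B x x) has_derivative (\<lambda>h. B x h)) (at x)"
      by (simp only: sym[of _ x] scaleR_half_double)
    then show ?thesis unfolding R_def[abs_def]
      by (intro has_derivative_diff G[OF that] has_derivative_ident)
  qed
  have onR: "onorm (\<lambda>v. G' x v - v - B x v) \<le> \<epsilon> * norm x" if x: "norm x \<le> \<rho>" for x
  proof (rule onorm_le)
    fix v :: 'a
    have "norm x < r" using x \<rho> by simp
    from has_derivative_bounded_linear[OF derR[OF this]]
    interpret L: bounded_linear "\<lambda>v. G' x v - v - B x v" .
    have "G' x v - v - B x v = (\<lambda>v. G' x v - v - B x v) (\<Sum>b\<in>Basis. (v \<bullet> b) *\<^sub>R b)"
      by (simp add: euclidean_representation)
    also have "\<dots> = (\<Sum>b\<in>Basis. (v \<bullet> b) *\<^sub>R (G' x b - b - B x b))" by (simp only: L.sum L.scaleR)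
    also have "norm \<dots> \<le> (\<Sum>b\<in>(Basis::'a set). norm v * (e * norm x))"
    proof (rule sum_norm_le)
      fix b :: 'a assume b: "b \<in> Basis"
      have "norm x < d b" using x \<rho>(3)[OF b] by simp
      then show "norm ((v \<bullet> b) *\<^sub>R (G' x b - b - B x b)) \<le> norm v * (e * norm x)"
        using d(2)[of x b] Basis_le_norm[OF b, of v] by (simp add: mult_mono)
    qed
    also have "\<dots> = \<epsilon> * norm x * norm v" by (simp add: e_def)
    finally show "norm (G' x v - v - B x v) \<le> \<epsilon> * norm x * norm v" .
  qed
  have "norm (R x - R y) \<le> \<epsilon> * max (norm x) (norm y) * norm (x - y)" if xy: "norm x \<le> \<rho>" "norm y \<le> \<rho>" for x y
  proof (rule differentiable_bound[where S = "cball 0 (max (norm x) (norm y))"])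
    fix z :: 'a assume z: "z \<in> cball 0 (max (norm x) (norm y))"
    then have nz: "norm z \<le> max (norm x) (norm y)" by simp
    then have "norm z \<le> \<rho>" using xy by linarith
    then show "(R has_derivative (\<lambda>v. G' z v - v - B z v)) (at z within cball 0 (max (norm x) (norm y)))"
      using \<rho>(2) by (intro has_derivative_at_withinI[OF derR]) linarith
    have "onorm (\<lambda>v. G' z v - v - B z v) \<le> \<epsilon> * norm z" by (rule onR) fact
    also have "\<dots> \<le> \<epsilon> * max (norm x) (norm y)" using nz \<open>0 < \<epsilon>\<close> by simp
    finally show "onorm (\<lambda>v. G' z v - v - B z v) \<le> \<epsilon> * max (norm x) (norm y)" .
  qed auto
  then show ?thesis using \<rho>(1) unfolding R_def by blast
qed

lemma norm_frame_proj_decomp: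
  assumes "orthonormal n \<tau>"
  shows "(norm x)\<^sup>2 = (norm (frame_proj n \<tau> x))\<^sup>2 + (norm (x - frame_proj n \<tau> x))\<^sup>2"
    and "i < n \<Longrightarrow> (x - frame_proj n \<tau> x) \<bullet> \<tau> i = 0"
proof -
  show orth: "(x - frame_proj n \<tau> x) \<bullet> \<tau> i = 0" if "i < n" for i
    using inner_lincomb[OF assms that] by (simp add: inner_diff_left frame_proj_def)
  have "(norm (frame_proj n \<tau> x + (x - frame_proj n \<tau> x)))\<^sup>2 = (norm (frame_proj n \<tau> x))\<^sup>2 + (norm (x - frame_proj n \<tau> x))\<^sup>2"
    unfolding frame_proj_def[of n \<tau> x]
    by (intro norm_add_orthogonal inner_lincomb_eq_0) (rule orth[unfolded frame_proj_def])
  then show "(norm x)\<^sup>2 = (norm (frame_proj n \<tau> x))\<^sup>2 + (norm (x - frame_proj n \<tau> x))\<^sup>2" by simp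
qed

lemma norm_frame_proj_le:
  assumes "orthonormal n \<tau>"
  shows "norm (frame_proj n \<tau> x) \<le> norm x" "norm (x - frame_proj n \<tau> x) \<le> norm x"
  by (rule power2_le_imp_le; simp add: norm_frame_proj_decomp(1)[OF assms, of x])+

text \<open>The graph over the tangent plane is found by inverting the tangential part of \<open>G\<close>, a small
  Lipschitz perturbation of the identity.\<close>

lemma graph_of_map:
  fixes G :: "'a::euclidean_space \<Rightarrow> 'a"
  assumes ortho: "orthonormal n \<tau>" and G0: "G 0 = 0"
    and B: "bounded_bilinear B" and sym: "\<And>x y. B x y = B y x"
    and rem: "\<And>\<epsilon>. 0 < \<epsilon> \<Longrightarrow> \<exists>\<rho>>0. \<forall>x y. norm x \<le> \<rho> \<and> norm y \<le> \<rho> \<longrightarrow>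
      norm ((G x - x - (1/2) *\<^sub>R B x x) - (G y - y - (1/2) *\<^sub>R B y y)) \<le> \<epsilon> * max (norm x) (norm y) * norm (x - y)"
  defines "P \<equiv> frame_proj n \<tau>"
  obtains u \<rho>0 where "0 < \<rho>0" "u 0 = 0"
    "\<And>x i. P x = x \<Longrightarrow> norm x \<le> \<rho>0 \<Longrightarrow> i < n \<Longrightarrow> u x \<bullet> \<tau> i = 0"
    "\<And>x. P x = x \<Longrightarrow> norm x \<le> \<rho>0 \<Longrightarrow> \<exists>y. P y = y \<and> norm y \<le> 2 * norm x \<and> G y = x + u x"
    "\<And>\<epsilon>. 0 < \<epsilon> \<Longrightarrow> \<exists>\<rho>>0. \<forall>x y. P x = x \<and> P y = y \<and> norm x \<le> \<rho> \<and> norm y \<le> \<rho> \<longrightarrow>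
      norm ((u x - (1/2) *\<^sub>R (B x x - P (B x x))) - (u y - (1/2) *\<^sub>R (B y y - P (B y y)))) \<le> \<epsilon> * max (norm x) (norm y) * norm (x - y)"
proof -
  interpret B: bounded_bilinear B by (rule B)
  interpret P: bounded_linear P unfolding P_def by (rule bounded_linear_frame_proj)
  have PP: "P (P x) = P x" for x unfolding P_def frame_proj_def[of n \<tau> x] using frame_proj_lincomb[OF ortho] .
  note P_le = norm_frame_proj_le[OF ortho, folded P_def]
  obtain K where K: "1 \<le> K" "\<And>x y. norm (B x y) \<le> K * norm x * norm y"
  proof -
    obtain K where bK: "\<And>x y. norm (B x y) \<le> norm x * norm y * K" using B.bounded by blast
    have "norm (B x y) \<le> max 1 K * norm x * norm y" for x y
    proof -
      have "norm x * norm y * K \<le> norm x * norm y * max 1 K" by (intro mult_left_mono) auto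
      then show ?thesis using bK[of x y] by (simp only: mult_ac)
    qed
    then show thesis by (intro that[of "max 1 K"]) auto
  qed
  define R where "R x = G x - x - (1/2) *\<^sub>R B x x" for x
  have R0: "R 0 = 0" by (simp add: R_def G0 B.zero_left)
  \<comment> \<open>For \<open>y\<close> in the plane \<open>P (G y) = y + k y\<close>, so finding
    the point over \<open>x\<close> means solving \<open>x = y + k y\<close>.\<close>
  define k where "k y = P ((1/2) *\<^sub>R B y y + R y)" for y
  obtain \<rho>1 where \<rho>1: "0 < \<rho>1" "\<And>x y. norm x \<le> \<rho>1 \<Longrightarrow> norm y \<le> \<rho>1 \<Longrightarrow>
      norm (R x - R y) \<le> 1 * max (norm x) (norm y) * norm (x - y)"
    using rem[of 1] unfolding R_def by auto
  have Bdiff: "B x x - B y y = B (x + y) (x - y)" for x y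
    by (simp add: B.add_left B.diff_right sym[of y x])
  have k_lip: "norm (k x - k y) \<le> (K + 1) * max (norm x) (norm y) * norm (x - y)" if "norm x \<le> \<rho>1" "norm y \<le> \<rho>1" for x y
  proof -
    define m where "m = max (norm x) (norm y)"
    have "k x - k y = P ((1/2) *\<^sub>R B (x + y) (x - y) + (R x - R y))"
      unfolding k_def P.diff[symmetric] Bdiff[symmetric] by (simp add: scaleR_right_diff_distrib algebra_simps)
    then have "norm (k x - k y) \<le> norm ((1/2) *\<^sub>R B (x + y) (x - y) + (R x - R y))" using P_le(1) by simp
    also have "\<dots> \<le> norm ((1/2) *\<^sub>R B (x + y) (x - y)) + norm (R x - R y)" by (rule norm_triangle_ineq)
    also have "\<dots> \<le> K * m * norm (x - y) + m * norm (x - y)"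
    proof (intro add_mono)
      have "norm (x + y) \<le> 2 * m" using norm_triangle_ineq[of x y] by (simp add: m_def)
      then have "K * norm (x + y) * norm (x - y) \<le> K * (2 * m) * norm (x - y)" using K by (intro mult_right_mono mult_left_mono) auto
      then show "norm ((1/2) *\<^sub>R B (x + y) (x - y)) \<le> K * m * norm (x - y)" using K(2)[of "x + y" "x - y"] by simp
      show "norm (R x - R y) \<le> m * norm (x - y)" using \<rho>1(2)[OF that] by (simp add: m_def)
    qed
    finally show ?thesis by (simp add: m_def algebra_simps)
  qed
  have k0: "k 0 = 0" by (simp add: k_def R0 B.zero_left P.zero)
  \<comment> \<open>On this ball \<open>k\<close> has Lipschitz constant 1/2. The iteration
    \<open>y\<close> to \<open>x - k y\<close> is then a contraction, and it maps the ball to itself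
    when \<open>norm x\<close> is at most half the radius.\<close>
  define \<rho>2 where "\<rho>2 = min \<rho>1 (1 / (2 * (K + 1)))"
  have \<rho>2: "0 < \<rho>2" "\<rho>2 \<le> \<rho>1" "(K + 1) * \<rho>2 \<le> 1 / 2"
  proof -
    show "0 < \<rho>2" "\<rho>2 \<le> \<rho>1" using \<rho>1 K by (auto simp: \<rho>2_def)
    have "\<rho>2 \<le> 1 / (2 * (K + 1))" by (simp add: \<rho>2_def)
    then show "(K + 1) * \<rho>2 \<le> 1 / 2" using K(1) by (simp add: field_simps)
  qed
  have k_half: "norm (k x - k y) \<le> 1 / 2 * norm (x - y)" if "norm x \<le> \<rho>2" "norm y \<le> \<rho>2" for x y
  proof -
    have "norm (k x - k y) \<le> (K + 1) * max (norm x) (norm y) * norm (x - y)" using that \<rho>2 by (intro k_lip) auto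
    also have "\<dots> \<le> (K + 1) * \<rho>2 * norm (x - y)" using that K by (intro mult_right_mono mult_left_mono) auto
    also have "\<dots> \<le> 1 / 2 * norm (x - y)" using \<rho>2 by (intro mult_right_mono) auto
    finally show ?thesis .
  qed
  define S where "S = {y. P y = y} \<inter> cball 0 \<rho>2"
  have "closed {y. P y = y}" by (intro closed_Collect_eq continuous_intros P.continuous_on)
  then have S: "complete S" "S \<noteq> {}" unfolding S_def
    using \<rho>2(1) by (auto intro!: exI[of _ 0] P.zero simp: complete_eq_closed)
  have "\<exists>y. y \<in> S \<and> x - k y = y" if x: "P x = x" "norm x \<le> \<rho>2 / 2" for x
  proof -
    have "\<exists>!y\<in>S. x - k y = y"
    proof (rule Banach_fix[OF S, of "1 / 2"])
      show "(\<lambda>y. x - k y) ` S \<subseteq> S"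
      proof
        fix z assume "z \<in> (\<lambda>y. x - k y) ` S"
        then obtain y where y: "y \<in> S" "z = x - k y" by auto
        have "norm (k y) \<le> 1 / 2 * norm y" using k_half[of y 0] y \<rho>2 k0 by (auto simp: S_def)
        also have "\<dots> \<le> \<rho>2 / 2" using y by (auto simp: S_def)
        finally have "norm z \<le> \<rho>2" using norm_triangle_ineq4[of x "k y"] x y by simp
        moreover have "P z = z" using x y by (simp add: P.diff k_def PP)
        ultimately show "z \<in> S" by (simp add: S_def)
      qed
      show "dist (x - k y) (x - k z) \<le> 1 / 2 * dist y z" if "y \<in> S" "z \<in> S" for y z
        using k_half[of z y] that by (auto simp: S_def dist_norm norm_minus_commute)
    qed auto
    then show ?thesis by blast
  qed
  then obtain Y where Y: "\<And>x. P x = x \<Longrightarrow> norm x \<le> \<rho>2 / 2 \<Longrightarrow> Y x \<in> S \<and> x - k (Y x) = Y x"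
    by metis
  have YS: "P (Y x) = Y x" "norm (Y x) \<le> \<rho>2" "x = Y x + k (Y x)" if "P x = x" "norm x \<le> \<rho>2 / 2" for x
    using Y[OF that] by (auto simp: S_def algebra_simps)
  have Y_lip: "norm (Y x - Y y) \<le> 2 * norm (x - y)"
    if "P x = x" "norm x \<le> \<rho>2 / 2" "P y = y" "norm y \<le> \<rho>2 / 2" for x y
  proof -
    have "Y x - Y y = (x - y) - (k (Y x) - k (Y y))" using YS(3)[OF that(1,2)] YS(3)[OF that(3,4)] by (simp add: algebra_simps)
    then have "norm (Y x - Y y) \<le> norm (x - y) + norm (k (Y x) - k (Y y))" by (metis norm_triangle_ineq4)
    also have "\<dots> \<le> norm (x - y) + 1 / 2 * norm (Y x - Y y)"
      using that by (intro add_left_mono k_half YS)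
    finally show ?thesis by simp
  qed
  have z: "P 0 = 0" "norm (0::'a) \<le> \<rho>2 / 2" using \<rho>2 by (auto simp: P.zero)
  have Y0: "Y 0 = 0"
  proof -
    have "Y 0 = - k (Y 0)" using YS(3)[OF z] by (simp add: eq_neg_iff_add_eq_0)
    then have "norm (Y 0) = norm (k (Y 0) - k 0)" by (metis k0 diff_zero norm_minus_cancel)
    also have "\<dots> \<le> 1 / 2 * norm (Y 0 - 0)" using YS[OF z] \<rho>2 by (intro k_half) auto
    finally show ?thesis by simp
  qed
  have Y_le: "norm (Y x) \<le> 2 * norm x" if "P x = x" "norm x \<le> \<rho>2 / 2" for x
    using Y_lip[OF that z] by (simp add: Y0)
  define u where "u x = G (Y x) - P (G (Y x))" for x
  have GY: "G y = y + (1/2) *\<^sub>R B y y + R y" for y by (simp add: R_def)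
  have PGY: "P (G (Y x)) = x" if "P x = x" "norm x \<le> \<rho>2 / 2" for x
  proof -
    have "P (G (Y x)) = P (Y x) + k (Y x)" unfolding GY[of "Y x"] k_def by (simp add: P.add add.assoc)
    then show ?thesis using YS[OF that] by simp
  qed
  have u_eq: "u x = ((1/2) *\<^sub>R B (Y x) (Y x) + R (Y x)) - P ((1/2) *\<^sub>R B (Y x) (Y x) + R (Y x))"
    if "P x = x" "norm x \<le> \<rho>2 / 2" for x
    unfolding u_def GY[of "Y x"] using YS(1)[OF that] by (simp add: P.add)
  show thesis
  proof (rule that[of "\<rho>2 / 2" u])
    show "0 < \<rho>2 / 2" using \<rho>2 by simp
    show "u 0 = 0" by (simp add: u_def Y0 G0 P.zero)
    show "u x \<bullet> \<tau> i = 0" if "i < n" for x i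
      unfolding u_def P_def by (rule norm_frame_proj_decomp(2)[OF ortho that])
    show "\<exists>y. P y = y \<and> norm y \<le> 2 * norm x \<and> G y = x + u x" if "P x = x" "norm x \<le> \<rho>2 / 2" for x
      using YS(1)[OF that] Y_le[OF that] PGY[OF that] by (intro exI[of _ "Y x"]) (simp add: u_def)
    fix \<epsilon> :: real assume \<epsilon>: "0 < \<epsilon>"
    then have "0 < \<epsilon> / 8" by simp
    from rem[OF this] obtain \<rho>3 where \<rho>3: "0 < \<rho>3" "\<And>x y. norm x \<le> \<rho>3 \<Longrightarrow> norm y \<le> \<rho>3 \<Longrightarrow>
      norm (R x - R y) \<le> \<epsilon> / 8 * max (norm x) (norm y) * norm (x - y)" unfolding R_def by auto
    \<comment> \<open>The two terms of the bilinear increment below are each at most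
      \<open>12 * K * (K + 1) * m * m * v\<close>; the factor 1/2 in front of the quadratic term
      leaves one of them. The 8 in \<open>\<epsilon> / 8\<close> allows for \<open>Y\<close>
      doubling both norms and distances.\<close>
    define c where "c = 12 * K * (K + 1)"
    have c: "0 < c" using K by (simp add: c_def)
    define \<rho> where "\<rho> = min (\<rho>2 / 2) (min (\<rho>3 / 2) (\<epsilon> / (2 * c)))"
    have \<rho>: "0 < \<rho>" "\<rho> \<le> \<rho>2 / 2" "2 * \<rho> \<le> \<rho>3" "c * \<rho> \<le> \<epsilon> / 2"
    proof -
      show "0 < \<rho>" "\<rho> \<le> \<rho>2 / 2" "2 * \<rho> \<le> \<rho>3" using \<rho>2 \<rho>3 \<epsilon> c by (auto simp: \<rho>_def)
      have "c * \<rho> \<le> c * (\<epsilon> / (2 * c))" using c by (intro mult_left_mono) (auto simp: \<rho>_def)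
      then show "c * \<rho> \<le> \<epsilon> / 2" using c by simp
    qed
    have "norm ((u x - (1/2) *\<^sub>R (B x x - P (B x x))) - (u y - (1/2) *\<^sub>R (B y y - P (B y y)))) \<le> \<epsilon> * max (norm x) (norm y) * norm (x - y)"
      if x: "P x = x" "norm x \<le> \<rho>" and y: "P y = y" "norm y \<le> \<rho>" for x y
    proof -
      have x2: "norm x \<le> \<rho>2 / 2" and y2: "norm y \<le> \<rho>2 / 2" using x y \<rho> by auto
      define m where "m = max (norm x) (norm y)"
      define v where "v = norm (x - y)"
      have m: "0 \<le> m" "norm x \<le> m" "norm y \<le> m" "m \<le> \<rho>" and v: "0 \<le> v" using x y by (auto simp: m_def v_def le_max_iff_disj)
      \<comment> \<open>\<open>Y z\<close> differs from \<open>z\<close> by \<open>k (Y z)\<close>,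
        which is of second order; replacing one by the other in the quadratic term therefore changes
        it only to third order.\<close>
      have BY: "B (Y z) (Y z) - B z z = - B (Y z + z) (k (Y z))" if "P z = z" "norm z \<le> \<rho>2 / 2" for z
      proof -
        have "Y z - z = - k (Y z)" using YS(3)[OF that] by (metis add.commute diff_add_cancel diff_minus_eq_add minus_diff_eq uminus_add_conv_diff)
        then show ?thesis unfolding Bdiff by (simp add: B.minus_right)
      qed
      define W where "W = (1/2) *\<^sub>R (B (Y y + y) (k (Y y)) - B (Y x + x) (k (Y x))) + (R (Y x) - R (Y y))"
      have "(u x - (1/2) *\<^sub>R (B x x - P (B x x))) - (u y - (1/2) *\<^sub>R (B y y - P (B y y))) = W - P W"
      proof -
        define a where "a z = (1/2) *\<^sub>R B (Y z) (Y z) + R (Y z) - (1/2) *\<^sub>R B z z" for z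
        have "u z - (1/2) *\<^sub>R (B z z - P (B z z)) = a z - P (a z)" if "P z = z" "norm z \<le> \<rho>2 / 2" for z
          unfolding u_eq[OF that] a_def by (simp add: P.diff P.scaleR scaleR_right_diff_distrib)
        moreover have "a z = (1/2) *\<^sub>R (- B (Y z + z) (k (Y z))) + R (Y z)" if "P z = z" "norm z \<le> \<rho>2 / 2" for z
          unfolding BY[OF that, symmetric] a_def by (simp add: scaleR_right_diff_distrib)
        then have "W = a x - a y" using x(1) x2 y(1) y2 by (simp add: W_def scaleR_right_diff_distrib)
        ultimately show ?thesis using x(1) x2 y(1) y2 by (simp add: P.diff)
      qed
      then have "norm ((u x - (1/2) *\<^sub>R (B x x - P (B x x))) - (u y - (1/2) *\<^sub>R (B y y - P (B y y)))) \<le> norm W"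
        using P_le(2)[of W] by simp
      also have "\<dots> \<le> norm ((1/2) *\<^sub>R (B (Y y + y) (k (Y y)) - B (Y x + x) (k (Y x)))) + norm (R (Y x) - R (Y y))"
        unfolding W_def by (rule norm_triangle_ineq)
      also have "\<dots> \<le> c * m * m * v + \<epsilon> / 2 * m * v"
      proof (intro add_mono)
        have Yx: "norm (Y x) \<le> 2 * m" "norm (Y y) \<le> 2 * m" and Yv: "norm (Y y - Y x) \<le> 2 * v" "norm (Y x - Y y) \<le> 2 * v"
          using Y_le[OF x(1) x2] Y_le[OF y(1) y2] Y_lip[OF x(1) x2 y(1) y2] m by (auto simp: v_def norm_minus_commute)
        have Yr: "norm (Y x) \<le> \<rho>1" "norm (Y y) \<le> \<rho>1" using YS(2)[OF x(1) x2] YS(2)[OF y(1) y2] \<rho>2 by auto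
        have ky: "norm (k (Y y)) \<le> (K + 1) * (2 * m) * (2 * m)"
        proof -
          have "norm (k (Y y) - k 0) \<le> (K + 1) * max (norm (Y y)) (norm (0::'a)) * norm (Y y - 0)"
            using Yr \<rho>1(1) by (intro k_lip) auto
          also have "\<dots> \<le> (K + 1) * (2 * m) * (2 * m)" using Yx K m by (intro mult_mono) (auto simp: le_max_iff_disj)
          finally show ?thesis by (simp add: k0)
        qed
        have kd: "norm (k (Y y) - k (Y x)) \<le> (K + 1) * (2 * m) * (2 * v)"
        proof -
          have "norm (k (Y y) - k (Y x)) \<le> (K + 1) * max (norm (Y y)) (norm (Y x)) * norm (Y y - Y x)"
            using Yr by (intro k_lip) auto
          also have "\<dots> \<le> (K + 1) * (2 * m) * (2 * v)" using Yx Yv K m v by (intro mult_mono) (auto simp: le_max_iff_disj)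
          finally show ?thesis .
        qed
        have "B (Y y + y) (k (Y y)) - B (Y x + x) (k (Y x)) = B ((Y y - Y x) + (y - x)) (k (Y y)) + B (Y x + x) (k (Y y) - k (Y x))"
          by (simp add: B.add_left B.diff_left B.diff_right)
        also have "norm \<dots> \<le> K * (3 * v) * ((K + 1) * (2 * m) * (2 * m)) + K * (3 * m) * ((K + 1) * (2 * m) * (2 * v))"
        proof (rule order_trans[OF norm_triangle_ineq add_mono])
          have "norm ((Y y - Y x) + (y - x)) \<le> 3 * v" using norm_triangle_ineq[of "Y y - Y x" "y - x"] Yv by (simp add: v_def norm_minus_commute)
          then have "K * norm ((Y y - Y x) + (y - x)) * norm (k (Y y)) \<le> K * (3 * v) * ((K + 1) * (2 * m) * (2 * m))"
            using ky K m v by (intro mult_mono) auto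
          then show "norm (B ((Y y - Y x) + (y - x)) (k (Y y))) \<le> K * (3 * v) * ((K + 1) * (2 * m) * (2 * m))"
            using K(2) order_trans by blast
          have "norm (Y x + x) \<le> 3 * m" using norm_triangle_ineq[of "Y x" x] Yx m by linarith
          then have "K * norm (Y x + x) * norm (k (Y y) - k (Y x)) \<le> K * (3 * m) * ((K + 1) * (2 * m) * (2 * v))"
            using kd K m v by (intro mult_mono) auto
          then show "norm (B (Y x + x) (k (Y y) - k (Y x))) \<le> K * (3 * m) * ((K + 1) * (2 * m) * (2 * v))"
            using K(2) order_trans by blast
        qed
        also have "\<dots> = 2 * (c * m * m * v)" by (simp add: c_def algebra_simps)
        finally show "norm ((1/2) *\<^sub>R (B (Y y + y) (k (Y y)) - B (Y x + x) (k (Y x)))) \<le> c * m * m * v" by simp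
        have "norm (R (Y x) - R (Y y)) \<le> \<epsilon> / 8 * max (norm (Y x)) (norm (Y y)) * norm (Y x - Y y)"
          using Yx m \<rho> by (intro \<rho>3(2)) auto
        also have "\<dots> \<le> \<epsilon> / 8 * (2 * m) * (2 * v)" using Yx Yv \<epsilon> m v by (intro mult_mono) (auto simp: le_max_iff_disj)
        finally show "norm (R (Y x) - R (Y y)) \<le> \<epsilon> / 2 * m * v" by simp
      qed
      also have "\<dots> \<le> \<epsilon> / 2 * m * v + \<epsilon> / 2 * m * v"
      proof -
        have "c * m \<le> \<epsilon> / 2" using \<rho>(4) m c by (smt (verit) mult_left_mono)
        then show ?thesis using m v by (intro add_right_mono mult_right_mono) auto
      qed
      finally show ?thesis by (simp add: m_def v_def mult_ac)
    qed
    then show "\<exists>\<rho>>0. \<forall>x y. P x = x \<and> P y = y \<and> norm x \<le> \<rho> \<and> norm y \<le> \<rho> \<longrightarrow>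
      norm ((u x - (1/2) *\<^sub>R (B x x - P (B x x))) - (u y - (1/2) *\<^sub>R (B y y - P (B y y)))) \<le> \<epsilon> * max (norm x) (norm y) * norm (x - y)"
      using \<rho>(1) by blast
  qed
qed

section \<open>Smooth maps along lines, orthonormal frames and one-sided derivatives\<close>

lemma Ck_on_cong:
  assumes "open S" "\<And>x. x \<in> S \<Longrightarrow> f x = g x"
  shows "Ck_on k f S \<Longrightarrow> Ck_on k g S"
  using assms(2)
proof (induction k arbitrary: f g)
  case 0
  then show ?case by (simp cong: continuous_on_cong)
next
  case (Suc k)
  have der: "g differentiable (at x) \<and> frechet_derivative f (at x) = frechet_derivative g (at x)" if x: "x \<in> S" for x
  proof -
    have f: "f differentiable (at x)" using Suc.prems(1) x by simp
    have "frechet_derivative f (at x) = frechet_derivative g (at x)"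
      by (rule frechet_derivative_transform_within_open[OF f assms(1) x Suc.prems(2)])
    moreover have "g differentiable (at x)"
    proof -
      obtain D where "(f has_derivative D) (at x)" using f by (auto simp: differentiable_def)
      then have "(g has_derivative D) (at x)"
        by (rule has_derivative_transform_within_open[OF _ assms(1) x]) (rule Suc.prems(2))
      then show ?thesis by (auto simp: differentiable_def)
    qed
    ultimately show ?thesis by blast
  qed
  have "Ck_on k (\<lambda>x. frechet_derivative g (at x) v) S" for v
    by (rule Suc.IH[of "\<lambda>x. frechet_derivative f (at x) v"]) (use Suc.prems(1) der in auto)
  then show ?case using der by simp
qed

text \<open>The factor \<open>c\<close> carries the induction: the derivative applied to
  \<open>v\<close> is \<open>c * v\<close> times the composite of the derivative of \<open>f\<close>
  in direction \<open>b\<close>, a map of the same shape.\<close>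

lemma Ck_on_affine:
  fixes f :: "'a::real_normed_vector \<Rightarrow> 'b::real_normed_vector"
  assumes "open J" and J: "\<And>s. s \<in> J \<Longrightarrow> z + s *\<^sub>R b \<in> V"
  shows "Ck_on k f V \<Longrightarrow> Ck_on k (\<lambda>s. c *\<^sub>R f (z + s *\<^sub>R b)) J"
proof (induction k arbitrary: f c)
  case 0
  have "continuous_on J (\<lambda>s. f (z + s *\<^sub>R b))"
    by (rule continuous_on_compose2[of V f]) (use 0 J in \<open>auto intro!: continuous_intros\<close>)
  then show ?case by (simp add: continuous_on_scaleR)
next
  case (Suc k)
  have der: "((\<lambda>s. c *\<^sub>R f (z + s *\<^sub>R b)) has_derivative (\<lambda>h. (c * h) *\<^sub>R frechet_derivative f (at (z + s *\<^sub>R b)) b)) (at s)"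
    if s: "s \<in> J" for s
  proof -
    have f: "(f has_derivative frechet_derivative f (at (z + s *\<^sub>R b))) (at (z + s *\<^sub>R b))"
      using Suc.prems J[OF s] frechet_derivative_works by auto
    have l: "((\<lambda>s. z + s *\<^sub>R b) has_derivative (\<lambda>h. h *\<^sub>R b)) (at s)" by (auto intro!: derivative_eq_intros)
    have "frechet_derivative f (at (z + s *\<^sub>R b)) (h *\<^sub>R b) = h *\<^sub>R frechet_derivative f (at (z + s *\<^sub>R b)) b" for h
      using linear_scale[OF has_derivative_linear[OF f]] .
    then have eq: "(\<lambda>h. c *\<^sub>R frechet_derivative f (at (z + s *\<^sub>R b)) (h *\<^sub>R b)) = (\<lambda>h. (c * h) *\<^sub>R frechet_derivative f (at (z + s *\<^sub>R b)) b)"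
      by simp
    show ?thesis using has_derivative_scaleR_right[OF has_derivative_compose[OF l f], of c] unfolding eq .
  qed
  have fd: "frechet_derivative (\<lambda>s. c *\<^sub>R f (z + s *\<^sub>R b)) (at s) v = (c * v) *\<^sub>R frechet_derivative f (at (z + s *\<^sub>R b)) b"
    if "s \<in> J" for s v
    using frechet_derivative_at[OF der[OF that]] by metis
  have "Ck_on k (\<lambda>s. frechet_derivative (\<lambda>s. c *\<^sub>R f (z + s *\<^sub>R b)) (at s) v) J" for v
  proof (rule Ck_on_cong[OF assms(1)])
    show "Ck_on k (\<lambda>s. (c * v) *\<^sub>R (\<lambda>x. frechet_derivative f (at x) b) (z + s *\<^sub>R b)) J"
      by (rule Suc.IH) (use Suc.prems in simp)
  qed (use fd in simp)
  then show ?case using der unfolding Ck_on.simps differentiable_def by blast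
qed

lemma smooth_on_affine:
  fixes f :: "'a::real_normed_vector \<Rightarrow> 'b::real_normed_vector"
  assumes "smooth_on f V" "open J" "\<And>s. s \<in> J \<Longrightarrow> z + s *\<^sub>R b \<in> V"
  shows "smooth_on (\<lambda>s. f (z + s *\<^sub>R b)) J"
  using Ck_on_affine[OF assms(2,3), of _ f 1] assms(1) by (simp add: smooth_on_def)

lemma smooth_on_const: "smooth_on (\<lambda>x. c) S"
proof -
  have "Ck_on k (\<lambda>x. c) S" for k and c :: 'b
    by (induction k arbitrary: c) auto
  then show ?thesis by (simp add: smooth_on_def)
qed

lemma smooth_on_has_derivative:
  assumes "smooth_on f S" "x \<in> S"
  shows "(f has_derivative frechet_derivative f (at x)) (at x)"
proof -
  have "Ck_on (Suc 0) f S" using assms(1) by (simp only: smooth_on_def)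
  then show ?thesis using assms(2) frechet_derivative_works by auto
qed

lemma smooth_on_frechet_derivative:
  assumes "smooth_on f S"
  shows "smooth_on (\<lambda>x. frechet_derivative f (at x) v) S"
  unfolding smooth_on_def
proof
  fix k
  have "Ck_on (Suc k) f S" using assms by (simp only: smooth_on_def)
  then show "Ck_on k (\<lambda>x. frechet_derivative f (at x) v) S" by simp
qed

lemma smooth_on_imp_continuous_on: "smooth_on f S \<Longrightarrow> continuous_on S f"
  unfolding smooth_on_def by (metis Ck_on.simps(1))

lemma obtain_frame:
  fixes T :: "'a::euclidean_space set"
  assumes "subspace T" "dim T = n"
  obtains \<tau> where "orthonormal n \<tau>" "\<And>x. frame_proj n \<tau> x = x \<longleftrightarrow> x \<in> T" "\<And>i. i < n \<Longrightarrow> \<tau> i \<in> T"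
proof -
  obtain B where B: "B \<subseteq> T" "pairwise orthogonal B" "\<And>x. x \<in> B \<Longrightarrow> norm x = 1" "independent B" "card B = dim T" "span B = T"
    using orthonormal_basis_subspace[OF assms(1)] by metis
  have "finite B" using B(4) independent_imp_finite by blast
  then obtain \<tau> where \<tau>: "bij_betw \<tau> {..<n} B"
    using ex_bij_betw_nat_finite[of B] B(5) assms(2) by (auto simp: atLeast0LessThan)
  have \<tau>B: "\<tau> i \<in> B" if "i < n" for i using \<tau> that by (auto simp: bij_betw_def)
  have orth: "orthonormal n \<tau>"
    unfolding orthonormal_def
  proof (intro allI impI)
    fix i j assume ij: "i < n" "j < n"
    show "\<tau> i \<bullet> \<tau> j = (if i = j then 1 else 0)"
    proof (cases "i = j")
      case True
      then show ?thesis using B(3)[OF \<tau>B[OF ij(1)]] by (simp add: dot_square_norm)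
    next
      case False
      then have "\<tau> i \<noteq> \<tau> j" using \<tau> ij by (auto simp: bij_betw_def inj_on_def)
      then have "orthogonal (\<tau> i) (\<tau> j)" using B(2) \<tau>B ij by (auto simp: pairwise_def)
      then show ?thesis using False by (simp add: orthogonal_def)
    qed
  qed
  have in_T: "lincomb n \<tau> f \<in> T" for f
    unfolding lincomb_def using \<tau>B B(1) by (intro subspace_sum[OF assms(1)] subspace_scale[OF assms(1)]) auto
  have "frame_proj n \<tau> x = x" if "x \<in> T" for x
  proof -
    have "T \<subseteq> {x. frame_proj n \<tau> x = x}"
      unfolding B(6)[symmetric]
    proof (rule span_minimal)
      show "B \<subseteq> {x. frame_proj n \<tau> x = x}"
      proof
        fix b assume "b \<in> B"
        then obtain i where i: "i < n" "b = \<tau> i" using \<tau> by (auto simp: bij_betw_def)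
        have "b = lincomb n \<tau> (\<lambda>j. if j = i then 1 else 0)"
          using i by (simp add: lincomb_def if_distrib[of "\<lambda>x. x *\<^sub>R _"] cong: if_cong)
        then have "frame_proj n \<tau> b = b"
          using frame_proj_lincomb[OF orth, of "\<lambda>j. if j = i then 1 else 0"] by (simp only:)
        then show "b \<in> {x. frame_proj n \<tau> x = x}" by simp
      qed
      interpret P: bounded_linear "frame_proj n \<tau>" by (rule bounded_linear_frame_proj)
      show "subspace {x. frame_proj n \<tau> x = x}"
        by (rule subspaceI) (auto simp: P.zero P.add P.scaleR)
    qed
    then show ?thesis using that by blast
  qed
  moreover have "x \<in> T" if "frame_proj n \<tau> x = x" for x
    using in_T[of "\<lambda>i. x \<bullet> \<tau> i"] that by (simp add: frame_proj_def)
  ultimately show thesis using that[OF orth] \<tau>B B(1) by blast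
qed

text \<open>Difference quotients from one side lie in \<open>S\<close>, which is closed, and the
  two-sided derivative is their limit. One side is all that curves in \<open>tangent_space\<close>
  provide.\<close>

lemma one_sided_derivative_in_subspace:
  fixes f :: "real \<Rightarrow> 'a::euclidean_space"
  assumes f: "(f has_vector_derivative v) (at 0)" and S: "subspace S" and "0 < \<epsilon>"
    and side: "(\<forall>s. 0 < s \<and> s < \<epsilon> \<longrightarrow> f s - f 0 \<in> S) \<or> (\<forall>s. - \<epsilon> < s \<and> s < 0 \<longrightarrow> f s - f 0 \<in> S)"
  shows "v \<in> S"
proof -
  have lim: "((\<lambda>s. (f s - f 0) /\<^sub>R s) \<longlongrightarrow> v) (at 0)"
  proof -
    have "((\<lambda>s. (f s - f 0 - s *\<^sub>R v) /\<^sub>R norm s) \<longlongrightarrow> 0) (at 0)"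
      using f unfolding has_vector_derivative_def has_derivative_at2 by (simp add: divide_inverse diff_diff_eq)
    then have "((\<lambda>s. norm ((f s - f 0) /\<^sub>R s - v)) \<longlongrightarrow> 0) (at 0)"
    proof (rule Lim_transform_eventually[OF tendsto_norm_zero])
      show "\<forall>\<^sub>F s in at 0. norm ((f s - f 0 - s *\<^sub>R v) /\<^sub>R norm s) = norm ((f s - f 0) /\<^sub>R s - v)"
        unfolding eventually_at_filter
      proof (rule always_eventually, intro allI impI)
        fix s :: real assume "s \<noteq> 0"
        then have "(f s - f 0) /\<^sub>R s - v = (f s - f 0 - s *\<^sub>R v) /\<^sub>R s" by (simp add: scaleR_right_diff_distrib)
        then show "norm ((f s - f 0 - s *\<^sub>R v) /\<^sub>R norm s) = norm ((f s - f 0) /\<^sub>R s - v)" by simp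
      qed
    qed
    then show ?thesis by (simp add: tendsto_norm_zero_iff LIM_zero_iff)
  qed
  have "\<exists>F::real filter. F \<le> at 0 \<and> F \<noteq> bot \<and> (\<forall>\<^sub>F s in F. (f s - f 0) /\<^sub>R s \<in> S)"
    using side
  proof
    assume *: "\<forall>s. 0 < s \<and> s < \<epsilon> \<longrightarrow> f s - f 0 \<in> S"
    have "\<forall>\<^sub>F s in at_right 0. (f s - f 0) /\<^sub>R s \<in> S"
      unfolding eventually_at_right_field using \<open>0 < \<epsilon>\<close> * subspace_scale[OF S] by blast
    then show ?thesis by (intro exI[of _ "at_right 0"]) (auto intro: at_le)
  next
    assume *: "\<forall>s. - \<epsilon> < s \<and> s < 0 \<longrightarrow> f s - f 0 \<in> S"
    have "\<forall>\<^sub>F s in at_left 0. (f s - f 0) /\<^sub>R s \<in> S"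
      unfolding eventually_at_left_field using \<open>0 < \<epsilon>\<close> * subspace_scale[OF S]
      by (intro exI[of _ "- \<epsilon>"]) auto
    then show ?thesis by (intro exI[of _ "at_left 0"]) (auto intro: at_le)
  qed
  then obtain F :: "real filter" where F: "F \<le> at 0" "F \<noteq> bot" "\<forall>\<^sub>F s in F. (f s - f 0) /\<^sub>R s \<in> S" by blast
  show ?thesis
    using Lim_in_closed_set[OF closed_subspace[OF S] F(3,2)] tendsto_mono[OF F(1) lim] by blast
qed

subsection \<open>Charts and tangent spaces\<close>

text \<open>The image of \<Sigma> under the chart is deliberately left out: charts at interior and
  at boundary points share everything below and differ only in their slice condition.\<close>

locale slice_chart =
  fixes U V :: "'a::euclidean_space set" and \<phi> \<psi> :: "'a \<Rightarrow> 'a" and L :: "'a set" and n :: nat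
  assumes diffeo: "smooth_diffeo U V \<phi> \<psi>" and L: "subspace L" "dim L = n"
begin

definition d\<psi> :: "'a \<Rightarrow> 'a \<Rightarrow> 'a" where "d\<psi> z = frechet_derivative \<psi> (at z)"
text \<open>Taken at \<open>\<psi> z\<close> and indexed by the chart point \<open>z\<close>, so
  that it is the inverse of \<open>d\<psi> z\<close>.\<close>

definition d\<phi> :: "'a \<Rightarrow> 'a \<Rightarrow> 'a" where "d\<phi> z = frechet_derivative \<phi> (at (\<psi> z))"
definition dd\<psi> :: "'a \<Rightarrow> 'a \<Rightarrow> 'a \<Rightarrow> 'a" where "dd\<psi> z a b = frechet_derivative (\<lambda>x. d\<psi> x b) (at z) a"
definition tangent :: "'a \<Rightarrow> 'a set" where "tangent z = d\<psi> z ` L"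

lemma opens: "open U" "open V" and smooth: "smooth_on \<phi> U" "smooth_on \<psi> V"
  using diffeo by (auto simp: smooth_diffeo_def)

lemma inv: "z \<in> V \<Longrightarrow> \<psi> z \<in> U" "z \<in> V \<Longrightarrow> \<phi> (\<psi> z) = z" "x \<in> U \<Longrightarrow> \<phi> x \<in> V" "x \<in> U \<Longrightarrow> \<psi> (\<phi> x) = x"
  using diffeo by (auto simp: smooth_diffeo_def homeomorphism_def)

lemma has_derivative_\<psi>: "z \<in> V \<Longrightarrow> (\<psi> has_derivative d\<psi> z) (at z)"
  unfolding d\<psi>_def by (rule smooth_on_has_derivative[OF smooth(2)])

lemma has_derivative_\<phi>: "z \<in> V \<Longrightarrow> (\<phi> has_derivative d\<phi> z) (at (\<psi> z))"
  unfolding d\<phi>_def by (rule smooth_on_has_derivative[OF smooth(1) inv(1)])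

lemma has_derivative_d\<psi>: "z \<in> V \<Longrightarrow> ((\<lambda>x. d\<psi> x b) has_derivative (\<lambda>a. dd\<psi> z a b)) (at z)"
  unfolding dd\<psi>_def d\<psi>_def
  by (rule smooth_on_has_derivative[OF smooth_on_frechet_derivative[OF smooth(2)]])

lemma linear_d: "z \<in> V \<Longrightarrow> bounded_linear (d\<psi> z)" "z \<in> V \<Longrightarrow> bounded_linear (d\<phi> z)"
  using has_derivative_\<psi> has_derivative_\<phi> has_derivative_bounded_linear by blast+

lemma d_inverse: "z \<in> V \<Longrightarrow> d\<phi> z (d\<psi> z v) = v" "z \<in> V \<Longrightarrow> d\<psi> z (d\<phi> z v) = v"
proof -
  assume z: "z \<in> V"
  have "((\<lambda>x. \<phi> (\<psi> x)) has_derivative (\<lambda>h. d\<phi> z (d\<psi> z h))) (at z)"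
    by (rule has_derivative_compose[OF has_derivative_\<psi>[OF z] has_derivative_\<phi>[OF z]])
  moreover have "((\<lambda>x. \<phi> (\<psi> x)) has_derivative (\<lambda>h. h)) (at z)"
    by (rule has_derivative_transform_within_open[OF has_derivative_ident opens(2) z]) (simp add: inv)
  ultimately have "(\<lambda>h. d\<phi> z (d\<psi> z h)) = (\<lambda>h. h)" by (rule has_derivative_unique)
  then show "d\<phi> z (d\<psi> z v) = v" by meson
  have "(\<psi> has_derivative d\<psi> z) (at (\<phi> (\<psi> z)))" using has_derivative_\<psi>[OF z] inv(2)[OF z] by simp
  then have "((\<lambda>x. \<psi> (\<phi> x)) has_derivative (\<lambda>h. d\<psi> z (d\<phi> z h))) (at (\<psi> z))"
    by (rule has_derivative_compose[OF has_derivative_\<phi>[OF z]])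
  moreover have "((\<lambda>x. \<psi> (\<phi> x)) has_derivative (\<lambda>h. h)) (at (\<psi> z))"
    by (rule has_derivative_transform_within_open[OF has_derivative_ident opens(1) inv(1)[OF z]]) (simp add: inv)
  ultimately have "(\<lambda>h. d\<psi> z (d\<phi> z h)) = (\<lambda>h. h)" by (rule has_derivative_unique)
  then show "d\<psi> z (d\<phi> z v) = v" by meson
qed

lemma tangent_iff: "z \<in> V \<Longrightarrow> w \<in> tangent z \<longleftrightarrow> d\<phi> z w \<in> L"
  unfolding tangent_def using d_inverse by (metis (no_types, lifting) image_iff)

lemma tangent: "z \<in> V \<Longrightarrow> subspace (tangent z)" "z \<in> V \<Longrightarrow> dim (tangent z) = n"
proof -
  assume z: "z \<in> V"
  have lin: "linear (d\<psi> z)" using linear_d(1)[OF z] bounded_linear.linear by blast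
  show "subspace (tangent z)" unfolding tangent_def by (rule linear_subspace_image[OF lin L(1)])
  have "inj (d\<psi> z)" by (rule inj_on_inverseI[of _ "d\<phi> z"]) (rule d_inverse(1)[OF z])
  then show "dim (tangent z) = n" unfolding tangent_def using dim_image_eq[OF lin] L inj_on_subset by (metis subset_UNIV)
qed

lemma dd\<psi>_linear: "z \<in> V \<Longrightarrow> linear (\<lambda>a. dd\<psi> z a b)" "z \<in> V \<Longrightarrow> linear (dd\<psi> z a)"
proof -
  assume z: "z \<in> V"
  show 1: "linear (\<lambda>a. dd\<psi> z a b)" for b using has_derivative_linear[OF has_derivative_d\<psi>[OF z]] .
  have "dd\<psi> z a (b + c) = dd\<psi> z a b + dd\<psi> z a c" for b c
  proof -
    have "((\<lambda>x. d\<psi> x b + d\<psi> x c) has_derivative (\<lambda>a. dd\<psi> z a b + dd\<psi> z a c)) (at z)"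
      by (intro has_derivative_add has_derivative_d\<psi> z)
    then have "((\<lambda>x. d\<psi> x (b + c)) has_derivative (\<lambda>a. dd\<psi> z a b + dd\<psi> z a c)) (at z)"
      by (rule has_derivative_transform_within_open[OF _ opens(2) z]) (simp add: linear_simps(1)[OF linear_d(1)])
    from has_derivative_unique[OF has_derivative_d\<psi>[OF z] this] show ?thesis by meson
  qed
  moreover have "dd\<psi> z a (r *\<^sub>R b) = r *\<^sub>R dd\<psi> z a b" for b r
  proof -
    have "((\<lambda>x. r *\<^sub>R d\<psi> x b) has_derivative (\<lambda>a. r *\<^sub>R dd\<psi> z a b)) (at z)"
      by (intro has_derivative_scaleR_right has_derivative_d\<psi> z)
    then have "((\<lambda>x. d\<psi> x (r *\<^sub>R b)) has_derivative (\<lambda>a. r *\<^sub>R dd\<psi> z a b)) (at z)"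
      by (rule has_derivative_transform_within_open[OF _ opens(2) z]) (simp add: linear_simps(5)[OF linear_d(1)])
    from has_derivative_unique[OF has_derivative_d\<psi>[OF z] this] show ?thesis by meson
  qed
  ultimately show "linear (dd\<psi> z a)" by (rule linearI)
qed

lemma dd\<psi>_sym:
  assumes z: "z \<in> V"
  shows "dd\<psi> z a b = dd\<psi> z b a"
proof -
  obtain r where r: "0 < r" "ball z r \<subseteq> V" using opens(2) z open_contains_ball by blast
  have "(\<psi> has_derivative d\<psi> x) (at x)" if "dist z x < r" for x
    using r that by (intro has_derivative_\<psi>) auto
  then show ?thesis
    by (rule second_derivative_symmetric[OF r(1) _ has_derivative_d\<psi>[OF z] has_derivative_d\<psi>[OF z]])
qed

lemma continuous_dd\<psi>: "continuous_on V (\<lambda>z. dd\<psi> z a b)"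
  unfolding dd\<psi>_def d\<psi>_def
  by (intro smooth_on_imp_continuous_on smooth_on_frechet_derivative smooth)

text \<open>Moves the second derivative of the parametrization back to the chart, where tangency
  becomes membership in the fixed space \<open>L\<close>. For tangent second derivatives this is the
  vector of Christoffel symbols.\<close>

definition tangential_coeff :: "'a \<Rightarrow> 'a \<Rightarrow> 'a \<Rightarrow> 'a" where
  "tangential_coeff z a b = d\<phi> z (dd\<psi> z a b)"

lemma continuous_tangential_coeff: "continuous_on V (\<lambda>z. tangential_coeff z a b)"
proof -
  have "continuous_on V (\<lambda>z. \<Sum>c\<in>Basis. (dd\<psi> z a b \<bullet> c) *\<^sub>R d\<phi> z c)"
  proof (intro continuous_intros continuous_dd\<psi>)
    fix c :: 'a
    have "continuous_on U (\<lambda>x. frechet_derivative \<phi> (at x) c)"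
      by (intro smooth_on_imp_continuous_on smooth_on_frechet_derivative smooth)
    then show "continuous_on V (\<lambda>z. d\<phi> z c)" unfolding d\<phi>_def
      by (rule continuous_on_compose2[OF _ smooth_on_imp_continuous_on[OF smooth(2)]]) (use inv in auto)
  qed
  moreover have "(\<Sum>c\<in>Basis. (dd\<psi> z a b \<bullet> c) *\<^sub>R d\<phi> z c) = tangential_coeff z a b" if "z \<in> V" for z
  proof -
    interpret l: bounded_linear "d\<phi> z" by (rule linear_d(2)[OF that])
    have "tangential_coeff z a b = d\<phi> z (\<Sum>c\<in>Basis. (dd\<psi> z a b \<bullet> c) *\<^sub>R c)"
      by (simp add: tangential_coeff_def euclidean_representation)
    then show ?thesis by (simp only: l.sum l.scaleR)
  qed
  ultimately show ?thesis by (simp cong: continuous_on_cong)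
qed

text \<open>Reparametrizing \<psi> by \<open>d\<phi> z\<close> gives a map with derivative the
  identity at 0 and second derivative \<open>B\<close>; its Taylor remainder feeds
  \<open>graph_of_map\<close>. The factor 2 bounds the parameter of the point over \<open>x\<close>,
  so that it can be kept within the part of the chart known to map into \<Sigma>.\<close>

lemma chart_graph:
  assumes z: "z \<in> V"
  obtains \<tau> B u \<rho>0 where "orthonormal n \<tau>" "\<And>x. frame_proj n \<tau> x = x \<longleftrightarrow> x \<in> tangent z"
    "bounded_bilinear B" "\<And>x y. B x y = B y x" "\<And>a b. B (d\<psi> z a) (d\<psi> z b) = dd\<psi> z a b"
    "0 < \<rho>0" "u 0 = 0"
    "\<And>x i. x \<in> tangent z \<Longrightarrow> norm x \<le> \<rho>0 \<Longrightarrow> i < n \<Longrightarrow> u x \<bullet> \<tau> i = 0"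
    "\<And>x. x \<in> tangent z \<Longrightarrow> norm x \<le> \<rho>0 \<Longrightarrow>
       \<exists>y\<in>L. norm (d\<psi> z y) \<le> 2 * norm x \<and> \<psi> (z + y) = \<psi> z + x + u x"
    "\<And>\<epsilon>. 0 < \<epsilon> \<Longrightarrow> \<exists>\<rho>>0. \<forall>x y. frame_proj n \<tau> x = x \<and> frame_proj n \<tau> y = y \<and> norm x \<le> \<rho> \<and> norm y \<le> \<rho> \<longrightarrow>
      norm ((u x - (1/2) *\<^sub>R (B x x - frame_proj n \<tau> (B x x))) - (u y - (1/2) *\<^sub>R (B y y - frame_proj n \<tau> (B y y)))) \<le> \<epsilon> * max (norm x) (norm y) * norm (x - y)"
proof -
  obtain \<tau> where \<tau>: "orthonormal n \<tau>" "\<And>x. frame_proj n \<tau> x = x \<longleftrightarrow> x \<in> tangent z"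
    by (rule obtain_frame[OF tangent[OF z]]) (rule that)
  interpret A: bounded_linear "d\<phi> z" by (rule linear_d(2)[OF z])
  define G where "G y = \<psi> (z + d\<phi> z y) - \<psi> z" for y
  define G' where "G' y v = d\<psi> (z + d\<phi> z y) (d\<phi> z v)" for y v
  define B where "B x y = dd\<psi> z (d\<phi> z x) (d\<phi> z y)" for x y
  have "bilinear (\<lambda>a b. dd\<psi> z a b)" unfolding bilinear_def using dd\<psi>_linear[OF z] by blast
  then have "bounded_bilinear (\<lambda>a b. dd\<psi> z a b)" using bilinear_conv_bounded_bilinear by blast
  then have B: "bounded_bilinear B"
    unfolding B_def[abs_def] by (rule bounded_bilinear.comp[OF _ linear_d(2)[OF z] linear_d(2)[OF z]])
  have Bsym: "B x y = B y x" for x y unfolding B_def by (rule dd\<psi>_sym[OF z])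
  obtain r0 where r0: "0 < r0" "ball z r0 \<subseteq> V" using opens(2) z open_contains_ball by blast
  obtain K where K: "0 < K" "\<And>y. norm (d\<phi> z y) \<le> norm y * K" using A.pos_bounded by blast
  define r where "r = r0 / K"
  have r: "0 < r" using r0 K by (simp add: r_def)
  have inV: "z + d\<phi> z y \<in> V" if "norm y < r" for y
  proof -
    have "norm (d\<phi> z y) < r0" using K(2)[of y] that K(1) by (simp add: r_def pos_less_divide_eq)
    then show ?thesis using r0 by (auto simp: dist_norm)
  qed
  have aff: "((\<lambda>y. z + d\<phi> z y) has_derivative d\<phi> z) (at y)" for y
    using has_derivative_add[OF has_derivative_const[of z] A.has_derivative[OF has_derivative_ident]] by simp
  have derG: "(G has_derivative G' y) (at y)" if "norm y < r" for y
  proof -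
    have "((\<lambda>y. \<psi> (z + d\<phi> z y)) has_derivative (\<lambda>v. d\<psi> (z + d\<phi> z y) (d\<phi> z v))) (at y)"
      by (rule has_derivative_compose[OF aff has_derivative_\<psi>[OF inV[OF that]]])
    from has_derivative_diff[OF this has_derivative_const[of "\<psi> z"]]
    show ?thesis unfolding G_def[abs_def] G'_def[abs_def] by simp
  qed
  have G'0: "G' 0 v = v" for v using d_inverse(2)[OF z] by (simp add: G'_def A.zero)
  have derG': "((\<lambda>y. G' y v) has_derivative (\<lambda>h. B h v)) (at 0)" for v
  proof -
    have "((\<lambda>x. d\<psi> x (d\<phi> z v)) has_derivative (\<lambda>a. dd\<psi> z a (d\<phi> z v))) (at (z + d\<phi> z 0))"
      using has_derivative_d\<psi>[OF z] by (simp add: A.zero)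
    from has_derivative_compose[OF aff this] show ?thesis unfolding G'_def B_def .
  qed
  have rem: "\<exists>\<rho>>0. \<forall>x y. norm x \<le> \<rho> \<and> norm y \<le> \<rho> \<longrightarrow>
    norm ((G x - x - (1/2) *\<^sub>R B x x) - (G y - y - (1/2) *\<^sub>R B y y)) \<le> \<epsilon> * max (norm x) (norm y) * norm (x - y)"
    if "0 < \<epsilon>" for \<epsilon>
    by (rule second_order_remainder[OF r derG G'0 derG' B Bsym that])
  have "G 0 = 0" by (simp add: G_def A.zero)
  obtain u \<rho>0 where u: "0 < \<rho>0" "u 0 = 0"
    "\<And>x i. frame_proj n \<tau> x = x \<Longrightarrow> norm x \<le> \<rho>0 \<Longrightarrow> i < n \<Longrightarrow> u x \<bullet> \<tau> i = 0"
    "\<And>x. frame_proj n \<tau> x = x \<Longrightarrow> norm x \<le> \<rho>0 \<Longrightarrow> \<exists>y. frame_proj n \<tau> y = y \<and> norm y \<le> 2 * norm x \<and> G y = x + u x"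
    "\<And>\<epsilon>. 0 < \<epsilon> \<Longrightarrow> \<exists>\<rho>>0. \<forall>x y. frame_proj n \<tau> x = x \<and> frame_proj n \<tau> y = y \<and> norm x \<le> \<rho> \<and> norm y \<le> \<rho> \<longrightarrow>
      norm ((u x - (1/2) *\<^sub>R (B x x - frame_proj n \<tau> (B x x))) - (u y - (1/2) *\<^sub>R (B y y - frame_proj n \<tau> (B y y)))) \<le> \<epsilon> * max (norm x) (norm y) * norm (x - y)"
    by (rule graph_of_map[OF \<tau>(1) \<open>G 0 = 0\<close> B Bsym rem]) (assumption | rule that)+
  show thesis
  proof (rule that[of \<tau> B \<rho>0 u])
    show "B (d\<psi> z a) (d\<psi> z b) = dd\<psi> z a b" for a b by (simp add: B_def d_inverse[OF z])
    show "\<exists>y\<in>L. norm (d\<psi> z y) \<le> 2 * norm x \<and> \<psi> (z + y) = \<psi> z + x + u x"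
      if xT: "x \<in> tangent z" and x\<rho>: "norm x \<le> \<rho>0" for x
    proof -
      obtain y where y: "frame_proj n \<tau> y = y" "norm y \<le> 2 * norm x" "G y = x + u x"
        using u(4)[OF \<tau>(2)[THEN iffD2, OF xT] x\<rho>] by (elim exE conjE)
      have "d\<phi> z y \<in> L" using \<tau>(2)[THEN iffD1, OF y(1)] tangent_iff[OF z, of y] by simp
      moreover have "\<psi> (z + d\<phi> z y) = \<psi> z + x + u x" using y(3) by (simp add: G_def algebra_simps)
      ultimately show ?thesis using y(2) d_inverse(2)[OF z] by (intro bexI[of _ "d\<phi> z y"]) auto
    qed
    show "u x \<bullet> \<tau> i = 0" if "x \<in> tangent z" "norm x \<le> \<rho>0" "i < n" for x i
      by (rule u(3)[OF \<tau>(2)[THEN iffD2, OF that(1)] that(2,3)])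
  qed (fact \<tau> u B Bsym | rule u(5), assumption)+
qed

end

section \<open>Tangency of second derivatives and tangent spaces in a chart\<close>

context slice_chart
begin

text \<open>The normal part \<open>N\<close> of the second derivative is the second fundamental form
  in these coordinates. It vanishes on the frame by \<open>second_order_vanishes\<close>, hence on
  the tangent space by bilinearity, which leaves only the tangential part.\<close>

lemma dd\<psi>_tangent_interior:
  assumes ent: "entropy n \<Sigma> = 1" and z: "z \<in> V" and "0 < \<delta>"
    and \<Sigma>: "\<And>y. y \<in> L \<Longrightarrow> norm y < \<delta> \<Longrightarrow> \<psi> (z + y) \<in> \<Sigma>" and ab: "a \<in> L" "b \<in> L"
  shows "dd\<psi> z a b \<in> tangent z"
proof -
  obtain \<tau> B u \<rho>0 where \<tau>: "orthonormal n \<tau>" "\<And>x. frame_proj n \<tau> x = x \<longleftrightarrow> x \<in> tangent z"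
    and B: "bounded_bilinear B" "\<And>x y. B x y = B y x" "\<And>a b. B (d\<psi> z a) (d\<psi> z b) = dd\<psi> z a b"
    and u: "0 < \<rho>0" "u 0 = 0" "\<And>x i. x \<in> tangent z \<Longrightarrow> norm x \<le> \<rho>0 \<Longrightarrow> i < n \<Longrightarrow> u x \<bullet> \<tau> i = 0"
    "\<And>x. x \<in> tangent z \<Longrightarrow> norm x \<le> \<rho>0 \<Longrightarrow> \<exists>y\<in>L. norm (d\<psi> z y) \<le> 2 * norm x \<and> \<psi> (z + y) = \<psi> z + x + u x"
    and rem: "\<And>\<epsilon>. 0 < \<epsilon> \<Longrightarrow> \<exists>\<rho>>0. \<forall>x y. frame_proj n \<tau> x = x \<and> frame_proj n \<tau> y = y \<and> norm x \<le> \<rho> \<and> norm y \<le> \<rho> \<longrightarrow>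
      norm ((u x - (1/2) *\<^sub>R (B x x - frame_proj n \<tau> (B x x))) - (u y - (1/2) *\<^sub>R (B y y - frame_proj n \<tau> (B y y)))) \<le> \<epsilon> * max (norm x) (norm y) * norm (x - y)"
    by (rule chart_graph[OF z]) (rule that)
  define N where "N x y = B x y - frame_proj n \<tau> (B x y)" for x y
  interpret P: bounded_linear "frame_proj n \<tau>" by (rule bounded_linear_frame_proj)
  interpret B: bounded_bilinear B by (rule B(1))
  have lin: "linear (\<lambda>v. v - frame_proj n \<tau> v)"
    by (rule linearI) (simp_all add: P.add P.scaleR scaleR_right_diff_distrib)
  have "linear (N x)" for x
    using linear_compose[OF bounded_linear.linear[OF B.bounded_linear_right[of x]] lin] by (simp add: o_def N_def[abs_def])
  moreover have "linear (\<lambda>x. N x y)" for y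
    using linear_compose[OF bounded_linear.linear[OF B.bounded_linear_left[of y]] lin] by (simp add: o_def N_def[abs_def])
  ultimately have "bilinear N" unfolding bilinear_def by simp
  then have N: "bounded_bilinear N" using bilinear_conv_bounded_bilinear by blast
  then obtain K where K: "\<And>x y. norm (N x y) \<le> norm x * norm y * K" using bounded_bilinear.bounded by blast
  interpret g: graph_expansion n \<tau> N "max 1 K"
  proof (rule graph_expansion.intro)
    show "N x y = N y x" for x y unfolding N_def B(2)[of x y] ..
    show "N x y \<bullet> \<tau> i = 0" if "i < n" for i x y
      unfolding N_def by (rule norm_frame_proj_decomp(2)[OF \<tau>(1) that])
    show "norm (N x y) \<le> max 1 K * norm x * norm y" for x y
    proof -
      have "norm x * norm y * K \<le> norm x * norm y * max 1 K" by (intro mult_left_mono) auto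
      then show ?thesis using K[of x y] by (simp only: mult_ac)
    qed
  qed (fact \<tau>(1) N | simp)+
  obtain K2 where K2: "0 < K2" "\<And>y. norm (d\<phi> z y) \<le> norm y * K2"
    using bounded_linear.pos_bounded[OF linear_d(2)[OF z]] by blast
  \<comment> \<open>The chart parameter of the point over \<open>x\<close> has norm at most
    \<open>2 * K2 * norm x\<close>; this choice keeps it at \<open>\<delta> / 2\<close>.\<close>
  define \<rho> where "\<rho> = min \<rho>0 (\<delta> / (4 * K2))"
  have \<rho>: "0 < \<rho>" "\<rho> \<le> \<rho>0" "4 * K2 * \<rho> \<le> \<delta>"
  proof -
    show "0 < \<rho>" "\<rho> \<le> \<rho>0" using u(1) K2 \<open>0 < \<delta>\<close> by (auto simp: \<rho>_def)
    have "\<rho> \<le> \<delta> / (4 * K2)" by (simp add: \<rho>_def)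
    then show "4 * K2 * \<rho> \<le> \<delta>" using K2 by (simp add: field_simps)
  qed
  have zero: "N (\<tau> i) (\<tau> j) = 0" if "i < n" "j < n" for i j
  proof (rule g.second_order_vanishes[where u = u and p = "\<psi> z", OF ent \<rho>(1)])
    show "u x \<bullet> \<tau> i = 0" if "frame_proj n \<tau> x = x" "norm x \<le> \<rho>" "i < n" for x i
      using u(3)[OF \<tau>(2)[THEN iffD1, OF that(1)] _ that(3)] that(2) \<rho>(2) by linarith
    show "\<psi> z + x + u x \<in> \<Sigma>" if "frame_proj n \<tau> x = x" "norm x \<le> \<rho>" for x
    proof -
      have "norm x \<le> \<rho>0" using that(2) \<rho>(2) by linarith
      from u(4)[OF \<tau>(2)[THEN iffD1, OF that(1)] this]
      obtain y where y: "y \<in> L" "norm (d\<psi> z y) \<le> 2 * norm x" "\<psi> (z + y) = \<psi> z + x + u x" by blast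
      have "norm y \<le> norm (d\<psi> z y) * K2" using K2(2)[of "d\<psi> z y"] by (simp add: d_inverse(1)[OF z])
      also have "\<dots> \<le> (2 * \<rho>) * K2" using y(2) that(2) K2(1) by (intro mult_right_mono) auto
      also have "\<dots> < \<delta>" using \<rho>(3) \<open>0 < \<delta>\<close> by (simp add: mult_ac)
      finally show ?thesis using \<Sigma>[OF y(1)] y(3) by simp
    qed
    show "\<exists>\<rho>>0. g.remainder_bound u \<epsilon> \<rho>" if "0 < \<epsilon>" for \<epsilon>
      using rem[OF that] unfolding g.remainder_bound_def N_def .
  qed (fact u(2) that)+
  have zero1: "N (\<tau> j) (lincomb n \<tau> f) = 0" if "j < n" for j f
    unfolding g.B_lincomb using zero that by simp
  have zero2: "N (lincomb n \<tau> f) (lincomb n \<tau> h) = 0" for f h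
    unfolding g.B_lincomb[of _ h] using zero1 by (simp add: g.sym[of "lincomb n \<tau> f"])
  have "d\<psi> z a \<in> tangent z" "d\<psi> z b \<in> tangent z" using ab by (auto simp: tangent_def)
  then have "frame_proj n \<tau> (d\<psi> z a) = d\<psi> z a" "frame_proj n \<tau> (d\<psi> z b) = d\<psi> z b" using \<tau>(2) by simp_all
  then have "N (d\<psi> z a) (d\<psi> z b) = 0"
    using zero2[of "\<lambda>i. d\<psi> z a \<bullet> \<tau> i" "\<lambda>i. d\<psi> z b \<bullet> \<tau> i"] by (simp only: frame_proj_def)
  then have "frame_proj n \<tau> (dd\<psi> z a b) = dd\<psi> z a b" by (simp add: N_def B(3))
  then show ?thesis using \<tau>(2) by simp
qed

text \<open>Tangent spaces vary with the point, but \<open>tangential_coeff\<close> is continuous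
  and must lie in the fixed closed space \<open>L\<close>, a condition that passes to limits. In a
  half-space chart \<open>e\<close> points inwards.\<close>

lemma dd\<psi>_tangent_closed:
  assumes z: "z \<in> V" and "0 < \<delta>"
    and *: "\<And>s. 0 < s \<Longrightarrow> s < \<delta> \<Longrightarrow> z + s *\<^sub>R e \<in> V \<and> dd\<psi> (z + s *\<^sub>R e) a b \<in> tangent (z + s *\<^sub>R e)"
  shows "dd\<psi> z a b \<in> tangent z"
proof -
  have lim: "((\<lambda>s. z + s *\<^sub>R e) \<longlongrightarrow> z) (at_right 0)"
  proof -
    have "((\<lambda>s. z + s *\<^sub>R e) \<longlongrightarrow> z + 0 *\<^sub>R e) (at_right 0)" by (intro tendsto_intros)
    then show ?thesis by simp
  qed
  have "isCont (\<lambda>z. tangential_coeff z a b) z"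
    using continuous_tangential_coeff opens(2) z continuous_on_eq_continuous_at by blast
  then have lim2: "((\<lambda>s. tangential_coeff (z + s *\<^sub>R e) a b) \<longlongrightarrow> tangential_coeff z a b) (at_right 0)"
    using lim by (rule isCont_tendsto_compose)
  have ev: "\<forall>\<^sub>F s in at_right 0. tangential_coeff (z + s *\<^sub>R e) a b \<in> L"
    unfolding eventually_at_right_field tangential_coeff_def using \<open>0 < \<delta>\<close> * tangent_iff by blast
  have "tangential_coeff z a b \<in> L"
    by (rule Lim_in_closed_set[OF closed_subspace[OF L(1)] ev _ lim2]) simp
  then show ?thesis using tangent_iff[OF z] by (simp add: tangential_coeff_def)
qed

text \<open>In the chart a curve in \<Sigma> has increments in \<open>L\<close>, so its velocity is
  in \<open>L\<close>. Conversely straight lines in the chart realize every vector. With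
  \<open>e = 0\<close> the half-space is all of \<open>L\<close>, which covers interior
  points.\<close>

lemma tangent_space_eq:
  assumes slice: "\<phi> ` (U \<inter> \<Sigma>) = V \<inter> {y \<in> L. 0 \<le> e \<bullet> y}" and z: "z \<in> V" "z \<in> L" "0 \<le> e \<bullet> z"
  shows "tangent_space \<Sigma> (\<psi> z) = tangent z"
proof
  have \<Sigma>I: "\<psi> y \<in> \<Sigma>" if "y \<in> V" "y \<in> L" "0 \<le> e \<bullet> y" for y
  proof -
    have "y \<in> \<phi> ` (U \<inter> \<Sigma>)" using that slice by blast
    then show ?thesis using inv(4) by auto
  qed
  have \<Sigma>D: "\<phi> x \<in> L" if "x \<in> U" "x \<in> \<Sigma>" for x using that slice by blast
  show "tangent_space \<Sigma> (\<psi> z) \<subseteq> tangent z"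
  proof
    fix v assume "v \<in> tangent_space \<Sigma> (\<psi> z)"
    then obtain \<epsilon> and \<gamma> :: "real \<Rightarrow> 'a" where \<gamma>: "0 < \<epsilon>" "\<gamma> 0 = \<psi> z" "(\<gamma> has_vector_derivative v) (at 0)"
      "\<gamma> ` {0..<\<epsilon>} \<subseteq> \<Sigma> \<or> \<gamma> ` {-\<epsilon><..0} \<subseteq> \<Sigma>" by (auto simp: tangent_space_def)
    have "isCont \<gamma> 0" using \<gamma>(3) has_vector_derivative_continuous by blast
    then have "\<forall>\<^sub>F s in nhds 0. \<gamma> s \<in> U"
      using opens(1) inv(1)[OF z(1)] \<gamma>(2) unfolding continuous_at tendsto_def
      by (auto simp: eventually_at_filter elim!: eventually_mono)
    then obtain d where d: "0 < d" "\<And>s. \<bar>s\<bar> < d \<Longrightarrow> \<gamma> s \<in> U"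
      unfolding eventually_nhds_metric by (auto simp: dist_real_def)
    have "((\<lambda>s. \<phi> (\<gamma> s)) has_vector_derivative d\<phi> z v) (at 0)"
    proof -
      have "(\<gamma> has_derivative (\<lambda>h. h *\<^sub>R v)) (at 0)" using \<gamma>(3) by (simp add: has_vector_derivative_def)
      moreover have "(\<phi> has_derivative d\<phi> z) (at (\<gamma> 0))" using has_derivative_\<phi>[OF z(1)] \<gamma>(2) by simp
      ultimately have "((\<lambda>s. \<phi> (\<gamma> s)) has_derivative (\<lambda>h. d\<phi> z (h *\<^sub>R v))) (at 0)" by (rule has_derivative_compose)
      then show ?thesis by (simp add: has_vector_derivative_def linear_simps(5)[OF linear_d(2)[OF z(1)]])
    qed
    then have "d\<phi> z v \<in> L"
    proof (rule one_sided_derivative_in_subspace[OF _ L(1)])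
      show "0 < min \<epsilon> d" using \<gamma>(1) d by simp
      have "\<phi> (\<gamma> s) - \<phi> (\<gamma> 0) \<in> L" if "\<bar>s\<bar> < d" "\<gamma> s \<in> \<Sigma>" for s
        using \<Sigma>D[OF d(2)[OF that(1)] that(2)] z inv(2)[OF z(1)] \<gamma>(2) subspace_diff[OF L(1)] by simp
      then show "(\<forall>s. 0 < s \<and> s < min \<epsilon> d \<longrightarrow> \<phi> (\<gamma> s) - \<phi> (\<gamma> 0) \<in> L) \<or>
          (\<forall>s. - min \<epsilon> d < s \<and> s < 0 \<longrightarrow> \<phi> (\<gamma> s) - \<phi> (\<gamma> 0) \<in> L)"
        using \<gamma>(4) by (auto simp: image_subset_iff)
    qed
    then show "v \<in> tangent z" using tangent_iff[OF z(1)] by simp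
  qed
  show "tangent z \<subseteq> tangent_space \<Sigma> (\<psi> z)"
  proof
    fix v assume "v \<in> tangent z"
    then obtain b where b: "b \<in> L" "v = d\<psi> z b" by (auto simp: tangent_def)
    obtain r where r: "0 < r" "ball z r \<subseteq> V" using opens(2) z(1) open_contains_ball by blast
    define \<epsilon> where "\<epsilon> = r / (norm b + 1)"
    have \<epsilon>: "0 < \<epsilon>" using r by (simp add: \<epsilon>_def add_nonneg_pos)
    have inV: "z + s *\<^sub>R b \<in> V" if "s \<in> {-\<epsilon><..<\<epsilon>}" for s
    proof -
      have "\<bar>s\<bar> * norm b \<le> \<bar>s\<bar> * (norm b + 1)" by (intro mult_left_mono) auto
      also have "\<dots> < \<epsilon> * (norm b + 1)" using that by (intro mult_strict_right_mono) (auto simp: add_nonneg_pos)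
      also have "\<dots> = r" by (simp add: \<epsilon>_def add_nonneg_eq_0_iff)
      finally show ?thesis using r by (auto simp: dist_norm)
    qed
    have "((\<lambda>s. \<psi> (z + s *\<^sub>R b)) has_vector_derivative v) (at 0)"
    proof -
      have "((\<lambda>s. z + s *\<^sub>R b) has_derivative (\<lambda>h. h *\<^sub>R b)) (at 0)" by (auto intro!: derivative_eq_intros)
      moreover have "(\<psi> has_derivative d\<psi> z) (at (z + 0 *\<^sub>R b))" using has_derivative_\<psi>[OF z(1)] by simp
      ultimately have "((\<lambda>s. \<psi> (z + s *\<^sub>R b)) has_derivative (\<lambda>h. d\<psi> z (h *\<^sub>R b))) (at 0)" by (rule has_derivative_compose)
      then show ?thesis by (simp add: has_vector_derivative_def linear_simps(5)[OF linear_d(1)[OF z(1)]] b(2))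
    qed
    moreover have "smooth_on (\<lambda>s. \<psi> (z + s *\<^sub>R b)) {-\<epsilon><..<\<epsilon>}"
      by (rule smooth_on_affine[OF smooth(2) _ inV]) auto
    moreover have "(\<lambda>s. \<psi> (z + s *\<^sub>R b)) ` {0..<\<epsilon>} \<subseteq> \<Sigma> \<or> (\<lambda>s. \<psi> (z + s *\<^sub>R b)) ` {-\<epsilon><..0} \<subseteq> \<Sigma>"
    \<comment> \<open>Inward directions stay in the half-space for positive times, outward ones for
      negative times.\<close>
    proof (cases "0 \<le> e \<bullet> b")
      case True
      have "\<psi> (z + s *\<^sub>R b) \<in> \<Sigma>" if "s \<in> {0..<\<epsilon>}" for s
        using that True z b \<epsilon> L(1) by (intro \<Sigma>I inV) (auto simp: inner_add_right subspace_add subspace_scale)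
      then show ?thesis by blast
    next
      case False
      have "\<psi> (z + s *\<^sub>R b) \<in> \<Sigma>" if "s \<in> {-\<epsilon><..0}" for s
        using that False z b \<epsilon> L(1)
        by (intro \<Sigma>I inV) (auto simp: inner_add_right subspace_add subspace_scale mult_nonpos_nonpos)
      then show ?thesis by blast
    qed
    ultimately show "v \<in> tangent_space \<Sigma> (\<psi> z)"
      unfolding tangent_space_def using \<epsilon>
      by (intro CollectI exI[of _ \<epsilon>] conjI exI[of _ "\<lambda>s. \<psi> (z + s *\<^sub>R b)"]) auto
  qed
qed

end

text \<open>Gronwall's argument: the sum \<open>g\<close> of the squares satisfies
  \<open>g' \<le> k * g\<close> with \<open>k = 2 * n * C\<close>, so
  \<open>exp (- k * s) * g s\<close> does not increase from its initial value 0.\<close>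

lemma linear_ode_zero:
  fixes f :: "nat \<Rightarrow> real \<Rightarrow> real"
  assumes der: "\<And>i s. i < n \<Longrightarrow> 0 \<le> s \<Longrightarrow> s \<le> 1 \<Longrightarrow> (f i has_real_derivative (\<Sum>j<n. c i j s * f j s)) (at s)"
    and c: "\<And>i j s. i < n \<Longrightarrow> j < n \<Longrightarrow> 0 \<le> s \<Longrightarrow> s \<le> 1 \<Longrightarrow> \<bar>c i j s\<bar> \<le> C"
    and zero: "\<And>i. i < n \<Longrightarrow> f i 0 = 0" and i: "i < n"
  shows "f i 1 = 0"
proof -
  define g where "g s = (\<Sum>i<n. (f i s)\<^sup>2)" for s
  define g' where "g' s = (\<Sum>i<n. 2 * f i s * (\<Sum>j<n. c i j s * f j s))" for s
  define k where "k = 2 * real n * C"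
  have dg: "(g has_real_derivative g' s) (at s)" if "0 \<le> s" "s \<le> 1" for s
    unfolding g_def[abs_def] g'_def
    by (intro DERIV_sum) (auto intro!: derivative_eq_intros der that)
  have g'_le: "g' s \<le> k * g s" if s: "0 \<le> s" "s \<le> 1" for s
  proof -
    have "g' s = (\<Sum>i<n. \<Sum>j<n. c i j s * (2 * f i s * f j s))"
      unfolding g'_def by (simp add: sum_distrib_left mult_ac)
    also have "\<dots> \<le> (\<Sum>i<n. \<Sum>j<n. C * ((f i s)\<^sup>2 + (f j s)\<^sup>2))"
    proof (intro sum_mono)
      fix i j assume "i \<in> {..<n}" "j \<in> {..<n}"
      then have cC: "\<bar>c i j s\<bar> \<le> C" using c s by simp
      have "\<bar>2 * f i s * f j s\<bar> \<le> (f i s)\<^sup>2 + (f j s)\<^sup>2"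
        using zero_le_power2[of "f i s + f j s"] zero_le_power2[of "f i s - f j s"]
        by (simp add: abs_le_iff power2_eq_square algebra_simps)
      then have "\<bar>c i j s\<bar> * \<bar>2 * f i s * f j s\<bar> \<le> C * ((f i s)\<^sup>2 + (f j s)\<^sup>2)"
        using cC by (intro mult_mono) auto
      then show "c i j s * (2 * f i s * f j s) \<le> C * ((f i s)\<^sup>2 + (f j s)\<^sup>2)"
        by (metis abs_le_D1 abs_mult)
    qed
    also have "\<dots> = k * g s"
      by (simp add: sum_distrib_left[symmetric] sum.distrib g_def k_def algebra_simps)
    finally show ?thesis .
  qed
  have "exp (- k * 1) * g 1 \<le> exp (- k * 0) * g 0"
  proof (rule DERIV_nonpos_imp_nonincreasing[of 0 1 "\<lambda>s. exp (- k * s) * g s"])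
    fix s :: real assume s: "0 \<le> s" "s \<le> 1"
    have "((\<lambda>s. exp (- k * s) * g s) has_real_derivative exp (- k * s) * (g' s - k * g s)) (at s)"
      by (auto intro!: derivative_eq_intros dg s simp: algebra_simps)
    moreover have "exp (- k * s) * (g' s - k * g s) \<le> 0"
      using g'_le[OF s] by (intro mult_nonneg_nonpos) auto
    ultimately show "\<exists>y. ((\<lambda>s. exp (- k * s) * g s) has_real_derivative y) (at s) \<and> y \<le> 0" by blast
  qed simp
  moreover have "g 0 = 0" by (simp add: g_def zero)
  ultimately have "exp (- k) * g 1 \<le> 0" by simp
  then have "g 1 \<le> 0" by (simp add: mult_le_0_iff)
  moreover have "(f i 1)\<^sup>2 \<le> g 1" unfolding g_def using i by (intro member_le_sum) auto
  ultimately show ?thesis by (metis order_trans power2_less_eq_zero_iff)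
qed

section \<open>Constancy of the tangent planes in a flat chart\<close>

context slice_chart
begin

text \<open>For \<open>w\<close> normal to the tangent space at \<open>z0\<close>, the numbers
  \<open>w \<bullet> d\<psi> (p s) (\<beta> i)\<close> along the segment solve a homogeneous linear
  system, since tangency expresses the second derivatives through the first ones. They start at 0,
  so \<open>w\<close> is normal to the tangent space at \<open>z\<close> as well; equal dimensions
  turn the inclusion into equality.\<close>

lemma tangent_constant:
  assumes D: "convex D" "D \<subseteq> V" "D \<subseteq> L" and z: "z0 \<in> D" "z \<in> D"
    and tan: "\<And>x a b. x \<in> D \<Longrightarrow> a \<in> L \<Longrightarrow> b \<in> L \<Longrightarrow> dd\<psi> x a b \<in> tangent x"
  shows "tangent z = tangent z0"
proof -
  define a where "a = z - z0"
  define p where "p s = z0 + s *\<^sub>R a" for s :: real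
  have aL: "a \<in> L" using z D(3) subspace_diff[OF L(1)] by (auto simp: a_def)
  have pD: "p s \<in> D" if "0 \<le> s" "s \<le> 1" for s
  proof -
    have "(1 - s) *\<^sub>R z0 + s *\<^sub>R z \<in> D" using D(1) z that unfolding convex_alt by blast
    also have "(1 - s) *\<^sub>R z0 + s *\<^sub>R z = p s" by (simp add: p_def a_def algebra_simps)
    finally show ?thesis .
  qed
  have p01: "p 0 = z0" "p 1 = z" by (simp_all add: p_def a_def)
  have dp: "(p has_derivative (\<lambda>h. h *\<^sub>R a)) (at s)" for s
    unfolding p_def[abs_def] by (auto intro!: derivative_eq_intros)
  obtain \<beta> where \<beta>: "orthonormal n \<beta>" "\<And>x. frame_proj n \<beta> x = x \<longleftrightarrow> x \<in> L" "\<And>i. i < n \<Longrightarrow> \<beta> i \<in> L"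
    by (rule obtain_frame[OF L]) (rule that)
  have expand: "x = (\<Sum>j<n. (x \<bullet> \<beta> j) *\<^sub>R \<beta> j)" if "x \<in> L" for x
    using \<beta>(2)[THEN iffD2, OF that] by (simp add: frame_proj_def lincomb_def)
  have zV: "z \<in> V" "z0 \<in> V" using z D(2) by auto
  define c where "c i j s = tangential_coeff (p s) a (\<beta> i) \<bullet> \<beta> j" for i j s
  have "\<exists>C. \<forall>i<n. \<forall>j<n. \<forall>s. 0 \<le> s \<and> s \<le> 1 \<longrightarrow> \<bar>c i j s\<bar> \<le> C"
  proof -
    have cont: "continuous_on {0..1} (\<lambda>s. \<Sum>i<n. \<Sum>j<n. \<bar>c i j s\<bar>)"
      unfolding c_def
    proof (intro continuous_intros)
      fix i
      show "continuous_on {0..1} (\<lambda>s. tangential_coeff (p s) a (\<beta> i))"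
        by (rule continuous_on_compose2[OF continuous_tangential_coeff])
           (use pD D(2) in \<open>auto simp: p_def intro!: continuous_intros\<close>)
    qed
    have "compact {0..1::real}" by simp
    from compact_imp_bounded[OF compact_continuous_image[OF cont this]]
    obtain C where "\<forall>s\<in>{0..1}. \<bar>\<Sum>i<n. \<Sum>j<n. \<bar>c i j s\<bar>\<bar> \<le> C"
      unfolding bounded_iff by auto
    then have C: "\<bar>\<Sum>i<n. \<Sum>j<n. \<bar>c i j s\<bar>\<bar> \<le> C" if "0 \<le> s" "s \<le> 1" for s
      using that by simp
    have "\<bar>c i j s\<bar> \<le> C" if "i < n" "j < n" "0 \<le> s" "s \<le> 1" for i j s
    proof -
      have "\<bar>c i j s\<bar> \<le> (\<Sum>j<n. \<bar>c i j s\<bar>)" using that by (intro member_le_sum) auto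
      also have "\<dots> \<le> (\<Sum>i<n. \<Sum>j<n. \<bar>c i j s\<bar>)" using that by (intro member_le_sum) (auto intro: sum_nonneg)
      also have "\<dots> \<le> C" using C[OF that(3,4)] by linarith
      finally show ?thesis .
    qed
    then show ?thesis by blast
  qed
  then obtain C where C: "\<And>i j s. i < n \<Longrightarrow> j < n \<Longrightarrow> 0 \<le> s \<Longrightarrow> s \<le> 1 \<Longrightarrow> \<bar>c i j s\<bar> \<le> C" by blast
  have ortho: "w \<bullet> v = 0" if w: "\<And>v. v \<in> tangent z0 \<Longrightarrow> w \<bullet> v = 0" and v: "v \<in> tangent z" for w v
  proof -
    define f where "f i s = w \<bullet> d\<psi> (p s) (\<beta> i)" for i s
    have der: "(f i has_real_derivative (\<Sum>j<n. c i j s * f j s)) (at s)" if i: "i < n" and s: "0 \<le> s" "s \<le> 1" for i s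
    proof -
      have sV: "p s \<in> V" using pD[OF s] D(2) by blast
      interpret l: bounded_linear "d\<psi> (p s)" by (rule linear_d(1)[OF sV])
      have "((\<lambda>s. d\<psi> (p s) (\<beta> i)) has_derivative (\<lambda>h. dd\<psi> (p s) (h *\<^sub>R a) (\<beta> i))) (at s)"
        by (rule has_derivative_compose[OF dp has_derivative_d\<psi>[OF sV]])
      then have "(f i has_derivative (\<lambda>h. w \<bullet> dd\<psi> (p s) (h *\<^sub>R a) (\<beta> i))) (at s)"
        unfolding f_def[abs_def] by (rule has_derivative_inner_right)
      moreover have "(\<lambda>h. w \<bullet> dd\<psi> (p s) (h *\<^sub>R a) (\<beta> i)) = (*) (\<Sum>j<n. c i j s * f j s)"
      proof -
        have "tangential_coeff (p s) a (\<beta> i) \<in> L"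
          unfolding tangential_coeff_def using tan[OF pD[OF s] aL \<beta>(3)[OF i]] tangent_iff[OF sV] by blast
        from expand[OF this] have e: "tangential_coeff (p s) a (\<beta> i) = (\<Sum>j<n. c i j s *\<^sub>R \<beta> j)" by (simp only: c_def)
        have "dd\<psi> (p s) a (\<beta> i) = d\<psi> (p s) (tangential_coeff (p s) a (\<beta> i))"
          unfolding tangential_coeff_def by (rule d_inverse(2)[OF sV, symmetric])
        also have "\<dots> = (\<Sum>j<n. c i j s *\<^sub>R d\<psi> (p s) (\<beta> j))" unfolding e by (simp only: l.sum l.scaleR)
        finally have "w \<bullet> dd\<psi> (p s) a (\<beta> i) = (\<Sum>j<n. c i j s * f j s)" by (simp add: inner_sum_right f_def)
        then show ?thesis using linear_scale[OF dd\<psi>_linear(1)[OF sV], of _ a "\<beta> i"] by (simp add: fun_eq_iff mult.commute)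
      qed
      ultimately show ?thesis by (simp add: has_field_derivative_def)
    qed
    have f1: "f i 1 = 0" if "i < n" for i
    proof (rule linear_ode_zero[OF der C _ that])
      show "f i 0 = 0" if "i < n" for i
        unfolding f_def p01 by (rule w) (use \<beta>(3)[OF that] in \<open>simp add: tangent_def\<close>)
    qed
    obtain l where l: "l \<in> L" "v = d\<psi> z l" using v by (auto simp: tangent_def)
    interpret dl: bounded_linear "d\<psi> z" by (rule linear_d(1)[OF zV(1)])
    have "v = (\<Sum>j<n. (l \<bullet> \<beta> j) *\<^sub>R d\<psi> z (\<beta> j))"
      unfolding l(2) by (subst expand[OF l(1)]) (simp only: dl.sum dl.scaleR)
    then show ?thesis using f1 by (simp add: inner_sum_right f_def p01)
  qed
  have "tangent z \<subseteq> tangent z0"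
  proof
    fix v assume v: "v \<in> tangent z"
    obtain t w where tw: "t \<in> span (tangent z0)" "\<And>x. x \<in> span (tangent z0) \<Longrightarrow> orthogonal w x" "v = t + w"
      using orthogonal_subspace_decomp_exists[of "tangent z0" v] by metis
    have sp: "span (tangent z0) = tangent z0" using tangent(1)[OF zV(2)] by (rule span_eq_iff[THEN iffD2])
    have w0: "w \<bullet> x = 0" if "x \<in> tangent z0" for x using tw(2) that sp by (simp add: orthogonal_def)
    have "w \<bullet> v = 0" by (rule ortho[OF w0 v])
    then have "w = 0" using w0[of t] tw sp by (simp add: inner_add_right)
    then show "v \<in> tangent z0" using tw sp by simp
  qed
  then show ?thesis
    using tangent[OF zV(1)] tangent[OF zV(2)] subspace_dim_equal by (metis order_refl)
qed

text \<open>Along the segment the velocity of \<psi> stays in the constant tangent space. Hence its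
  inner product with the normal part \<open>w\<close> of \<open>\<psi> z - \<psi> z0\<close> does
  not change, which forces \<open>w = 0\<close>.\<close>

lemma chart_in_plane:
  assumes D: "convex D" "D \<subseteq> V" "D \<subseteq> L" and z: "z0 \<in> D" "z \<in> D"
    and tan: "\<And>x a b. x \<in> D \<Longrightarrow> a \<in> L \<Longrightarrow> b \<in> L \<Longrightarrow> dd\<psi> x a b \<in> tangent x"
  shows "\<psi> z - \<psi> z0 \<in> tangent z0"
proof -
  define a where "a = z - z0"
  define p where "p s = z0 + s *\<^sub>R a" for s :: real
  have aL: "a \<in> L" using z D(3) subspace_diff[OF L(1)] by (auto simp: a_def)
  have pD: "p s \<in> D" if "0 \<le> s" "s \<le> 1" for s
  proof -
    have "(1 - s) *\<^sub>R z0 + s *\<^sub>R z \<in> D" using D(1) z that unfolding convex_alt by blast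
    also have "(1 - s) *\<^sub>R z0 + s *\<^sub>R z = p s" by (simp add: p_def a_def algebra_simps)
    finally show ?thesis .
  qed
  have p01: "p 0 = z0" "p 1 = z" by (simp_all add: p_def a_def)
  have dp: "(p has_derivative (\<lambda>h. h *\<^sub>R a)) (at s)" for s
    unfolding p_def[abs_def] by (auto intro!: derivative_eq_intros)
  have z0V: "z0 \<in> V" using z D(2) by auto
  have sp: "span (tangent z0) = tangent z0" using tangent(1)[OF z0V] by (rule span_eq_iff[THEN iffD2])
  obtain t w where tw: "t \<in> span (tangent z0)" "\<And>x. x \<in> span (tangent z0) \<Longrightarrow> orthogonal w x" "\<psi> z - \<psi> z0 = t + w"
    using orthogonal_subspace_decomp_exists[of "tangent z0" "\<psi> z - \<psi> z0"] by metis
  have w0: "w \<bullet> x = 0" if "x \<in> tangent z0" for x using tw(2) that sp by (simp add: orthogonal_def)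
  have der: "((\<lambda>s. w \<bullet> \<psi> (p s)) has_real_derivative 0) (at s)" if s: "0 \<le> s" "s \<le> 1" for s
  proof -
    have sV: "p s \<in> V" using pD[OF s] D(2) by blast
    have "((\<lambda>s. \<psi> (p s)) has_derivative (\<lambda>h. d\<psi> (p s) (h *\<^sub>R a))) (at s)"
      by (rule has_derivative_compose[OF dp has_derivative_\<psi>[OF sV]])
    then have "((\<lambda>s. w \<bullet> \<psi> (p s)) has_derivative (\<lambda>h. w \<bullet> d\<psi> (p s) (h *\<^sub>R a))) (at s)"
      by (rule has_derivative_inner_right)
    moreover have "w \<bullet> d\<psi> (p s) (h *\<^sub>R a) = 0" for h
    proof -
      have "d\<psi> (p s) (h *\<^sub>R a) \<in> tangent (p s)" using aL subspace_scale[OF L(1)] by (auto simp: tangent_def)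
      then have "d\<psi> (p s) (h *\<^sub>R a) \<in> tangent z0" using tangent_constant[OF D z(1) pD[OF s] tan] by simp
      then show ?thesis using w0 by simp
    qed
    moreover have "(\<lambda>h. 0) = (*) (0::real)" by auto
    ultimately show ?thesis unfolding has_field_derivative_def by simp
  qed
  obtain x where "w \<bullet> \<psi> (p 1) - w \<bullet> \<psi> (p 0) = (1 - 0) * 0"
    using MVT2[of 0 1 "\<lambda>s. w \<bullet> \<psi> (p s)" "\<lambda>_. 0"] der by auto
  then have "w \<bullet> (t + w) = 0" by (simp add: p01 tw(3)[symmetric] inner_diff_right)
  then have "w = 0" using w0[of t] tw sp by (simp add: inner_add_right)
  then show ?thesis using tw sp by simp
qed

end

subsection \<open>Planarity\<close>

text \<open>Setting \<open>e = 0\<close> presents a full slice as a degenerate half-space, so both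
  kinds of points are handled by one argument. An interior chart is preferred whenever there is
  one.\<close>

lemma submanifold_chart:
  fixes \<Sigma> :: "'a::euclidean_space set"
  assumes "submanifold n \<Sigma>" "p \<in> \<Sigma>"
  obtains U V \<phi> \<psi> L e where "slice_chart U V \<phi> \<psi> L n" "p \<in> U" "e \<in> L"
    "\<phi> ` (U \<inter> \<Sigma>) = V \<inter> {y \<in> L. 0 \<le> e \<bullet> y}" "interior_point n \<Sigma> p \<Longrightarrow> e = 0"
proof (cases "interior_point n \<Sigma> p")
  case True
  then obtain U V and \<phi> \<psi> :: "'a \<Rightarrow> 'a" and L where *: "p \<in> U" "smooth_diffeo U V \<phi> \<psi>" "subspace L" "dim L = n" "\<phi> ` (U \<inter> \<Sigma>) = V \<inter> L"
    unfolding interior_point_def by blast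
  show thesis
    by (rule that[of U V \<phi> \<psi> L 0]) (use * in \<open>auto simp: slice_chart_def subspace_0\<close>)
next
  case False
  then have "boundary_point n \<Sigma> p" using assms by (auto simp: submanifold_def)
  then obtain U V and \<phi> \<psi> :: "'a \<Rightarrow> 'a" and L e where *: "p \<in> U" "smooth_diffeo U V \<phi> \<psi>" "subspace L" "dim L = n" "e \<in> L"
     "\<phi> ` (U \<inter> \<Sigma>) = V \<inter> {y \<in> L. 0 \<le> e \<bullet> y}"
    unfolding boundary_point_def by blast
  show thesis
    by (rule that[of U V \<phi> \<psi> L e]) (use * False in \<open>auto simp: slice_chart_def\<close>)
qed

lemma local_plane:
  fixes \<Sigma> :: "'a::euclidean_space set"
  assumes "submanifold n \<Sigma>" and ent: "entropy n \<Sigma> = 1" and p: "p \<in> \<Sigma>"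
  obtains W T where "open W" "p \<in> W" "subspace T" "dim T = n"
    "\<And>q. q \<in> W \<Longrightarrow> q \<in> \<Sigma> \<Longrightarrow> tangent_space \<Sigma> q = T \<and> q - p \<in> T"
    "interior_point n \<Sigma> p \<Longrightarrow> \<exists>r>0. \<forall>x\<in>T. norm x < r \<longrightarrow> p + x \<in> \<Sigma>"
proof -
  obtain U V \<phi> \<psi> L e where ch: "slice_chart U V \<phi> \<psi> L n" and pU: "p \<in> U" and e: "e \<in> L"
    and slice: "\<phi> ` (U \<inter> \<Sigma>) = V \<inter> {y \<in> L. 0 \<le> e \<bullet> y}" and e0: "interior_point n \<Sigma> p \<Longrightarrow> e = 0"
    by (rule submanifold_chart[OF assms(1) p]) (rule that)
  interpret slice_chart U V \<phi> \<psi> L n by (rule ch)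
  define H where "H = {y \<in> L. 0 \<le> e \<bullet> y}"
  define z0 where "z0 = \<phi> p"
  have z0: "z0 \<in> V" "z0 \<in> H" "\<psi> z0 = p" using slice pU p inv(4) by (auto simp: z0_def H_def)
  have \<Sigma>I: "\<psi> y \<in> \<Sigma>" if "y \<in> V" "y \<in> H" for y
  proof -
    have "y \<in> \<phi> ` (U \<inter> \<Sigma>)" using that slice by (auto simp: H_def)
    then show ?thesis using inv(4) by auto
  qed
  obtain r where r: "0 < r" "ball z0 r \<subseteq> V" using opens(2) z0(1) open_contains_ball by blast
  define D where "D = ball z0 r \<inter> H"
  have "convex H"
  proof -
    have "H = L \<inter> {y. 0 \<le> e \<bullet> y}" by (auto simp: H_def)
    then show ?thesis using convex_halfspace_ge[of 0 e] subspace_imp_convex[OF L(1)] by (auto intro: convex_Int)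
  qed
  then have D: "convex D" "D \<subseteq> V" "D \<subseteq> L" using r by (auto simp: D_def H_def intro: convex_Int)
  have tan_e: "dd\<psi> y a b \<in> tangent y" if y: "y \<in> V" "y \<in> L" "e \<noteq> 0 \<Longrightarrow> 0 < e \<bullet> y" and ab: "a \<in> L" "b \<in> L" for y a b
  proof -
    obtain d where d: "0 < d" "ball y d \<subseteq> V" using opens(2) y(1) open_contains_ball by blast
    \<comment> \<open>\<open>e \<bullet> y / norm e\<close> is the distance from \<open>y\<close> to
      the bounding hyperplane, so a full ball of \<open>L\<close> around \<open>y\<close> stays in
      the half-space.\<close>
    define \<delta> where "\<delta> = (if e = 0 then d else min d (e \<bullet> y / norm e))"
    have \<delta>: "0 < \<delta>" using d y by (auto simp: \<delta>_def)
    show ?thesis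
    proof (rule dd\<psi>_tangent_interior[OF ent y(1) \<delta> _ ab])
      fix v assume v: "v \<in> L" "norm v < \<delta>"
      have "\<delta> \<le> d" by (simp add: \<delta>_def)
      then have "y + v \<in> V" using d v by (auto simp: dist_norm)
      moreover have "y + v \<in> H"
      proof (cases "e = 0")
        case True
        then show ?thesis using y v L(1) by (simp add: H_def subspace_add)
      next
        case False
        then have "norm v < e \<bullet> y / norm e" using v by (simp add: \<delta>_def)
        then have "norm e * norm v < e \<bullet> y" using False by (simp add: pos_less_divide_eq mult.commute)
        moreover have "\<bar>e \<bullet> v\<bar> \<le> norm e * norm v" by (rule Cauchy_Schwarz_ineq2)
        ultimately have "0 \<le> e \<bullet> (y + v)" by (simp add: inner_add_right)
        then show ?thesis using y v L(1) by (simp add: H_def subspace_add)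
      qed
      ultimately show "\<psi> (y + v) \<in> \<Sigma>" by (rule \<Sigma>I)
    qed
  qed
  have tan: "dd\<psi> y a b \<in> tangent y" if y: "y \<in> D" and ab: "a \<in> L" "b \<in> L" for y a b
  proof -
    have yV: "y \<in> V" "y \<in> L" "0 \<le> e \<bullet> y" using y D by (auto simp: D_def H_def)
    obtain d where d: "0 < d" "ball y d \<subseteq> V" using opens(2) yV(1) open_contains_ball by blast
    \<comment> \<open>Moving from \<open>y\<close> along \<open>e\<close> enters the open
      half-space, where \<open>tan_e\<close> applies; this bound keeps the motion inside
      \<open>V\<close>.\<close>
    define \<delta> where "\<delta> = d / (norm e + 1)"
    have \<delta>: "0 < \<delta>" using d by (simp add: \<delta>_def add_nonneg_pos)
    show ?thesis
    proof (rule dd\<psi>_tangent_closed[OF yV(1) \<delta>])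
      fix s :: real assume s: "0 < s" "s < \<delta>"
      have "s * norm e \<le> s * (norm e + 1)" using s by (intro mult_left_mono) auto
      also have "\<dots> < \<delta> * (norm e + 1)" using s by (intro mult_strict_right_mono) (auto simp: add_nonneg_pos)
      also have "\<dots> = d" by (simp add: \<delta>_def add_nonneg_eq_0_iff)
      finally have V: "y + s *\<^sub>R e \<in> V" using d s by (auto simp: dist_norm)
      have "y + s *\<^sub>R e \<in> L" using yV e L(1) by (simp add: subspace_add subspace_scale)
      moreover have "0 < e \<bullet> (y + s *\<^sub>R e)" if "e \<noteq> 0"
        using yV(3) s that by (simp add: inner_add_right add_nonneg_pos)
      ultimately show "y + s *\<^sub>R e \<in> V \<and> dd\<psi> (y + s *\<^sub>R e) a b \<in> tangent (y + s *\<^sub>R e)"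
        using V tan_e ab by blast
    qed
  qed
  have z0D: "z0 \<in> D" using z0 r by (simp add: D_def)
  define T where "T = tangent z0"
  define W where "W = U \<inter> \<phi> -` ball z0 r"
  have "open W" unfolding W_def
    by (rule continuous_open_preimage[OF smooth_on_imp_continuous_on[OF smooth(1)] opens(1)]) simp
  moreover have "p \<in> W" using pU r by (simp add: W_def z0_def)
  moreover have "tangent_space \<Sigma> q = T \<and> q - p \<in> T" if "q \<in> W" "q \<in> \<Sigma>" for q
  proof -
    define z where "z = \<phi> q"
    have qU: "q \<in> U" using that by (simp add: W_def)
    have zD: "z \<in> D" using that slice qU by (auto simp: z_def D_def H_def W_def)
    have q: "q = \<psi> z" using inv(4)[OF qU] by (simp add: z_def)
    have "tangent_space \<Sigma> q = tangent z"
      unfolding q by (rule tangent_space_eq[OF slice]) (use zD D in \<open>auto simp: D_def H_def\<close>)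
    moreover have "tangent z = T" unfolding T_def by (rule tangent_constant[OF D z0D zD tan])
    moreover have "q - p \<in> T" unfolding T_def q z0(3)[symmetric] by (rule chart_in_plane[OF D z0D zD tan])
    ultimately show ?thesis by simp
  qed
  moreover have "\<exists>r>0. \<forall>x\<in>T. norm x < r \<longrightarrow> p + x \<in> \<Sigma>" if "interior_point n \<Sigma> p"
  proof -
    have H: "H = L" using e0[OF that] by (simp add: H_def)
    obtain \<tau> B u \<rho>0 where \<tau>: "orthonormal n \<tau>" "\<And>x. frame_proj n \<tau> x = x \<longleftrightarrow> x \<in> tangent z0"
      and u: "0 < \<rho>0" "u 0 = 0" "\<And>x i. x \<in> tangent z0 \<Longrightarrow> norm x \<le> \<rho>0 \<Longrightarrow> i < n \<Longrightarrow> u x \<bullet> \<tau> i = 0"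
      "\<And>x. x \<in> tangent z0 \<Longrightarrow> norm x \<le> \<rho>0 \<Longrightarrow> \<exists>y\<in>L. norm (d\<psi> z0 y) \<le> 2 * norm x \<and> \<psi> (z0 + y) = \<psi> z0 + x + u x"
      by (rule chart_graph[OF z0(1)]) (rule that)
    obtain K where K: "0 < K" "\<And>y. norm (d\<phi> z0 y) \<le> norm y * K"
      using bounded_linear.pos_bounded[OF linear_d(2)[OF z0(1)]] by blast
    define d where "d = min \<rho>0 (r / (2 * K))"
    have "0 < d" using u(1) r K by (simp add: d_def)
    moreover have "p + x \<in> \<Sigma>" if x: "x \<in> T" "norm x < d" for x
    proof -
      have xT: "x \<in> tangent z0" using x by (simp add: T_def)
      have x\<rho>: "norm x \<le> \<rho>0" "norm x < r / (2 * K)" using x by (auto simp: d_def)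
      obtain y where y: "y \<in> L" "norm (d\<psi> z0 y) \<le> 2 * norm x" "\<psi> (z0 + y) = \<psi> z0 + x + u x"
        using u(4)[OF xT x\<rho>(1)] by blast
      have "norm y \<le> norm (d\<psi> z0 y) * K" using K(2)[of "d\<psi> z0 y"] by (simp add: d_inverse(1)[OF z0(1)])
      also have "\<dots> \<le> (2 * norm x) * K" using y(2) K(1) by (intro mult_right_mono) auto
      also have "\<dots> < r" using x\<rho>(2) K(1) by (simp add: pos_less_divide_eq mult_ac)
      finally have yD: "z0 + y \<in> D" using y(1) z0(2) H L(1) by (simp add: D_def dist_norm subspace_add)
      \<comment> \<open>The chart stays in the plane and \<open>x\<close> is tangent, so
        \<open>u x\<close> is tangent; being also normal it is 0, and the graph is a piece of the
        plane itself.\<close>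
      have "x + u x \<in> tangent z0"
        using chart_in_plane[OF D z0D yD tan] unfolding y(3) by (simp add: add.assoc)
      then have "u x \<in> tangent z0" using subspace_diff[OF tangent(1)[OF z0(1)] _ xT] by fastforce
      then have "u x = frame_proj n \<tau> (u x)" using \<tau>(2)[of "u x"] by metis
      also have "\<dots> = 0" using u(3)[OF xT x\<rho>(1)] by (simp add: frame_proj_def lincomb_def)
      finally have "p + x = \<psi> (z0 + y)" using y(3) z0(3) by simp
      then show ?thesis using \<Sigma>I yD D(2) by (auto simp: D_def)
    qed
    ultimately show ?thesis by blast
  qed
  ultimately show thesis
    using that[of W T] tangent[OF z0(1)] unfolding T_def by blast
qed

text \<open>The definition uses a definite description, so existence and uniqueness are both due.
  The constant field \<open>v\<close> shows that 0 qualifies. Any other tangent extension takes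
  values in \<open>T\<close> along a curve of velocity \<open>u\<close>, so its derivative lies in
  \<open>T\<close>; then \<open>w\<close> is both in \<open>T\<close> and orthogonal to it.\<close>

lemma flat_of_local_plane:
  fixes \<Sigma> :: "'a::euclidean_space set"
  assumes "open W" "p \<in> W" "subspace T" and p: "p \<in> \<Sigma>"
    and tan: "\<And>q. q \<in> W \<Longrightarrow> q \<in> \<Sigma> \<Longrightarrow> tangent_space \<Sigma> q = T"
    and u: "u \<in> tangent_space \<Sigma> p" and v: "v \<in> tangent_space \<Sigma> p"
  shows "second_fundamental_form \<Sigma> p u v = 0"
  unfolding second_fundamental_form_def
proof (rule the_equality)
  have Tp: "tangent_space \<Sigma> p = T" using tan assms(2) p by blast
  show "0 \<in> (tangent_space \<Sigma> p)\<^sup>\<bottom> \<and> (\<exists>U Y. open U \<and> p \<in> U \<and> smooth_on Y U \<and>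
      (\<forall>q\<in>U \<inter> \<Sigma>. Y q \<in> tangent_space \<Sigma> q) \<and> Y p = v \<and> frechet_derivative Y (at p) u - 0 \<in> tangent_space \<Sigma> p)"
    using assms v Tp smooth_on_const[of v W] subspace_0[OF assms(3)]
    by (intro conjI exI[of _ W] exI[of _ "\<lambda>_. v"]) (auto simp: orthogonal_comp_def orthogonal_def)
  fix w assume w: "w \<in> (tangent_space \<Sigma> p)\<^sup>\<bottom> \<and> (\<exists>U Y. open U \<and> p \<in> U \<and> smooth_on Y U \<and>
      (\<forall>q\<in>U \<inter> \<Sigma>. Y q \<in> tangent_space \<Sigma> q) \<and> Y p = v \<and> frechet_derivative Y (at p) u - w \<in> tangent_space \<Sigma> p)"
  then obtain U Y where Y: "open U" "p \<in> U" "smooth_on Y U" "\<And>q. q \<in> U \<Longrightarrow> q \<in> \<Sigma> \<Longrightarrow> Y q \<in> tangent_space \<Sigma> q"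
    "frechet_derivative Y (at p) u - w \<in> T" unfolding Tp by blast
  have YT: "Y q \<in> T" if "q \<in> U \<inter> W" "q \<in> \<Sigma>" for q using Y(4)[of q] tan[of q] that by simp
  obtain \<epsilon> and \<gamma> :: "real \<Rightarrow> 'a" where \<gamma>: "0 < \<epsilon>" "\<gamma> 0 = p" "(\<gamma> has_vector_derivative u) (at 0)"
    "\<gamma> ` {0..<\<epsilon>} \<subseteq> \<Sigma> \<or> \<gamma> ` {-\<epsilon><..0} \<subseteq> \<Sigma>" using u by (auto simp: tangent_space_def)
  have "isCont \<gamma> 0" using \<gamma>(3) has_vector_derivative_continuous by blast
  then have "\<forall>\<^sub>F s in nhds 0. \<gamma> s \<in> U \<inter> W"
    using open_Int[OF Y(1) assms(1)] Y(2) assms(2) \<gamma>(2) unfolding continuous_at tendsto_def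
    by (auto simp: eventually_at_filter elim!: eventually_mono)
  then obtain d where d: "0 < d" "\<And>s. \<bar>s\<bar> < d \<Longrightarrow> \<gamma> s \<in> U \<inter> W"
    unfolding eventually_nhds_metric by (auto simp: dist_real_def)
  have derY: "(Y has_derivative frechet_derivative Y (at p)) (at (\<gamma> 0))"
    unfolding \<gamma>(2) by (rule smooth_on_has_derivative[OF Y(3,2)])
  have "((\<lambda>s. Y (\<gamma> s)) has_vector_derivative frechet_derivative Y (at p) u) (at 0)"
  proof -
    have "((\<lambda>s. Y (\<gamma> s)) has_derivative (\<lambda>h. frechet_derivative Y (at p) (h *\<^sub>R u))) (at 0)"
      by (rule has_derivative_compose[OF \<gamma>(3)[unfolded has_vector_derivative_def] derY])
    then show ?thesis
      by (simp add: has_vector_derivative_def linear_scale[OF has_derivative_linear[OF derY]])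
  qed
  then have "frechet_derivative Y (at p) u \<in> T"
  proof (rule one_sided_derivative_in_subspace[OF _ assms(3)])
    show "0 < min \<epsilon> d" using \<gamma>(1) d by simp
    have "Y (\<gamma> s) - Y (\<gamma> 0) \<in> T" if "\<bar>s\<bar> < d" "\<gamma> s \<in> \<Sigma>" for s
      using YT[OF d(2)[OF that(1)] that(2)] YT[of p] p Y(2) assms(2) \<gamma>(2) subspace_diff[OF assms(3)] by simp
    then show "(\<forall>s. 0 < s \<and> s < min \<epsilon> d \<longrightarrow> Y (\<gamma> s) - Y (\<gamma> 0) \<in> T) \<or>
        (\<forall>s. - min \<epsilon> d < s \<and> s < 0 \<longrightarrow> Y (\<gamma> s) - Y (\<gamma> 0) \<in> T)"
      using \<gamma>(4) by (auto simp: image_subset_iff)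
  qed
  from subspace_diff[OF assms(3) this Y(5)] have "w \<in> T" by simp
  then show "w = 0" using w unfolding Tp by (auto simp: orthogonal_comp_def orthogonal_def)
qed

theorem theorem1p1:
  fixes \<Sigma> :: "'a::euclidean_space set" and n k :: nat
  assumes "DIM('a) = n + k"
    and "submanifold n \<Sigma>"
    and "connected \<Sigma>"
    and "entropy n \<Sigma> = 1"
  shows "flat \<Sigma> \<and> (properly_embedded n \<Sigma> \<longrightarrow> is_plane n \<Sigma>)"
proof (intro conjI impI)
  define Q where "Q p W T \<longleftrightarrow> open W \<and> p \<in> W \<and> subspace T \<and> dim T = n \<and>
      (\<forall>q. q \<in> W \<and> q \<in> \<Sigma> \<longrightarrow> tangent_space \<Sigma> q = T \<and> q - p \<in> T) \<and>
      (interior_point n \<Sigma> p \<longrightarrow> (\<exists>r>0. \<forall>x\<in>T. norm x < r \<longrightarrow> p + x \<in> \<Sigma>))" for p W T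
  have "\<exists>W T. Q p W T" if "p \<in> \<Sigma>" for p
    by (rule local_plane[OF assms(2,4) that]) (unfold Q_def, blast)
  then obtain W T where Q: "\<And>p. p \<in> \<Sigma> \<Longrightarrow> Q p (W p) (T p)" by metis
  have WT: "open (W p)" "p \<in> W p" "subspace (T p)" "dim (T p) = n" if "p \<in> \<Sigma>" for p
    using Q[OF that] by (simp_all add: Q_def)
  have near: "tangent_space \<Sigma> q = T p" "q - p \<in> T p" if "p \<in> \<Sigma>" "q \<in> W p" "q \<in> \<Sigma>" for p q
    using Q[OF that(1)] that(2,3) by (simp_all add: Q_def)
  have inner: "\<exists>r>0. \<forall>x\<in>T p. norm x < r \<longrightarrow> p + x \<in> \<Sigma>" if "p \<in> \<Sigma>" "interior_point n \<Sigma> p" for p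
    using Q[OF that(1)] that(2) by (simp add: Q_def)
  show "flat \<Sigma>"
    unfolding flat_def
  proof (intro ballI)
    fix p u v assume p: "p \<in> \<Sigma>" and uv: "u \<in> tangent_space \<Sigma> p" "v \<in> tangent_space \<Sigma> p"
    show "second_fundamental_form \<Sigma> p u v = 0"
      by (rule flat_of_local_plane[OF WT(1-3)[OF p] p near(1)[OF p] uv])
  qed
  assume pe: "properly_embedded n \<Sigma>"
  have int: "interior_point n \<Sigma> p" if "p \<in> \<Sigma>" for p
    using pe that by (auto simp: properly_embedded_def manifold_boundary_def submanifold_def)
  have "\<Sigma> \<noteq> {}" using assms(4) by (auto simp: entropy_def)
  then obtain p0 where p0: "p0 \<in> \<Sigma>" by blast
  have tT: "tangent_space \<Sigma> p = T p" if "p \<in> \<Sigma>" for p by (rule near(1)[OF that WT(2)[OF that] that])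
  \<comment> \<open>The affine tangent plane at \<open>p\<close>, the quantity shown to be locally
    constant on \<Sigma>.\<close>
  define P where "P p = (\<lambda>x. p + x) ` T p" for p
  have loc: "P p = P q" if p: "p \<in> \<Sigma>" and q: "q \<in> \<Sigma>" "q \<in> W p" for p q
  proof -
    have "T q = T p" using near(1)[OF p q(2,1)] tT[OF q(1)] by simp
    moreover have d: "q - p \<in> T p" by (rule near(2)[OF p q(2,1)])
    moreover have "(\<lambda>x. p + x) ` T p = (\<lambda>x. q + x) ` T p"
    proof (intro set_eqI iffI)
      fix y assume "y \<in> (\<lambda>x. p + x) ` T p"
      then obtain x where "x \<in> T p" "y = p + x" by auto
      then show "y \<in> (\<lambda>x. q + x) ` T p"
        using subspace_diff[OF WT(3)[OF p] _ d] by (intro image_eqI[of _ _ "x - (q - p)"]) auto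
    next
      fix y assume "y \<in> (\<lambda>x. q + x) ` T p"
      then obtain x where "x \<in> T p" "y = q + x" by auto
      then show "y \<in> (\<lambda>x. p + x) ` T p"
        using subspace_add[OF WT(3)[OF p] _ d] by (intro image_eqI[of _ _ "x + (q - p)"]) auto
    qed
    ultimately show ?thesis by (simp add: P_def)
  qed
  have PP: "P p = P p0" if "p \<in> \<Sigma>" for p
  proof (rule connected_local_const[OF assms(3) that p0])
    show "\<forall>a\<in>\<Sigma>. \<forall>\<^sub>F b in at a within \<Sigma>. P a = P b"
    proof
      fix a assume a: "a \<in> \<Sigma>"
      show "\<forall>\<^sub>F b in at a within \<Sigma>. P a = P b"
        unfolding eventually_at_topological using WT(1,2)[OF a] loc[OF a] by blast
    qed
  qed
  have aff: "affine (P p0)" "aff_dim (P p0) = int n"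
    unfolding P_def using WT(3,4)[OF p0]
    by (auto simp: affine_translation[symmetric] subspace_imp_affine aff_dim_translation_eq aff_dim_subspace)
  have sub: "\<Sigma> \<subseteq> P p0"
  proof
    fix p assume p: "p \<in> \<Sigma>"
    have "p \<in> P p" using subspace_0[OF WT(3)[OF p]] by (auto simp: P_def)
    then show "p \<in> P p0" using PP[OF p] by simp
  qed
  have "closed \<Sigma>"
  proof -
    \<comment> \<open>Properness concerns compact sets only, so the limit point is enclosed in a
      closed unit ball.\<close>
    have "x \<in> \<Sigma>" if "x \<in> closure \<Sigma>" for x
    proof -
      have "compact (\<Sigma> \<inter> cball x 1)" using pe by (simp add: properly_embedded_def)
      then have "closure (\<Sigma> \<inter> cball x 1) = \<Sigma> \<inter> cball x 1" by (intro closure_closed compact_imp_closed)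
      moreover have "x \<in> closure (ball x 1 \<inter> \<Sigma>)"
        using open_Int_closure_subset[OF open_ball, of x 1 \<Sigma>] that by auto
      moreover have "closure (ball x 1 \<inter> \<Sigma>) \<subseteq> closure (\<Sigma> \<inter> cball x 1)" by (intro closure_mono) auto
      ultimately show ?thesis by blast
    qed
    then show ?thesis using closure_subset_eq[of \<Sigma>] by blast
  qed
  then have cl: "closedin (top_of_set (P p0)) \<Sigma>" using sub closed_subset by blast
  \<comment> \<open>With empty boundary every point has a full ball of its tangent plane in
    \<Sigma>. Being open, closed and nonempty in a connected plane, \<Sigma> is all of it.\<close>
  have op: "openin (top_of_set (P p0)) \<Sigma>"
    unfolding openin_euclidean_subtopology_iff
  proof (intro conjI ballI sub)
    fix p assume p: "p \<in> \<Sigma>"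
    obtain r where r: "0 < r" "\<And>x. x \<in> T p \<Longrightarrow> norm x < r \<Longrightarrow> p + x \<in> \<Sigma>"
      using inner[OF p int[OF p]] by blast
    have "y \<in> \<Sigma>" if "y \<in> P p0" "dist y p < r" for y
    proof -
      have "y \<in> P p" using that PP[OF p] by simp
      then obtain x where "x \<in> T p" "y = p + x" by (auto simp: P_def)
      then show ?thesis using r(2) that(2) by (simp add: dist_norm)
    qed
    then show "\<exists>e>0. \<forall>x'\<in>P p0. dist x' p < e \<longrightarrow> x' \<in> \<Sigma>" using r(1) by blast
  qed
  have "connected (P p0)" using aff(1) affine_imp_convex convex_connected by blast
  then have "\<Sigma> = P p0" using op cl \<open>\<Sigma> \<noteq> {}\<close> unfolding connected_clopen by blast
  then show "is_plane n \<Sigma>" using aff by (simp add: is_plane_def)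
qed

end
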